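(* Let $m>n\ge 1$ be integers, $\nu>\beta(m-1)$ real, let $\mathbf{T}\sim\mathcal{T}_{m\times n}^\beta(\nu,\mathbf{0},\mathbf{I}_m,\mathbf{I}_n)$ and let $\widetilde{\mathbf{F}}=\mathbf{T}^{*}\mathbf{T}\in\mathfrak{P}_n^\beta$. Then $\widetilde{\mathbf{F}}$ has the density $$\frac{1}{\mathcal{B}_n^\beta[\beta(\nu+n-m)/2,\beta m/2]}\,|\widetilde{\mathbf{F}}|^{\beta(m-n+1)/2-1}\,|\mathbf{I}_n+\widetilde{\mathbf{F}}|^{-\beta(n+\nu)/2},\qquad \widetilde{\mathbf{F}}\in\mathfrak{P}_n^\beta.$$
   Context: Let $\beta\in\{1,2,4\}$ and let $\mathfrak{F}$ be the real numbers ($\beta=1$), the complex numbers ($\beta=2$) or the quaternions ($\beta=4$). $\mathfrak{F}^{m\times n}$ is the set of $m\times n$ matrices over $\mathfrak{F}$, and $\mathbf{A}^{*}$ is the conjugate transpose. $\mathfrak{P}_p^\beta$ is the cone of $p\times p$ positive definite Hermitian ($\mathbf{A}=\mathbf{A}^*$) matrices over $\mathfrak{F}$; for $\mathbf{A}\in\mathfrak{P}_p^\beta$, $|\mathbf{A}|$ is the product of its $p$ (positive real) eigenvalues. Densities on $\mathfrak{F}^{m\times n}$ are with respect to Lebesgue measure in the $\beta mn$ real components of the entries. Densities on $\mathfrak{P}_p^\beta$ are with respect to the product of the Lebesgue measures of the $p$ real diagonal entries and of the $\beta$ real components of each entry above the diagonal. $\Gamma_p^\beta[a]=\pi^{p(p-1)\beta/4}\prod_{i=1}^p\Gamma(a-(i-1)\beta/2)$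 for $a>(p-1)\beta/2$, and $\mathcal{B}_p^\beta[b,a]=\Gamma_p^\beta[a]\Gamma_p^\beta[b]/\Gamma_p^\beta[a+b]$. $\mathbf{T}\sim\mathcal{T}_{m\times n}^\beta(\nu,\mathbf{0},\mathbf{I}_m,\mathbf{I}_n)$ means that $\mathbf{T}\in\mathfrak{F}^{m\times n}$ has density $$\frac{\Gamma_m^\beta[\beta(n+\nu)/2]}{\pi^{mn\beta/2}\,\Gamma_m^\beta[\beta\nu/2]}\;|\mathbf{I}_m+\mathbf{T}\mathbf{T}^{*}|^{-\beta(n+\nu)/2}.$$ The distribution of $\widetilde{\mathbf{F}}$ is also called a matricvariate beta type II distribution. *)

theory Defs
  imports "HOL-Probability.Probability"
begin

section \<open>The quaternions\<close>

datatype quat = Quat (qre: real) (qi: real) (qj: real) (qk: real)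

lemma quat_eq_iff: "x = y \<longleftrightarrow> qre x = qre y \<and> qi x = qi y \<and> qj x = qj y \<and> qk x = qk y"
  by (cases x; cases y) auto

instantiation quat :: real_vector
begin

definition "0 = Quat 0 0 0 0"
definition "x + y = Quat (qre x + qre y) (qi x + qi y) (qj x + qj y) (qk x + qk y)"
definition "- x = Quat (- qre x) (- qi x) (- qj x) (- qk x)"
definition "x - y = Quat (qre x - qre y) (qi x - qi y) (qj x - qj y) (qk x - qk y)"
definition "r *\<^sub>R x = Quat (r * qre x) (r * qi x) (r * qj x) (r * qk x)"

instance
  by standard
    (auto simp: quat_eq_iff zero_quat_def plus_quat_def uminus_quat_def minus_quat_def
      scaleR_quat_def algebra_simps)

end

lemma quat_zero_sel [simp]: "qre 0 = 0" "qi 0 = 0" "qj 0 = 0" "qk 0 = 0"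
  by (simp_all add: zero_quat_def)

lemma quat_plus_sel [simp]:
  "qre (x + y) = qre x + qre y" "qi (x + y) = qi x + qi y"
  "qj (x + y) = qj x + qj y" "qk (x + y) = qk x + qk y"
  by (simp_all add: plus_quat_def)

lemma quat_uminus_sel [simp]:
  "qre (- x) = - qre x" "qi (- x) = - qi x" "qj (- x) = - qj x" "qk (- x) = - qk x"
  by (simp_all add: uminus_quat_def)

lemma quat_minus_sel [simp]:
  "qre (x - y) = qre x - qre y" "qi (x - y) = qi x - qi y"
  "qj (x - y) = qj x - qj y" "qk (x - y) = qk x - qk y"
  by (simp_all add: minus_quat_def)

lemma quat_scaleR_sel [simp]:
  "qre (r *\<^sub>R x) = r * qre x" "qi (r *\<^sub>R x) = r * qi x"
  "qj (r *\<^sub>R x) = r * qj x" "qk (r *\<^sub>R x) = r * qk x"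
  by (simp_all add: scaleR_quat_def)

instantiation quat :: real_algebra_1
begin

definition "1 = Quat 1 0 0 0"

definition "x * y = Quat
  (qre x * qre y - qi x * qi y - qj x * qj y - qk x * qk y)
  (qre x * qi y + qi x * qre y + qj x * qk y - qk x * qj y)
  (qre x * qj y - qi x * qk y + qj x * qre y + qk x * qi y)
  (qre x * qk y + qi x * qj y - qj x * qi y + qk x * qre y)"

instance
  by standard (auto simp: quat_eq_iff one_quat_def times_quat_def algebra_simps)

end

lemma quat_one_sel [simp]: "qre 1 = 1" "qi 1 = 0" "qj 1 = 0" "qk 1 = 0"
  by (simp_all add: one_quat_def)

lemma quat_times_sel [simp]:
  "qre (x * y) = qre x * qre y - qi x * qi y - qj x * qj y - qk x * qk y"
  "qi (x * y) = qre x * qi y + qi x * qre y + qj x * qk y - qk x * qj y"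
  "qj (x * y) = qre x * qj y - qi x * qk y + qj x * qre y + qk x * qi y"
  "qk (x * y) = qre x * qk y + qi x * qj y - qj x * qi y + qk x * qre y"
  by (simp_all add: times_quat_def)

instantiation quat :: real_inner
begin

definition "x \<bullet> y = qre x * qre y + qi x * qi y + qj x * qj y + qk x * qk y"

definition "norm (x :: quat) = sqrt (x \<bullet> x)"

definition "sgn (x :: quat) = x /\<^sub>R norm x"

definition "dist x y = norm (x - y :: quat)"

definition [code del]:
  "(uniformity :: (quat \<times> quat) filter) = (INF e\<in>{0 <..}. principal {(x, y). dist x y < e})"

definition [code del]:
  "open (U :: quat set) \<longleftrightarrow> (\<forall>x\<in>U. eventually (\<lambda>(x', y). x' = x \<longrightarrow> y \<in> U) uniformity)"

instance
proof
  fix x y z :: quat and r :: real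
  show "x \<bullet> y = y \<bullet> x" by (simp add: inner_quat_def mult.commute)
  show "(x + y) \<bullet> z = x \<bullet> z + y \<bullet> z" by (simp add: inner_quat_def algebra_simps)
  show "(r *\<^sub>R x) \<bullet> y = r * (x \<bullet> y)" by (simp add: inner_quat_def algebra_simps)
  show "0 \<le> x \<bullet> x" by (simp add: inner_quat_def)
  show "x \<bullet> x = 0 \<longleftrightarrow> x = 0"
    by (simp add: inner_quat_def quat_eq_iff add_nonneg_eq_0_iff)
qed (simp_all add: norm_quat_def sgn_quat_def dist_quat_def uniformity_quat_def open_quat_def)

end

definition quat_cnj :: "quat \<Rightarrow> quat"
  where "quat_cnj x = Quat (qre x) (- qi x) (- qj x) (- qk x)"

lemma quat_cnj_sel [simp]:
  "qre (quat_cnj x) = qre x" "qi (quat_cnj x) = - qi x"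
  "qj (quat_cnj x) = - qj x" "qk (quat_cnj x) = - qk x"
  by (simp_all add: quat_cnj_def)

lemma quat_norm_squared: "(norm x)\<^sup>2 = (qre x)\<^sup>2 + (qi x)\<^sup>2 + (qj x)\<^sup>2 + (qk x)\<^sup>2"
  unfolding power2_norm_eq_inner by (simp add: inner_quat_def power2_eq_square)

lemma quat_mult_cnj: "x * quat_cnj x = (norm x)\<^sup>2 *\<^sub>R 1"
  unfolding quat_norm_squared by (simp add: quat_eq_iff power2_eq_square)

instantiation quat :: real_normed_div_algebra
begin

definition "inverse (x :: quat) = quat_cnj x /\<^sub>R (norm x)\<^sup>2"

definition "x div y = x * inverse (y :: quat)"

instance
proof
  fix x y :: quat
  show "norm (x * y) = norm x * norm y"
  proof (rule power2_eq_imp_eq)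
    show "(norm (x * y))\<^sup>2 = (norm x * norm y)\<^sup>2"
      unfolding power_mult_distrib quat_norm_squared by (simp add: power2_eq_square algebra_simps)
  qed simp_all
  show "inverse (0 :: quat) = 0"
    by (simp add: inverse_quat_def)
  assume "x \<noteq> 0"
  then have "(norm x)\<^sup>2 \<noteq> 0" by simp
  then show "x * inverse x = 1"
    by (simp add: inverse_quat_def quat_mult_cnj)
  have "quat_cnj x * x = (norm x)\<^sup>2 *\<^sub>R 1"
    unfolding quat_norm_squared by (simp add: quat_eq_iff power2_eq_square)
  with \<open>(norm x)\<^sup>2 \<noteq> 0\<close> show "inverse x * x = 1"
    by (simp add: inverse_quat_def)
qed (simp_all add: divide_quat_def)

end

instantiation quat :: euclidean_space
begin

definition "Basis = {Quat 1 0 0 0, Quat 0 1 0 0, Quat 0 0 1 0, Quat 0 0 0 1}"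

instance
proof
  fix x :: quat
  show "(\<forall>u\<in>Basis. x \<bullet> u = 0) \<longleftrightarrow> x = 0"
    by (cases x) (simp add: Basis_quat_def inner_quat_def zero_quat_def)
qed (auto simp: Basis_quat_def inner_quat_def)

end

lemma DIM_quat [simp]: "DIM(quat) = 4"
  by (simp add: Basis_quat_def)


section \<open>Conjugation on the real, complex and quaternionic numbers\<close>

text \<open>
  The class only serves to give the definitions below for the three types
  \<open>real\<close>, \<open>complex\<close> and \<open>quat\<close> at once.
\<close>
class conj_div_algebra = real_normed_div_algebra + euclidean_space +
  fixes conjugate :: "'a \<Rightarrow> 'a"
  assumes conjugate_add: "conjugate (x + y) = conjugate x + conjugate y"
    and conjugate_scaleR: "conjugate (r *\<^sub>R x) = r *\<^sub>R conjugate x"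
    and conjugate_mult: "conjugate (x * y) = conjugate y * conjugate x"
    and conjugate_conjugate: "conjugate (conjugate x) = x"
    and mult_conjugate: "x * conjugate x = (norm x)\<^sup>2 *\<^sub>R 1"

instantiation real :: conj_div_algebra
begin
definition "conjugate (x :: real) = x"
instance by standard (simp_all add: conjugate_real_def power2_eq_square)
end

instantiation complex :: conj_div_algebra
begin
definition "conjugate (x :: complex) = cnj x"
instance
proof
  fix x y :: complex and r :: real
  show "x * conjugate x = (norm x)\<^sup>2 *\<^sub>R 1"
    by (simp only: conjugate_complex_def scaleR_conv_of_real complex_norm_square mult_1_right)
qed (simp_all add: conjugate_complex_def complex_eq_iff)
end

instantiation quat :: conj_div_algebra
begin
definition "conjugate (x :: quat) = quat_cnj x"
instance
  by standard (simp_all add: conjugate_quat_def quat_mult_cnj quat_eq_iff algebra_simps)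
end


section \<open>Hermitian matrices\<close>

definition conj_transpose :: "'a::conj_div_algebra^'n^'m \<Rightarrow> 'a^'m^'n"
  where "conj_transpose A = (\<chi> i j. conjugate (A $ j $ i))"

definition pos_def_cone :: "('a::conj_div_algebra^'n^'n) set"
  where "pos_def_cone = {A. conj_transpose A = A \<and>
    (\<forall>x. x \<noteq> 0 \<longrightarrow> (\<exists>r>0. (\<Sum>i\<in>UNIV. conjugate (x $ i) * (A *v x) $ i) = of_real r))}"

definition eigenspace :: "'a::conj_div_algebra^'n^'n \<Rightarrow> real \<Rightarrow> ('a^'n) set"
  where "eigenspace A l = {x. A *v x = l *\<^sub>R x}"

text \<open>
  The product of the eigenvalues of a Hermitian matrix, counted with multiplicity.
  All eigenvalues of a Hermitian matrix are real (for quaternions this refers to right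
  eigenvalues, \<open>A x = x l\<close>; a real \<open>l\<close> is central). The multiplicity of \<open>l\<close> is the dimension
  of its eigenspace over the ground field or skew field, which is the real
  dimension \<open>dim\<close> divided by the dimension of \<open>'a\<close> over the reals. For matrices that are not
  Hermitian the value has no meaning.
\<close>
definition herm_det :: "'a::conj_div_algebra^'n^'n \<Rightarrow> real"
  where "herm_det A =
    (\<Prod>l \<in> {l. \<exists>x\<in>eigenspace A l. x \<noteq> 0}. l ^ (dim (eigenspace A l) div DIM('a)))"

text \<open>
  Lebesgue measure on the Hermitian matrices, as a measure on all square matrices that is
  concentrated on the Hermitian ones: the image of the product of the Lebesgue measures of the
  real diagonal entries \<open>d\<close> and of the entries \<open>u\<close> above the diagonal. The linear
  order on the index type only serves to say which entries are above the diagonal.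
\<close>
definition hermitian_of ::
    "('n \<Rightarrow> real) \<times> ('n \<times> 'n \<Rightarrow> 'a) \<Rightarrow> 'a::conj_div_algebra^'n::{finite,linorder}^'n::{finite,linorder}"
  where "hermitian_of = (\<lambda>(d, u). \<chi> i j.
    if i = j then of_real (d i) else if i < j then u (i, j) else conjugate (u (j, i)))"

abbreviation hermitian_coords :: "(('n::{finite,linorder} \<Rightarrow> real) \<times> ('n \<times> 'n \<Rightarrow> 'a::conj_div_algebra)) measure"
  where "hermitian_coords \<equiv>
    (\<Pi>\<^sub>M i\<in>UNIV. lborel) \<Otimes>\<^sub>M (\<Pi>\<^sub>M p\<in>{(i, j). i < j}. lborel)"

definition hermitian_lborel :: "('a::conj_div_algebra^'n::{finite,linorder}^'n::{finite,linorder}) measure"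
  where "hermitian_lborel = distr hermitian_coords borel hermitian_of"

lemma measurable_conjugate: "conjugate \<in> borel_measurable (borel :: 'a::conj_div_algebra measure)"
proof -
  have "linear (conjugate :: 'a \<Rightarrow> 'a)"
    by (rule linearI) (simp_all add: conjugate_add conjugate_scaleR)
  then show ?thesis
    unfolding linear_conv_bounded_linear
    by (rule borel_measurable_continuous_onI[OF linear_continuous_on])
qed

text \<open>This ensures that the image measure above is not degenerate.\<close>
lemma measurable_hermitian_of:
  "(hermitian_of :: _ \<Rightarrow> 'a::conj_div_algebra^'n::{finite,linorder}^'n::{finite,linorder})
    \<in> measurable hermitian_coords borel"
proof -
  let ?h = "hermitian_of :: _ \<Rightarrow> (('a, 'n) vec, 'n) vec"
  let ?C = "hermitian_coords :: (('n \<Rightarrow> real) \<times> ('n \<times> 'n \<Rightarrow> 'a)) measure"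
  have lborel_to_borel: "g \<in> borel_measurable N" if "g \<in> measurable N lborel"
    for N and g :: "_ \<Rightarrow> 'b::euclidean_space"
    using that by (simp only: measurable_cong_sets[OF refl sets_lborel])
  have diag: "(\<lambda>x. fst x i) \<in> borel_measurable ?C" for i
    by (rule lborel_to_borel, rule measurable_compose[OF measurable_fst measurable_component_singleton]) simp
  have off_diag: "(\<lambda>x. snd x (i, j)) \<in> borel_measurable ?C" if "i < j" for i j
    by (rule lborel_to_borel, rule measurable_compose[OF measurable_snd measurable_component_singleton])
      (use that in simp)
  have of_real: "(of_real :: real \<Rightarrow> 'a) \<in> borel_measurable borel"
    by (rule borel_measurable_continuous_onI) (rule continuous_on_of_real_id)
  have entry: "(\<lambda>x. ?h x $ i $ j) \<in> borel_measurable ?C" for i j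
  proof -
    consider "i = j" | "i < j" | "j < i" by force
    then show ?thesis
    proof cases
      case 1
      then have "(\<lambda>x. ?h x $ i $ j) = (\<lambda>x. of_real (fst x i))"
        by (simp add: hermitian_of_def case_prod_beta)
      then show ?thesis
        by (simp only: measurable_compose[OF diag of_real])
    next
      case 2
      then have "(\<lambda>x. ?h x $ i $ j) = (\<lambda>x. snd x (i, j))"
        by (auto simp: hermitian_of_def case_prod_beta fun_eq_iff)
      then show ?thesis
        by (simp only: off_diag[OF 2])
    next
      case 3
      then have "(\<lambda>x. ?h x $ i $ j) = (\<lambda>x. conjugate (snd x (j, i)))"
        by (auto simp: hermitian_of_def case_prod_beta fun_eq_iff)
      then show ?thesis
        by (simp only: measurable_compose[OF off_diag[OF 3] measurable_conjugate])
    qed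
  qed
  have "(\<lambda>x. ?h x \<bullet> b) \<in> borel_measurable ?C" if b: "b \<in> Basis" for b
  proof -
    from b obtain i j u where "b = axis i (axis j u)"
      by (auto simp: Basis_vec_def)
    then have "(\<lambda>x. ?h x \<bullet> b) = (\<lambda>x. ?h x $ i $ j \<bullet> u)"
      by (simp add: inner_axis)
    then show ?thesis
      by (simp only: borel_measurable_inner[OF entry borel_measurable_const])
  qed
  then have "?h \<in> borel_measurable ?C"
    using borel_measurable_euclidean_space[of ?h ?C] by blast
  then show ?thesis .
qed


section \<open>The densities\<close>

definition multi_Gamma :: "real \<Rightarrow> nat \<Rightarrow> real \<Rightarrow> real"
  where "multi_Gamma \<beta> p a =
    pi powr (real p * (real p - 1) * \<beta> / 4) * (\<Prod>i=1..p. Gamma (a - (real i - 1) * \<beta> / 2))"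

definition multi_Beta :: "real \<Rightarrow> nat \<Rightarrow> real \<Rightarrow> real \<Rightarrow> real"
  where "multi_Beta \<beta> p b a = multi_Gamma \<beta> p a * multi_Gamma \<beta> p b / multi_Gamma \<beta> p (a + b)"

definition matricvariate_T_density :: "real \<Rightarrow> real \<Rightarrow> 'a::conj_div_algebra^'n^'m \<Rightarrow> real"
  where "matricvariate_T_density \<beta> \<nu> T =
    (let m = CARD('m); n = CARD('n) in
      multi_Gamma \<beta> m (\<beta> * (real n + \<nu>) / 2) /
        (pi powr (real m * real n * \<beta> / 2) * multi_Gamma \<beta> m (\<beta> * \<nu> / 2)) *
      herm_det (mat 1 + T ** conj_transpose T) powr (- (\<beta> * (real n + \<nu>) / 2)))"

text \<open>The density is zero outside the cone of positive definite matrices.\<close>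
definition matricvariate_beta_II_density ::
    "real \<Rightarrow> nat \<Rightarrow> real \<Rightarrow> 'a::conj_div_algebra^'n^'n \<Rightarrow> real"
  where "matricvariate_beta_II_density \<beta> m \<nu> F =
    (let n = CARD('n) in
      if F \<in> pos_def_cone then
        1 / multi_Beta \<beta> n (\<beta> * (\<nu> + real n - real m) / 2) (\<beta> * real m / 2) *
        herm_det F powr (\<beta> * (real m - real n + 1) / 2 - 1) *
        herm_det (mat 1 + F) powr (- (\<beta> * (real n + \<nu>) / 2))
      else 0)"

end

theory Submission
  imports Defs
begin

text \<open>
  The Gram matrix of \<open>T\<close> is built up column by column. Given columns with positive definite Gram
  matrix \<open>P\<close>, a new column \<open>x\<close> contributes its inner products \<open>b\<close> with the old columns and its
  squared norm \<open>s\<close>. In coordinates adapted to an orthonormal basis of the span of the old columns,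
  Lebesgue measure in \<open>x\<close> splits into Lebesgue measure on the span and the measure
  \<open>c r^(\<beta>(m - k)/2 - 1) dr\<close> for the squared distance \<open>r = s - b\<^sup>* P\<inverse> b\<close> to it, where \<open>k\<close> is the
  number of old columns; passing from the span to \<open>b\<close> costs the factor \<open>|P|^(-\<beta>/2)\<close>. As \<open>r\<close> is the
  quotient of the two determinants, the powers of \<open>|P|\<close> telescope. So the image of Lebesgue measure
  under \<open>T \<mapsto> T\<^sup>* T\<close> has a density that is a power of the determinant, and the theorem follows,
  since by Sylvester's identity the density of \<open>T\<close> depends on \<open>T\<^sup>* T\<close> only.

  Over the quaternions there is no multiplicative determinant to work with. Its role is taken by the
  determinant of \<open>x \<mapsto> A x\<close> as a real linear map, which by the spectral theorem is the power \<open>\<beta>\<close> of the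
  product of the eigenvalues when \<open>A\<close> is Hermitian.
\<close>

section \<open>The determinant of a linear map\<close>

text \<open>The induction runs over sets of columns within one type and integrates an arbitrary
  function of the Gram matrix: the integral over the new column, almost everywhere a function of the
  old Gram matrix alone, can then be fed to the induction hypothesis. Applied to the indicator of
  the complement of the cone, the same hypothesis shows that dependent columns are negligible.
  Columns are added in increasing order of the index, so the new off-diagonal entries are entries
  above the diagonal and no conjugation has to be undone.

  As \<open>edet\<close> is the power \<beta> of \<open>herm_det\<close>, exponents are those of the
  theorem divided by \<beta>. With c columns the exponent is (m - c + 1)/2 - 1/\<beta>. The radial
  part removes (m - c)/2 - 1/\<beta> and the Jacobian 1/2, which cancels it; the enlarged
  determinant is left with (m - c)/2 - 1/\<beta>, the same formula for c + 1.

  The constants pi^a / Gamma(a) with a = \<beta> (m - c)/2 are half the areas of unit spheres in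
  real dimension 2a. Together with the constant of T they give the Beta function because the Gamma
  factors involved form one product of m + n terms, cut after m or after n.\<close>

text \<open>
  The library has determinants, and their relation to Lebesgue measure, only for \<open>real^'n\<close> with a
  well-ordered finite \<open>'n\<close>; this index type makes them available on every Euclidean space.
\<close>
typedef (overloaded) 'a dim_index = "{..<DIM('a::euclidean_space)}"
  using DIM_positive by blast

setup_lifting type_definition_dim_index

instantiation dim_index :: (euclidean_space) linorder
begin
lift_definition less_eq_dim_index :: "'a dim_index \<Rightarrow> 'a dim_index \<Rightarrow> bool" is "(\<le>)" .
lift_definition less_dim_index :: "'a dim_index \<Rightarrow> 'a dim_index \<Rightarrow> bool" is "(<)" .
instance by (standard; transfer) auto
end

lemma bij_betw_Rep_dim_index:
  "bij_betw (Rep_dim_index :: 'a::euclidean_space dim_index \<Rightarrow> nat) UNIV {..<DIM('a)}"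
  using type_definition.Rep_range[OF type_definition_dim_index]
  by (auto simp: bij_betw_def inj_on_def Rep_dim_index_inject)

instance dim_index :: (euclidean_space) finite
  by standard (simp add: bij_betw_finite[OF bij_betw_Rep_dim_index])

instance dim_index :: (euclidean_space) wellorder
proof
  fix P :: "'a dim_index \<Rightarrow> bool" and a :: "'a dim_index"
  assume step: "\<And>x. (\<And>y. y < x \<Longrightarrow> P y) \<Longrightarrow> P x"
  show "P a"
  proof (induction "Rep_dim_index a" arbitrary: a rule: less_induct)
    case less
    show ?case by (rule step, rule less) (simp add: less_dim_index.rep_eq)
  qed
qed

section \<open>Orthonormal coordinates on a Euclidean space\<close>

definition basis_enum :: "'a::euclidean_space dim_index \<Rightarrow> 'a" where
  "basis_enum = (SOME e. bij_betw e UNIV Basis)"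

lemma bij_betw_basis_enum: "bij_betw (basis_enum :: 'a::euclidean_space dim_index \<Rightarrow> 'a) UNIV Basis"
proof -
  have "card (UNIV :: 'a dim_index set) = DIM('a)"
    using bij_betw_same_card[OF bij_betw_Rep_dim_index] by simp
  then have "\<exists>e :: 'a dim_index \<Rightarrow> 'a. bij_betw e UNIV Basis"
    by (intro finite_same_card_bij) auto
  then show ?thesis unfolding basis_enum_def by (rule someI_ex)
qed

lemma sum_basis_enum: "(\<Sum>i\<in>UNIV. F (basis_enum i)) = (\<Sum>b\<in>Basis. F b)"
  by (rule sum.reindex_bij_betw[OF bij_betw_basis_enum])

lemma prod_basis_enum: "(\<Prod>i\<in>UNIV. F (basis_enum i)) = (\<Prod>b\<in>Basis. F b)"
  by (rule prod.reindex_bij_betw[OF bij_betw_basis_enum])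

lemma basis_enum_in [simp]: "basis_enum i \<in> Basis"
  using bij_betw_basis_enum by (auto simp: bij_betw_def)

lemma inner_basis_enum: "basis_enum i \<bullet> basis_enum j = (if i = j then 1 else 0)"
  using bij_betw_basis_enum by (auto simp: inner_Basis bij_betw_def inj_on_def)

definition ecoord :: "'a::euclidean_space \<Rightarrow> real ^ 'a dim_index" where
  "ecoord x = (\<chi> i. x \<bullet> basis_enum i)"

definition euncoord :: "real ^ 'a dim_index \<Rightarrow> 'a::euclidean_space" where
  "euncoord v = (\<Sum>i\<in>UNIV. v $ i *\<^sub>R basis_enum i)"

lemma ecoord_euncoord [simp]: "ecoord (euncoord v) = v"
  by (simp add: vec_eq_iff ecoord_def euncoord_def inner_sum_left inner_basis_enum sum.delta if_distrib cong: if_cong)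

lemma euncoord_ecoord [simp]: "euncoord (ecoord x) = x"
proof -
  have "euncoord (ecoord x) = (\<Sum>i\<in>UNIV. (x \<bullet> basis_enum i) *\<^sub>R basis_enum i)"
    by (simp add: ecoord_def euncoord_def)
  also have "\<dots> = x" by (simp add: sum_basis_enum[of "\<lambda>b. (x \<bullet> b) *\<^sub>R b"] euclidean_representation)
  finally show ?thesis .
qed

lemma linear_ecoord: "linear ecoord"
  by (rule linearI) (simp_all add: ecoord_def vec_eq_iff inner_add_left)

lemma linear_euncoord: "linear euncoord"
  by (rule linearI) (simp_all add: euncoord_def scaleR_add_left sum.distrib scaleR_sum_right)

lemma borel_measurable_linear:
  fixes f :: "'a::euclidean_space \<Rightarrow> 'b::euclidean_space"
  assumes "linear f" shows "f \<in> borel_measurable borel"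
  using assms linear_continuous_on[of f UNIV]
  by (intro borel_measurable_continuous_onI) (simp add: linear_conv_bounded_linear)

lemma vimage_euncoord: "euncoord -` S = ecoord ` S"
  by (auto simp: image_iff) (metis ecoord_euncoord)

lemma euncoord_vimage_box: "euncoord -` box l u = box (ecoord l) (ecoord u)"
proof -
  have "v \<in> euncoord -` box l u \<longleftrightarrow> v \<in> box (ecoord l) (ecoord u)" for v
  proof -
    have e: "euncoord v \<bullet> basis_enum i = v $ i" for i
      using ecoord_euncoord[of v] by (metis ecoord_def vec_lambda_beta)
    have "v \<in> euncoord -` box l u \<longleftrightarrow> (\<forall>b\<in>Basis. l \<bullet> b < euncoord v \<bullet> b \<and> euncoord v \<bullet> b < u \<bullet> b)"
      by (simp add: mem_box)
    also have "\<dots> \<longleftrightarrow> (\<forall>i. l \<bullet> basis_enum i < v $ i \<and> v $ i < u \<bullet> basis_enum i)"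
      unfolding bij_betw_imp_surj_on[OF bij_betw_basis_enum, symmetric] by (simp add: e)
    finally show ?thesis by (simp add: mem_box_cart ecoord_def)
  qed
  then show ?thesis by blast
qed

lemma emeasure_box_ecoord: 
  assumes "\<And>b. b \<in> Basis \<Longrightarrow> l \<bullet> b \<le> u \<bullet> b"
  shows "emeasure lborel (box (ecoord l) (ecoord u)) = (\<Prod>b\<in>Basis. (u - l) \<bullet> b)"
proof -
  have "(\<Prod>b\<in>Basis. (ecoord u - ecoord l) \<bullet> b) = (\<Prod>i\<in>UNIV. (ecoord u - ecoord l) $ i)"
    unfolding Basis_vec_def
    by (subst prod.UNION_disjoint) (auto simp: inner_axis axis_eq_axis)
  also have "\<dots> = (\<Prod>i\<in>UNIV. (u - l) \<bullet> basis_enum i)"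
    by (simp add: ecoord_def inner_diff_left)
  also have "\<dots> = (\<Prod>b\<in>Basis. (u - l) \<bullet> b)" by (rule prod_basis_enum)
  finally have *: "(\<Prod>b\<in>Basis. (ecoord u - ecoord l) \<bullet> b) = (\<Prod>b\<in>Basis. (u - l) \<bullet> b)" .
  have "\<forall>b\<in>Basis. ecoord l \<bullet> b \<le> ecoord u \<bullet> b"
    using assms by (auto simp: Basis_vec_def inner_axis ecoord_def)
  then show ?thesis using * by (simp add: emeasure_lborel_box_eq)
qed

text \<open>Orthonormal coordinates carry boxes to boxes of the same volume, and Lebesgue measure is
  determined by its values on boxes.\<close>

lemma lborel_euncoord: "distr lborel borel euncoord = lborel"
proof (rule lborel_eqI[symmetric])
  fix l u :: 'a assume "\<And>b. b \<in> Basis \<Longrightarrow> l \<bullet> b \<le> u \<bullet> b"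
  then show "emeasure (distr lborel borel euncoord) (box l u) = (\<Prod>b\<in>Basis. (u - l) \<bullet> b)"
    by (simp add: emeasure_distr borel_measurable_linear linear_euncoord euncoord_vimage_box emeasure_box_ecoord)
qed simp

text \<open>Another enumeration of the basis permutes rows and columns alike, so the value depends
  on \<open>f\<close> only.\<close>

definition edet :: "('a::euclidean_space \<Rightarrow> 'a) \<Rightarrow> real" where
  "edet f = det (\<chi> i j. f (basis_enum j) \<bullet> basis_enum i)"

lemma edet_eq_det_matrix: "edet f = det (matrix (\<lambda>v. ecoord (f (euncoord v))))"
proof -
  have "euncoord (axis j 1) = basis_enum j" for j :: "'a dim_index"
    by (simp add: euncoord_def axis_def if_distrib[of "\<lambda>r. r *\<^sub>R _"] cong: if_cong)
  then show ?thesis by (simp add: edet_def matrix_def ecoord_def)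
qed

lemma edet_compose:
  assumes "linear f" "linear g" shows "edet (\<lambda>x. f (g x)) = edet f * edet g"
proof -
  have l: "linear (\<lambda>v. ecoord (h (euncoord v)))" if "linear h" for h :: "'a \<Rightarrow> 'a"
    using linear_compose[OF linear_compose[OF linear_euncoord that] linear_ecoord] by (simp add: o_def)
  have "matrix (\<lambda>v. ecoord (f (g (euncoord v)))) =
    matrix (\<lambda>v. ecoord (f (euncoord v))) ** matrix (\<lambda>v. ecoord (g (euncoord v)))"
    using matrix_compose[OF l[OF assms(2)] l[OF assms(1)]] by (simp add: o_def)
  then show ?thesis by (simp add: edet_eq_det_matrix det_mul)
qed

lemma edet_diagonal:
  assumes "\<And>b. b \<in> Basis \<Longrightarrow> f b = c b *\<^sub>R b" shows "edet f = (\<Prod>b\<in>Basis. c b)"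
proof -
  have "edet f = (\<Prod>i\<in>UNIV. c (basis_enum i))"
    unfolding edet_def by (subst det_diagonal) (auto simp: assms inner_basis_enum)
  then show ?thesis by (simp add: prod_basis_enum)
qed

lemma edet_ident: "edet (\<lambda>x. x) = 1"
  by (subst edet_diagonal[where c="\<lambda>_. 1"]) auto

text \<open>In an orthonormal basis the adjoint has the transposed matrix.\<close>

lemma edet_adjoint:
  assumes "\<And>x y. f x \<bullet> y = x \<bullet> g y" shows "edet g = edet f"
proof -
  have "(\<chi> i j. g (basis_enum j) \<bullet> basis_enum i) = transpose (\<chi> i j. f (basis_enum j) \<bullet> basis_enum i)"
    unfolding vec_eq_iff transpose_def vec_lambda_beta using assms inner_commute by metis
  then show ?thesis by (simp add: edet_def)
qed

lemma edet_nonzero_bij: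
  assumes "linear f" "edet f \<noteq> 0" obtains h where "linear h" "\<And>x. h (f x) = x" "\<And>x. f (h x) = x"
proof -
  have lin: "linear (\<lambda>v. ecoord (f (euncoord v)))"
    using linear_compose[OF linear_compose[OF linear_euncoord assms(1)] linear_ecoord] by (simp add: o_def)
  have inv: "invertible (matrix (\<lambda>v. ecoord (f (euncoord v))))"
    using assms(2) by (simp add: edet_eq_det_matrix invertible_det_nz)
  obtain k where k: "linear k" "(\<lambda>v. ecoord (f (euncoord v))) \<circ> k = id"
      "k \<circ> (\<lambda>v. ecoord (f (euncoord v))) = id"
    using iffD1[OF matrix_invertible[OF lin] inv] by (elim exE conjE)
  have k: "linear k" "\<And>v. k (ecoord (f (euncoord v))) = v" "\<And>v. ecoord (f (euncoord (k v))) = v"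
    using k(1) fun_cong[OF k(2)] fun_cong[OF k(3)] by (simp_all add: o_def)
  show thesis
  proof
    show "linear (\<lambda>x. euncoord (k (ecoord x)))"
      using linear_compose[OF linear_compose[OF linear_ecoord k(1)] linear_euncoord] by (simp add: o_def)
    show "euncoord (k (ecoord (f x))) = x" for x using k(2)[of "ecoord x"] by simp
    show "f (euncoord (k (ecoord x))) = x" for x using k(3)[of "ecoord x"] by (metis euncoord_ecoord)
  qed
qed

section \<open>Linear changes of variables\<close>

lemma emeasure_linear_image_box:
  fixes h :: "'a::euclidean_space \<Rightarrow> 'a"
  assumes "linear h" "h ` box l u \<in> sets borel" and le: "\<And>b. b \<in> Basis \<Longrightarrow> l \<bullet> b \<le> u \<bullet> b"
  shows "emeasure lborel (h ` box l u) = ennreal (\<bar>edet h\<bar> * (\<Prod>b\<in>Basis. (u - l) \<bullet> b))"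
proof -
  let ?h = "\<lambda>v. ecoord (h (euncoord v))"
  have lin: "linear ?h"
    using linear_compose[OF linear_compose[OF linear_euncoord assms(1)] linear_ecoord] by (simp add: o_def)
  have im: "euncoord -` (h ` box l u) = ?h ` box (ecoord l) (ecoord u)"
    unfolding vimage_euncoord euncoord_vimage_box[symmetric] by (auto simp: image_iff)
  have meas: "?h ` box (ecoord l) (ecoord u) \<in> sets borel"
    using measurable_sets[OF borel_measurable_linear[OF linear_euncoord] assms(2)] im by simp
  have b: "box (ecoord l) (ecoord u) \<in> lmeasurable" by simp
  have p0: "0 \<le> (\<Prod>b\<in>Basis. (u - l) \<bullet> b)"
    using le by (intro prod_nonneg) (auto simp: inner_diff_left)
  have "emeasure lborel (h ` box l u) = emeasure lborel (?h ` box (ecoord l) (ecoord u))"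
    by (subst lborel_euncoord[symmetric], subst emeasure_distr)
      (simp_all add: borel_measurable_linear linear_euncoord assms(2) im)
  also have "\<dots> = emeasure lebesgue (?h ` box (ecoord l) (ecoord u))"
    using meas by simp
  also have "\<dots> = ennreal (measure lebesgue (?h ` box (ecoord l) (ecoord u)))"
    by (rule emeasure_eq_measure2[OF measurable_linear_image[OF lin b]])
  also have "\<dots> = ennreal (\<bar>edet h\<bar> * measure lebesgue (box (ecoord l) (ecoord u)))"
    by (simp only: measure_linear_image[OF lin b] edet_eq_det_matrix)
  also have "measure lebesgue (box (ecoord l) (ecoord u)) = (\<Prod>b\<in>Basis. (u - l) \<bullet> b)"
    using emeasure_box_ecoord[OF le] p0 by (simp add: measure_def)
  finally show ?thesis .
qed

text \<open>The preimage of a box under \<open>f\<close> is its image under the inverse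
  \<open>h\<close>, so its volume is scaled by \<open>\<bar>edet h\<bar>\<close>, which the factor
  \<open>\<bar>edet f\<bar>\<close> cancels. Agreement on boxes suffices.\<close>

lemma lborel_linear:
  fixes f :: "'a::euclidean_space \<Rightarrow> 'a"
  assumes f: "linear f" and nz: "edet f \<noteq> 0"
  shows "density (distr lborel borel f) (\<lambda>_. ennreal \<bar>edet f\<bar>) = lborel"
proof (rule lborel_eqI[symmetric])
  note [measurable] = borel_measurable_linear[OF f]
  obtain h where h: "linear h" "\<And>x. h (f x) = x" "\<And>x. f (h x) = x"
    using edet_nonzero_bij[OF assms] by blast
  have "edet f * edet h = 1" using edet_compose[OF f h(1)] h(3) by (simp add: edet_ident)
  then have d: "\<bar>edet f\<bar> * \<bar>edet h\<bar> = 1" by (simp flip: abs_mult)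
  fix l u :: 'a assume le: "\<And>b. b \<in> Basis \<Longrightarrow> l \<bullet> b \<le> u \<bullet> b"
  have p0: "0 \<le> (\<Prod>b\<in>Basis. (u - l) \<bullet> b)"
    using le by (intro prod_nonneg) (auto simp: inner_diff_left)
  have v: "f -` box l u = h ` box l u" using h by (auto simp: image_iff) metis
  have "h ` box l u \<in> sets borel" 
    using measurable_sets[OF borel_measurable_linear[OF f], of "box l u"] v by simp
  note e = emeasure_linear_image_box[OF h(1) this le]
  have "emeasure (density (distr lborel borel f) (\<lambda>_. ennreal \<bar>edet f\<bar>)) (box l u)
    = ennreal \<bar>edet f\<bar> * emeasure lborel (h ` box l u)"
    by (simp add: emeasure_density nn_integral_cmult emeasure_distr v)
  also have "\<dots> = ennreal ((\<bar>edet f\<bar> * \<bar>edet h\<bar>) * (\<Prod>b\<in>Basis. (u - l) \<bullet> b))"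
    using p0 by (simp add: e ennreal_mult[symmetric] mult.assoc)
  finally show "emeasure (density (distr lborel borel f) (\<lambda>_. ennreal \<bar>edet f\<bar>)) (box l u) = (\<Prod>b\<in>Basis. (u - l) \<bullet> b)"
    by (simp add: d)
qed simp

lemma nn_integral_lborel_linear:
  fixes f :: "'a::euclidean_space \<Rightarrow> 'a"
  assumes f: "linear f" and nz: "edet f \<noteq> 0" and [measurable]: "g \<in> borel_measurable borel"
  shows "(\<integral>\<^sup>+x. g x \<partial>lborel) = ennreal \<bar>edet f\<bar> * (\<integral>\<^sup>+x. g (f x) \<partial>lborel)"
proof -
  note [measurable] = borel_measurable_linear[OF f]
  show ?thesis
    by (subst lborel_linear[OF f nz, symmetric])
      (simp add: nn_integral_density nn_integral_distr nn_integral_cmult)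
qed

section \<open>Self-adjoint maps\<close>

text \<open>\<open>V\<close> is both the adjoint and a left inverse of \<open>U\<close>. Since
  adjoint maps have equal determinants, the square of \<open>edet U\<close> is 1.\<close>

lemma orthonormal_frame:
  fixes s :: "'a::euclidean_space \<Rightarrow> 'a"
  assumes s: "\<And>b c. b \<in> Basis \<Longrightarrow> c \<in> Basis \<Longrightarrow> s b \<bullet> s c = (if b = c then 1 else 0)"
  defines "U \<equiv> \<lambda>x. \<Sum>b\<in>Basis. (x \<bullet> b) *\<^sub>R s b"
    and "V \<equiv> \<lambda>y. \<Sum>b\<in>Basis. (y \<bullet> s b) *\<^sub>R b"
  shows "linear U" "linear V" "\<And>b. b \<in> Basis \<Longrightarrow> U b = s b"
    "\<And>x. V (U x) = x" "\<And>x. U (V x) = x" "\<And>x y. U x \<bullet> y = x \<bullet> V y"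
    "\<And>x y. U x \<bullet> U y = x \<bullet> y" "\<bar>edet U\<bar> = 1"
proof -
  show U: "linear U" unfolding U_def
    by (rule linearI) (simp_all add: inner_add_left scaleR_add_left sum.distrib scaleR_sum_right)
  show V: "linear V" unfolding V_def
    by (rule linearI) (simp_all add: inner_add_left scaleR_add_left sum.distrib scaleR_sum_right)
  show Ub: "U b = s b" if "b \<in> Basis" for b
  proof -
    have "U b = (\<Sum>c\<in>Basis. if c = b then s b else 0)"
      unfolding U_def by (rule sum.cong) (use that in \<open>auto simp: inner_Basis\<close>)
    then show ?thesis using that by simp
  qed
  have Us: "U x \<bullet> s c = x \<bullet> c" if "c \<in> Basis" for x c
  proof -
    have "U x \<bullet> s c = (\<Sum>b\<in>Basis. if b = c then x \<bullet> b else 0)"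
      unfolding U_def inner_sum_left by (rule sum.cong) (use that in \<open>auto simp: s\<close>)
    then show ?thesis using that by simp
  qed
  show VU: "V (U x) = x" for x
    by (simp add: V_def Us euclidean_representation)
  show adj: "U x \<bullet> y = x \<bullet> V y" for x y
    by (simp add: U_def V_def inner_sum_left inner_sum_right inner_commute[of y] mult.commute)
  show UU: "U x \<bullet> U y = x \<bullet> y" for x y by (simp add: adj VU)
  have "edet V * edet U = 1" using edet_compose[OF V U] by (simp add: VU edet_ident)
  moreover have "edet V = edet U" by (rule edet_adjoint) (rule adj)
  ultimately have "(edet U)\<^sup>2 = 1" by (simp add: power2_eq_square)
  then show "\<bar>edet U\<bar> = 1" by (simp add: abs_square_eq_1)
  \<comment> \<open>The left inverse \<open>V\<close> becomes a two-sided one because a nonzero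
    determinant makes \<open>U\<close> surjective.\<close>
  then have "edet U \<noteq> 0" by auto
  then obtain h where "\<And>x. U (h x) = x" using edet_nonzero_bij[OF U] by blast
  then show "U (V x) = x" for x by (metis VU)
qed

lemma extend_orthonormal:
  fixes s :: "'a::euclidean_space \<Rightarrow> 'a"
  assumes A: "A \<subseteq> Basis"
    and s: "\<And>b c. b \<in> A \<Longrightarrow> c \<in> A \<Longrightarrow> s b \<bullet> s c = (if b = c then 1 else 0)"
  shows "\<exists>s'. (\<forall>b\<in>A. s' b = s b) \<and> (\<forall>b\<in>Basis. \<forall>c\<in>Basis. s' b \<bullet> s' c = (if b = c then 1 else 0))"
proof -
  have inj: "inj_on s A"
    using s by (intro inj_onI) (metis zero_neq_one)
  have ind: "independent (s ` A)"
  proof (rule pairwise_orthogonal_independent)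
    show "pairwise orthogonal (s ` A)" by (auto simp: pairwise_def orthogonal_def s)
    show "0 \<notin> s ` A" using s by (metis imageE inner_zero_left zero_neq_one)
  qed
  have dA: "dim (span (s ` A)) = card A"
    using dim_eq_card_independent[OF ind] by (simp add: card_image[OF inj])
  let ?W = "{y \<in> UNIV. \<forall>x\<in>span (s ` A). orthogonal x y}"
  define W where "W = ?W"
  have dW: "dim W + card A = DIM('a)"
    using dim_subspace_orthogonal_to_vectors[of "span (s ` A)" UNIV] dA by (simp add: dim_UNIV W_def)
  have "subspace W" by (auto simp: subspace_def orthogonal_def inner_add_right W_def)
  then have "\<exists>B. B \<subseteq> W \<and> pairwise orthogonal B \<and> (\<forall>x\<in>B. norm x = 1) \<and> independent B \<and> card B = dim W"
    using orthonormal_basis_subspace by metis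
  then obtain B where
    B: "B \<subseteq> W" "pairwise orthogonal B" "\<And>x. x \<in> B \<Longrightarrow> norm x = 1" "independent B" "card B = dim W"
    by blast
  have "finite B" using B(4) independent_imp_finite by blast
  moreover have "card (Basis - A) = card B"
    using A dW B(5) by (simp add: card_Diff_subset finite_subset[OF A])
  ultimately obtain t where t: "bij_betw t (Basis - A) B"
    using finite_same_card_bij[of "Basis - A" B] by auto
  define s' where "s' b = (if b \<in> A then s b else t b)" for b
  have tB: "t b \<in> B" if "b \<in> Basis" "b \<notin> A" for b using t that by (auto simp: bij_betw_def)
  have st: "s b \<bullet> t c = 0" if "b \<in> A" "c \<in> Basis" "c \<notin> A" for b c
  proof -
    have "t c \<in> W" using tB[OF that(2,3)] B(1) by blast
    moreover have "s b \<in> span (s ` A)" using that(1) by (intro span_base) auto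
    ultimately show ?thesis by (simp add: orthogonal_def W_def)
  qed
  have tt: "t b \<bullet> t c = (if b = c then 1 else 0)" if "b \<in> Basis" "b \<notin> A" "c \<in> Basis" "c \<notin> A" for b c
  proof (cases "b = c")
    case True then show ?thesis using B(3)[OF tB[OF that(1,2)]] by (simp add: norm_eq_1)
  next
    case False
    then have "t b \<noteq> t c" using t that by (auto simp: bij_betw_def inj_on_def)
    then show ?thesis using False pairwiseD[OF B(2) tB[OF that(1,2)] tB[OF that(3,4)]] by (simp add: orthogonal_def)
  qed
  have "s' b = s b" if "b \<in> A" for b using that by (simp add: s'_def)
  moreover have "s' b \<bullet> s' c = (if b = c then 1 else 0)" if "b \<in> Basis" "c \<in> Basis" for b c
    using that s st tt by (auto simp: s'_def inner_commute[of "t _" "s _"])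
  ultimately show ?thesis by blast
qed

text \<open>Maximise \<open>x \<bullet> f x\<close> over the unit sphere of \<open>W\<close>. With
  \<open>l\<close> the maximum and \<open>v\<close> a point where it is attained,
  \<open>g = l - f\<close> is positive semidefinite on \<open>W\<close> and its form vanishes at
  \<open>v\<close>; this forces \<open>g v = 0\<close>.\<close>

lemma self_adjoint_eigenvector:
  fixes f :: "'a::euclidean_space \<Rightarrow> 'a"
  assumes f: "linear f" and adj: "\<And>x y. f x \<bullet> y = x \<bullet> f y"
    and W: "subspace W" "\<And>x. x \<in> W \<Longrightarrow> f x \<in> W" and nz: "w \<in> W" "w \<noteq> 0"
  obtains v l where "v \<in> W" "v \<noteq> 0" "f v = l *\<^sub>R v"
proof -
  let ?K = "W \<inter> sphere 0 1"
  have K: "compact ?K" using closed_subspace[OF W(1)] by (simp add: closed_Int_compact)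
  have "(1 / norm w) *\<^sub>R w \<in> ?K" using nz W(1) by (simp add: subspace_scale)
  then have ne: "?K \<noteq> {}" by blast
  have "continuous_on ?K (\<lambda>x. x \<bullet> f x)"
    using f by (intro continuous_intros linear_continuous_on) (simp add: linear_conv_bounded_linear)
  from continuous_attains_sup[OF K ne this] obtain v
    where v: "v \<in> W" "norm v = 1" and max: "\<And>x. x \<in> ?K \<Longrightarrow> x \<bullet> f x \<le> v \<bullet> f v" by auto
  define l where "l = v \<bullet> f v"
  define g where "g x = l *\<^sub>R x - f x" for x
  have gadd: "g (x + y) = g x + g y" for x y
    by (simp add: g_def linear_add[OF f] algebra_simps)
  have gsc: "g (r *\<^sub>R x) = r *\<^sub>R g x" for x r
    by (simp add: g_def linear_scale[OF f] algebra_simps)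
  have gW: "g x \<in> W" if "x \<in> W" for x
    unfolding g_def by (intro subspace_diff subspace_scale W that)
  have gadj: "g x \<bullet> y = x \<bullet> g y" for x y by (simp add: g_def inner_diff_left inner_diff_right adj)
  have pos: "x \<bullet> g x \<ge> 0" if "x \<in> W" for x
  proof (cases "x = 0")
    case False
    have u: "(1 / norm x) *\<^sub>R x \<in> ?K" using that False W(1) by (simp add: subspace_scale)
    have "((1 / norm x) *\<^sub>R x) \<bullet> f ((1 / norm x) *\<^sub>R x) \<le> l" using max[OF u] by (simp add: l_def)
    then have "x \<bullet> f x / (norm x)\<^sup>2 \<le> l"
      by (simp add: linear_scale[OF f] power2_eq_square)
    then have "x \<bullet> f x \<le> l * (x \<bullet> x)"
      using False by (simp add: divide_le_eq power2_norm_eq_inner)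
    then show ?thesis by (simp add: g_def inner_diff_right)
  qed simp
  have v0: "v \<bullet> g v = 0" using v by (simp add: g_def inner_diff_right l_def power2_norm_eq_inner[symmetric])
  let ?n = "g v \<bullet> g v" and ?q = "g v \<bullet> g (g v)"
  \<comment> \<open>Semidefiniteness at \<open>v + t *\<^sub>R g v\<close>. There is no constant
    term, so the linear coefficient must vanish.\<close>
  have exp: "0 \<le> 2 * t * ?n + t * t * ?q" for t
  proof -
    have "v + t *\<^sub>R g v \<in> W" by (intro subspace_add subspace_scale W gW v)
    then have "0 \<le> (v + t *\<^sub>R g v) \<bullet> g (v + t *\<^sub>R g v)" by (rule pos)
    also have "\<dots> = 2 * t * ?n + t * t * ?q"
      using gadj[of v "g v"] v0 by (simp add: gadd gsc inner_add_left inner_add_right algebra_simps)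
    finally show ?thesis .
  qed
  have "?n = 0"
  proof (rule ccontr)
    assume n: "?n \<noteq> 0"
    then have n: "?n > 0" by simp
    have "?q \<ge> 0" by (intro pos gW v)
    moreover have "?q \<noteq> 0"
    proof
      assume "?q = 0"
      then show False using exp[of "-1"] n by linarith
    qed
    ultimately have q: "?q > 0" by simp
    \<comment> \<open>This \<open>t\<close> minimises the quadratic polynomial, where its value is
      negative.\<close>
    have "0 \<le> 2 * (- ?n / ?q) * ?n + (- ?n / ?q) * (- ?n / ?q) * ?q" by (rule exp)
    also have "\<dots> = - (?n * ?n / ?q)" using q by (simp add: field_simps)
    finally show False using n q by (simp add: divide_le_0_iff mult_le_0_iff)
  qed
  then have "f v = l *\<^sub>R v" by (simp add: g_def)
  then show thesis using v that by (metis norm_zero zero_neq_one)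
qed

text \<open>Eigenspaces of different eigenvalues are orthogonal, so orthonormal bases of them
  combine. If they did not span, their orthogonal complement, which is invariant under
  \<open>f\<close>, would contain a further eigenvector; it would lie in one of the eigenspaces and
  hence be orthogonal to itself.\<close>

lemma spectral_basis:
  fixes f :: "'a::euclidean_space \<Rightarrow> 'a"
  assumes f: "linear f" and adj: "\<And>x y. f x \<bullet> y = x \<bullet> f y"
    and E_def: "\<And>l. E l = {x. f x = l *\<^sub>R x}" and L_def: "L = {l. \<exists>x\<in>E l. x \<noteq> 0}"
  obtains B where "\<And>l. l \<in> L \<Longrightarrow> B l \<subseteq> E l" "\<And>l. l \<in> L \<Longrightarrow> card (B l) = dim (E l)"
    "\<And>l. l \<in> L \<Longrightarrow> finite (B l)" "finite L" "disjoint_family_on B L"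
    "pairwise orthogonal (\<Union>(B ` L))" "\<And>x. x \<in> \<Union>(B ` L) \<Longrightarrow> norm x = 1"
    "card (\<Union>(B ` L)) = DIM('a)" "finite (\<Union>(B ` L))"
proof -
  have sub: "subspace (E l)" for l
    by (rule subspaceI) (auto simp: E_def linear_0[OF f] linear_add[OF f] linear_scale[OF f] algebra_simps)
  have "\<exists>B. B \<subseteq> E l \<and> pairwise orthogonal B \<and> (\<forall>x\<in>B. norm x = 1) \<and> independent B \<and> card B = dim (E l) \<and> span B = E l" for l
    using orthonormal_basis_subspace[OF sub[of l]] by metis
  then obtain B where B: "\<And>l. B l \<subseteq> E l" "\<And>l. pairwise orthogonal (B l)" "\<And>l x. x \<in> B l \<Longrightarrow> norm x = 1"
    "\<And>l. independent (B l)" "\<And>l. card (B l) = dim (E l)" "\<And>l. span (B l) = E l" by metis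
  have orth: "x \<bullet> y = 0" if "x \<in> E l" "y \<in> E k" "l \<noteq> k" for x y l k
    using adj[of x y] that by (simp add: E_def)
  let ?B = "\<Union>(B ` L)"
  have pw: "pairwise orthogonal ?B"
  proof (rule pairwiseI)
    fix x y assume "x \<in> ?B" "y \<in> ?B" "x \<noteq> y"
    then obtain l k where lk: "x \<in> B l" "y \<in> B k" by auto
    show "orthogonal x y"
    proof (cases "l = k")
      case True with lk \<open>x \<noteq> y\<close> B(2)[of l] show ?thesis by (auto simp: pairwise_def)
    next
      case False
      then have "x \<bullet> y = 0" using lk B(1) by (intro orth[of x l y k]) auto
      then show ?thesis by (simp add: orthogonal_def)
    qed
  qed
  have n1: "norm x = 1" if "x \<in> ?B" for x using that B(3) by auto
  have ind: "independent ?B"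
    using n1 by (intro pairwise_orthogonal_independent[OF pw]) force
  have fin: "finite ?B" using ind independent_imp_finite by blast
  have dis: "disjoint_family_on B L"
  proof -
    have False if "x \<in> B l" "x \<in> B k" "l \<noteq> k" for x l k
    proof -
      have "x \<bullet> x = 0" using that B(1) by (intro orth[of x l x k]) auto
      then show False using B(3)[OF that(1)] by auto
    qed
    then show ?thesis by (auto simp: disjoint_family_on_def)
  qed
  have ne: "B l \<noteq> {}" if "l \<in> L" for l
  proof
    assume "B l = {}"
    then have "E l = {0}" using B(6)[of l] by simp
    then show False using that by (auto simp: L_def)
  qed
  \<comment> \<open>The sets \<open>B l\<close> are nonempty, disjoint and contained in one finite
    set.\<close>
  have finL: "finite L"
  proof (rule ccontr)
    assume inf: "infinite L"
    have "inj_on B L" using ne dis by (auto simp: inj_on_def disjoint_family_on_def) blast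
    then have "infinite (B ` L)" using inf finite_imageD by blast
    then show False using fin finite_UnionD by blast
  qed
  have "span ?B = UNIV"
  proof (rule ccontr)
    assume "span ?B \<noteq> UNIV"
    then have "dim ?B < DIM('a)" by (metis dim_eq_full dim_subset_UNIV le_neq_implies_less)
    then obtain w where w: "w \<noteq> 0" "\<And>x. x \<in> span ?B \<Longrightarrow> orthogonal w x"
      using orthogonal_to_subspace_exists by metis
    define W where "W = {x. \<forall>b\<in>?B. b \<bullet> x = 0}"
    have sW: "subspace W" by (rule subspaceI) (auto simp: W_def inner_add_right)
    have fW: "f x \<in> W" if "x \<in> W" for x
    proof -
      have "b \<bullet> f x = 0" if "b \<in> ?B" for b
      proof -
        from that obtain l where "b \<in> B l" by auto
        then have "f b = l *\<^sub>R b" using B(1) by (auto simp: E_def)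
        then have "b \<bullet> f x = l * (b \<bullet> x)" using adj[of b x] by simp
        moreover have "b \<bullet> x = 0" using \<open>x \<in> W\<close> that unfolding W_def by blast
        ultimately show ?thesis by simp
      qed
      then show ?thesis unfolding W_def by blast
    qed
    have "w \<in> W" using w(2) by (auto simp: W_def orthogonal_def inner_commute intro!: span_base)
    from self_adjoint_eigenvector[OF f adj sW fW this w(1)] obtain v l
      where v: "v \<in> W" "v \<noteq> 0" "f v = l *\<^sub>R v" by metis
    then have "v \<in> E l" "l \<in> L" by (auto simp: E_def L_def)
    have "orthogonal v y" if "y \<in> span (B l)" for y
      using that
    proof (rule orthogonal_to_span)
      fix b assume "b \<in> B l"
      then show "orthogonal v b" using v(1) \<open>l \<in> L\<close> by (auto simp: W_def orthogonal_def inner_commute)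
    qed
    from this[of v] show False using B(6)[of l] \<open>v \<in> E l\<close> v(2) by (simp add: orthogonal_def)
  qed
  then have "card ?B = DIM('a)" by (metis ind dim_eq_card dim_eq_full dim_UNIV)
  then show thesis 
    using B(1,5) independent_imp_finite[OF B(4)] finL dis pw n1 fin
    by (intro that[of B]) simp_all
qed

text \<open>Conjugation with an orthonormal frame of eigenvectors keeps the determinant and makes
  the map diagonal; the diagonal entries are then grouped by eigenvalue.\<close>

theorem edet_self_adjoint:
  fixes f :: "'a::euclidean_space \<Rightarrow> 'a"
  assumes f: "linear f" and adj: "\<And>x y. f x \<bullet> y = x \<bullet> f y"
  shows "finite {l. \<exists>x. f x = l *\<^sub>R x \<and> x \<noteq> 0}"
    and "edet f = (\<Prod>l | \<exists>x. f x = l *\<^sub>R x \<and> x \<noteq> 0. l ^ dim {x. f x = l *\<^sub>R x})"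
proof -
  define E where "E l = {x. f x = l *\<^sub>R x}" for l
  define L where "L = {l. \<exists>x\<in>E l. x \<noteq> 0}"
  obtain B where B: "\<And>l. l \<in> L \<Longrightarrow> B l \<subseteq> E l" "\<And>l. l \<in> L \<Longrightarrow> card (B l) = dim (E l)"
    "\<And>l. l \<in> L \<Longrightarrow> finite (B l)" "finite L" "disjoint_family_on B L"
    "pairwise orthogonal (\<Union>(B ` L))" "\<And>x. x \<in> \<Union>(B ` L) \<Longrightarrow> norm x = 1"
    "card (\<Union>(B ` L)) = DIM('a)" "finite (\<Union>(B ` L))"
    by (rule spectral_basis[OF f adj E_def L_def], rule that) (assumption | blast)+
  have L': "L = {l. \<exists>x. f x = l *\<^sub>R x \<and> x \<noteq> 0}" by (auto simp: L_def E_def)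
  show "finite {l. \<exists>x. f x = l *\<^sub>R x \<and> x \<noteq> 0}" using B(4) L' by simp
  obtain s where s: "bij_betw s (Basis :: 'a set) (\<Union>(B ` L))"
    using finite_same_card_bij[OF finite_Basis B(9)] B(8) by auto
  have sB: "s b \<in> \<Union>(B ` L)" if "b \<in> Basis" for b using s that by (auto simp: bij_betw_def)
  have orth: "s b \<bullet> s c = (if b = c then 1 else 0)" if "b \<in> Basis" "c \<in> Basis" for b c
  proof (cases "b = c")
    case True then show ?thesis using B(7)[OF sB[OF that(1)]] by (simp add: norm_eq_1)
  next
    case False
    then have "s b \<noteq> s c" using s that by (auto simp: bij_betw_def inj_on_def)
    then show ?thesis using pairwiseD[OF B(6) sB[OF that(1)] sB[OF that(2)]] False by (simp add: orthogonal_def)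
  qed
  note fr = orthonormal_frame[of s, OF orth]
  define U V where "U = (\<lambda>x. \<Sum>b\<in>Basis. (x \<bullet> b) *\<^sub>R s b)" and "V = (\<lambda>y. \<Sum>b\<in>Basis. (y \<bullet> s b) *\<^sub>R b)"
  have UV: "linear U" "linear V" "\<And>b. b \<in> Basis \<Longrightarrow> U b = s b" "\<And>x. V (U x) = x" "\<And>x. U (V x) = x"
    using fr unfolding U_def V_def by auto
  \<comment> \<open>Well defined on the eigenvector basis because the sets \<open>B l\<close> are
    disjoint.\<close>
  define lam where "lam x = (THE l. l \<in> L \<and> x \<in> B l)" for x
  have lam: "lam x = l" if "l \<in> L" "x \<in> B l" for x l
    unfolding lam_def using that B(5) by (intro the_equality) (auto simp: disjoint_family_on_def)
  have "edet V * edet U = 1" using edet_compose[OF UV(2,1)] by (simp add: UV edet_ident)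
  moreover have "edet (\<lambda>x. V (f (U x))) = edet V * edet f * edet U"
    using edet_compose[OF UV(2) linear_compose[OF UV(1) f, unfolded o_def]] edet_compose[OF f UV(1)]
    by (simp add: mult.assoc)
  ultimately have "edet f = edet (\<lambda>x. V (f (U x)))" by (simp add: algebra_simps)
  also have "\<dots> = (\<Prod>b\<in>Basis. lam (s b))"
  proof (rule edet_diagonal)
    fix b :: 'a assume b: "b \<in> Basis"
    then obtain l where l: "l \<in> L" "s b \<in> B l" using sB by blast
    then have "f (s b) = l *\<^sub>R s b" using B(1) by (auto simp: E_def)
    then show "V (f (U b)) = lam (s b) *\<^sub>R b"
      using UV(3)[OF b] UV(4)[of b] linear_scale[OF UV(2)] lam[OF l] by simp
  qed
  also have "\<dots> = (\<Prod>x\<in>\<Union>(B ` L). lam x)" by (rule prod.reindex_bij_betw[OF s])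
  also have "\<dots> = (\<Prod>l\<in>L. \<Prod>x\<in>B l. lam x)"
    using B(3,4,5) by (intro prod.UNION_disjoint) (auto simp: disjoint_family_on_def)
  also have "\<dots> = (\<Prod>l\<in>L. l ^ dim (E l))"
    by (rule prod.cong) (simp_all add: lam B(2))
  finally show "edet f = (\<Prod>l | \<exists>x. f x = l *\<^sub>R x \<and> x \<noteq> 0. l ^ dim {x. f x = l *\<^sub>R x})"
    by (simp add: L' E_def)
qed

section \<open>Conjugation\<close>

lemma conjugate_0 [simp]: "conjugate (0::'a::conj_div_algebra) = 0"
  using conjugate_scaleR[of 0 "0::'a"] by simp

lemma norm_conjugate [simp]: "norm (conjugate (x::'a::conj_div_algebra)) = norm x"
proof (cases "x = 0")
  case False
  have "norm x * norm (conjugate x) = norm x * norm x"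
    by (simp add: norm_mult[symmetric] mult_conjugate power2_eq_square)
  then show ?thesis using False by simp
qed simp

lemma conjugate_mult_self: "conjugate (x::'a::conj_div_algebra) * x = of_real ((norm x)\<^sup>2)"
  using mult_conjugate[of "conjugate x"] by (simp add: conjugate_conjugate of_real_def)

lemma mult_conjugate_self: "(x::'a::conj_div_algebra) * conjugate x = of_real ((norm x)\<^sup>2)"
  using mult_conjugate[of x] by (simp add: of_real_def)

lemma conjugate_1 [simp]: "conjugate (1::'a::conj_div_algebra) = 1"
  using conjugate_mult_self[of "1::'a"] by simp

lemma conjugate_of_real [simp]: "conjugate (of_real r) = (of_real r :: 'a::conj_div_algebra)"
  by (simp add: of_real_def conjugate_scaleR)

lemma conjugate_sum: "conjugate (sum f A) = (\<Sum>i\<in>A. conjugate (f i :: 'a::conj_div_algebra))"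
  by (induction A rule: infinite_finite_induct) (auto simp: conjugate_add)

text \<open>Here \<open>x * x\<close> is the square of \<open>norm x\<close>. Real numbers are
  central, so the difference of squares factors, and in a division algebra \<open>x\<close> must be
  plus or minus \<open>norm x\<close>.\<close>

lemma self_conjugate_real:
  assumes "conjugate x = (x::'a::conj_div_algebra)" shows "\<exists>r. x = of_real r"
proof -
  let ?n = "of_real (norm x) :: 'a"
  have c: "x * ?n = ?n * x" by (simp add: of_real_def)
  have "(x - ?n) * (x + ?n) = x * x - ?n * ?n" by (simp add: algebra_simps c)
  also have "\<dots> = 0" using mult_conjugate_self[of x] assms by (simp add: power2_eq_square)
  finally have "x = ?n \<or> x = of_real (- norm x)" by (auto simp: eq_neg_iff_add_eq_0)
  then show ?thesis by blast
qed

text \<open>Polarisation of the multiplicativity of the norm.\<close>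

lemma inner_mult_mult: "(a * x) \<bullet> (a * y) = (norm (a::'a::conj_div_algebra))\<^sup>2 * (x \<bullet> y)"
proof -
  have p: "u \<bullet> v = ((norm (u + v))\<^sup>2 - (norm (u - v))\<^sup>2) / 4" for u v :: 'a
    by (simp add: power2_norm_eq_inner inner_add_left inner_add_right inner_diff_left inner_diff_right inner_commute)
  have "norm (a * x + a * y) = norm a * norm (x + y)" "norm (a * x - a * y) = norm a * norm (x - y)"
    by (simp_all only: norm_mult flip: distrib_left right_diff_distrib)
  then show ?thesis
    unfolding p[of "a*x"] p[of x] by (simp only: power_mult_distrib) (simp add: field_simps)
qed

lemma inner_mult_mult_right: "(x * a) \<bullet> (y * a) = (norm (a::'a::conj_div_algebra))\<^sup>2 * (x \<bullet> y)"
proof -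
  have p: "u \<bullet> v = ((norm (u + v))\<^sup>2 - (norm (u - v))\<^sup>2) / 4" for u v :: 'a
    by (simp add: power2_norm_eq_inner inner_add_left inner_add_right inner_diff_left inner_diff_right inner_commute)
  have "norm (x * a + y * a) = norm (x + y) * norm a" "norm (x * a - y * a) = norm (x - y) * norm a"
    by (simp_all only: norm_mult flip: distrib_right left_diff_distrib)
  then show ?thesis
    unfolding p[of "x*a"] p[of x] by (simp only: power_mult_distrib) (simp add: field_simps)
qed

text \<open>Since \<open>a * (conjugate a * y)\<close> is a real multiple of \<open>y\<close>, this
  is the preceding similarity property applied to \<open>conjugate a * y\<close>, after cancelling
  the square of \<open>norm a\<close>.\<close>

lemma inner_mult_left_adjoint: "(a * x) \<bullet> y = x \<bullet> (conjugate (a::'a::conj_div_algebra) * y)"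
proof (cases "a = 0")
  case False
  have "a * (conjugate a * y) = (norm a)\<^sup>2 *\<^sub>R y"
    by (simp add: mult.assoc[symmetric] mult_conjugate)
  then have "(norm a)\<^sup>2 * ((a * x) \<bullet> y) = (norm a)\<^sup>2 * (x \<bullet> (conjugate a * y))"
    using inner_mult_mult[of a x "conjugate a * y"] by simp
  then show ?thesis using False by simp
qed simp

lemma inner_mult_right_adjoint: "(x * a) \<bullet> y = x \<bullet> (y * conjugate (a::'a::conj_div_algebra))"
proof (cases "a = 0")
  case False
  have "(y * conjugate a) * a = (norm a)\<^sup>2 *\<^sub>R y"
    by (simp add: mult.assoc conjugate_mult_self) (simp add: of_real_def)
  then have "(norm a)\<^sup>2 * ((x * a) \<bullet> y) = (norm a)\<^sup>2 * (x \<bullet> (y * conjugate a))"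
    using inner_mult_mult_right[of x a "y * conjugate a"] by simp
  then show ?thesis using False by simp
qed simp

lemma inner_of_real_1 [simp]: "of_real r \<bullet> (1::'a::conj_div_algebra) = r"
  by (simp add: of_real_def power2_norm_eq_inner[symmetric])

section \<open>Matrices over a division algebra\<close>

definition cinner :: "'a::conj_div_algebra^'n \<Rightarrow> 'a^'n \<Rightarrow> 'a" where
  "cinner x y = (\<Sum>i\<in>UNIV. conjugate (x $ i) * y $ i)"

text \<open>Matrix entries multiply from the left, so scalars have to act from the right for
  matrices to be linear over the quaternions.\<close>

definition rscale :: "'a::conj_div_algebra^'n \<Rightarrow> 'a \<Rightarrow> 'a^'n" where
  "rscale x c = (\<chi> i. x $ i * c)"

text \<open>The inner product with 1 is the real part.\<close>

lemma inner_eq_cinner: "x \<bullet> y = cinner x y \<bullet> 1"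
proof -
  have "x $ i \<bullet> y $ i = (conjugate (x $ i) * y $ i) \<bullet> 1" for i
    using inner_mult_left_adjoint[of "conjugate (x $ i)" "y $ i" 1]
    by (simp add: conjugate_conjugate inner_commute)
  then show ?thesis by (simp add: inner_vec_def cinner_def inner_sum_left)
qed

lemma conjugate_cinner: "conjugate (cinner x y) = cinner y x"
  by (simp add: cinner_def conjugate_sum conjugate_mult conjugate_conjugate)

lemma cinner_self: "cinner x x = of_real ((norm x)\<^sup>2)"
  by (simp add: cinner_def conjugate_mult_self norm_vec_def L2_set_def sum_nonneg)

lemma cinner_rscale_right: "cinner x (rscale y c) = cinner x y * c"
  by (simp add: cinner_def rscale_def sum_distrib_right mult.assoc)

lemma cinner_rscale_left: "cinner (rscale x c) y = conjugate c * cinner x y"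
  by (simp add: cinner_def rscale_def sum_distrib_left conjugate_mult mult.assoc)

lemma cinner_add_right: "cinner x (y + z) = cinner x y + cinner x z"
  by (simp add: cinner_def algebra_simps sum.distrib)

lemma cinner_add_left: "cinner (x + y) z = cinner x z + cinner y z"
  by (simp add: cinner_def algebra_simps sum.distrib conjugate_add)

lemma cinner_sum_right: "cinner x (sum f A) = (\<Sum>i\<in>A. cinner x (f i))"
  by (induction A rule: infinite_finite_induct) (auto simp: cinner_add_right, simp_all add: cinner_def)

lemma cinner_sum_left: "cinner (sum f A) x = (\<Sum>i\<in>A. cinner (f i) x)"
  by (induction A rule: infinite_finite_induct) (auto simp: cinner_add_left, simp_all add: cinner_def)

lemma cinner_matrix_mult: "cinner (A *v x) y = cinner x (conj_transpose A *v y)"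
proof -
  have "cinner (A *v x) y = (\<Sum>i\<in>UNIV. \<Sum>j\<in>UNIV. conjugate (x $ j) * conjugate (A $ i $ j) * y $ i)"
    by (simp add: cinner_def matrix_vector_mult_def conjugate_sum conjugate_mult sum_distrib_right)
  also have "\<dots> = (\<Sum>j\<in>UNIV. \<Sum>i\<in>UNIV. conjugate (x $ j) * conjugate (A $ i $ j) * y $ i)"
    by (rule sum.swap)
  also have "\<dots> = cinner x (conj_transpose A *v y)"
    by (simp add: cinner_def matrix_vector_mult_def conj_transpose_def sum_distrib_left mult.assoc)
  finally show ?thesis .
qed

lemma inner_matrix_mult: "(A *v x) \<bullet> y = x \<bullet> (conj_transpose A *v y)"
  by (simp add: inner_eq_cinner cinner_matrix_mult)

lemma linear_matrix_mult: "linear ((*v) (A :: 'a::conj_div_algebra^'n^'m))"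
  by (rule linearI) (simp_all add: matrix_vector_mult_def vec_eq_iff algebra_simps sum.distrib scaleR_sum_right)

lemma matrix_mult_rscale: "A *v rscale x c = rscale (A *v x) c"
  by (simp add: rscale_def matrix_vector_mult_def vec_eq_iff sum_distrib_right mult.assoc)

lemma conj_transpose_conj_transpose [simp]: "conj_transpose (conj_transpose A) = A"
  by (simp add: conj_transpose_def vec_eq_iff conjugate_conjugate)

lemma conj_transpose_mult: "conj_transpose (A ** B) = conj_transpose B ** conj_transpose A"
  by (simp add: conj_transpose_def matrix_matrix_mult_def vec_eq_iff conjugate_sum conjugate_mult)

lemma conj_transpose_add: "conj_transpose (A + B) = conj_transpose A + conj_transpose B"
  by (simp add: conj_transpose_def vec_eq_iff conjugate_add)

lemma conj_transpose_mat_1 [simp]: "conj_transpose (mat 1) = mat 1"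
  by (simp add: conj_transpose_def mat_def vec_eq_iff)

text \<open>This makes the division in \<open>herm_det\<close> exact. A right line
  \<open>range (rscale x)\<close> has real dimension \<open>DIM('a)\<close>. Its orthogonal
  complement in \<open>W\<close> is again closed under right scaling, because the adjoint of right
  multiplication by \<open>c\<close> is right multiplication by \<open>conjugate c\<close>, which
  maps the line into itself. Induct on the dimension.\<close>

lemma DIM_dvd_dim_right_subspace:
  fixes W :: "('a::conj_div_algebra^'n) set"
  assumes "subspace W" "\<And>x c. x \<in> W \<Longrightarrow> rscale x c \<in> W"
  shows "DIM('a) dvd dim W"
  using assms
proof (induction "dim W" arbitrary: W rule: less_induct)
  case less
  show ?case
  proof (cases "W \<subseteq> {0}")
    case True
    then have "dim W = 0" by (metis dim_eq_0)
    then show ?thesis by (simp only: dvd_0_right)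
  next
    case False
    then obtain x where x: "x \<in> W" "x \<noteq> 0" by blast
    let ?L = "range (rscale x)"
    let ?W = "{y \<in> W. \<forall>z\<in>?L. orthogonal z y}"
    have lin: "linear (rscale x)"
      by (rule linearI) (simp_all add: rscale_def vec_eq_iff distrib_left)
    have inj: "inj (rscale x)"
      using x(2) by (intro injI) (auto simp: rscale_def vec_eq_iff)
    have sL: "subspace ?L" using linear_subspace_image[OF lin subspace_UNIV] .
    have dL: "dim ?L = DIM('a)" using dim_image_eq[OF lin, of UNIV] inj by (simp add: dim_UNIV)
    have LW: "?L \<subseteq> W" using less.prems(2)[OF x(1)] by auto
    have sum: "dim ?W + dim ?L = dim W"
      by (rule dim_subspace_orthogonal_to_vectors[OF sL less.prems(1) LW])
    have sW: "subspace ?W"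
      using less.prems(1) by (auto simp: subspace_def orthogonal_def inner_add_right)
    have rW: "rscale y c \<in> ?W" if "y \<in> ?W" for y c
    proof -
      have "rscale x d \<bullet> rscale y c = rscale x (d * conjugate c) \<bullet> y" for d
      proof -
        have "(x $ i * d) \<bullet> (y $ i * c) = (x $ i * (d * conjugate c)) \<bullet> y $ i" for i
          using inner_mult_right_adjoint[of "y $ i" c "x $ i * d"]
          by (simp only: inner_commute[of "y $ i"] inner_commute[of "y $ i * c"] mult.assoc)
        then show ?thesis by (simp add: inner_vec_def rscale_def)
      qed
      then show ?thesis using that less.prems(2) by (auto simp: orthogonal_def)
    qed
    have "dim ?W < dim W" using sum dL DIM_positive[where 'a='a] by linarith
    from less.hyps[OF this sW rW] have "DIM('a) dvd dim ?W + dim ?L" unfolding dL by simp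
    then show ?thesis using sum by (simp only:)
  qed
qed

section \<open>Eigenvalues of Hermitian matrices and Sylvester's identity\<close>

lemma hermitian_adjoint:
  assumes "conj_transpose A = A" shows "(A *v x) \<bullet> y = x \<bullet> (A *v y)"
  using inner_matrix_mult[of A x y] assms by simp

text \<open>A product over an infinite index set would have the default value 1; finiteness makes
  \<open>herm_det\<close> a genuine product over the eigenvalues.\<close>

lemma finite_eigenvalues:
  assumes "conj_transpose A = A" shows "finite {l. \<exists>x\<in>eigenspace A l. x \<noteq> 0}"
  using edet_self_adjoint(1)[OF linear_matrix_mult[of A] hermitian_adjoint[OF assms]]
  by (simp add: eigenspace_def)

text \<open>Eigenspaces are right subspaces, so the power \<open>DIM('a)\<close> restores the real
  multiplicities that occur in the spectral theorem.\<close>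

lemma herm_det_power:
  fixes A :: "'a::conj_div_algebra^'n^'n"
  assumes "conj_transpose A = A" shows "herm_det A ^ DIM('a) = edet ((*v) A)"
proof -
  have d: "DIM('a) dvd dim (eigenspace A l)" for l
    by (rule DIM_dvd_dim_right_subspace)
      (auto simp: subspace_def eigenspace_def linear_0[OF linear_matrix_mult] linear_add[OF linear_matrix_mult]
       linear_scale[OF linear_matrix_mult] algebra_simps matrix_mult_rscale, simp add: rscale_def vec_eq_iff)
  have "herm_det A ^ DIM('a) = (\<Prod>l | \<exists>x\<in>eigenspace A l. x \<noteq> 0. l ^ dim (eigenspace A l))"
    unfolding herm_det_def prod_power_distrib 
    by (rule prod.cong) (simp_all add: power_mult[symmetric] dvd_div_mult_self[OF d])
  also have "\<dots> = edet ((*v) A)"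
    unfolding edet_self_adjoint(2)[OF linear_matrix_mult[of A] hermitian_adjoint[OF assms]]
    by (simp add: eigenspace_def)
  finally show ?thesis .
qed

text \<open>For an eigenvalue other than 1, multiplication by \<open>conj_transpose T\<close> maps
  the eigenspace on the left injectively into the one on the right, since applying \<open>T\<close>
  afterwards gives back a nonzero multiple of the vector. By symmetry the dimensions agree.\<close>

lemma herm_det_sylvester:
  fixes T :: "'a::conj_div_algebra^'n^'m"
  shows "herm_det (mat 1 + T ** conj_transpose T) = herm_det (mat 1 + conj_transpose T ** T)"
proof -
  have mem: "x \<in> eigenspace (mat 1 + A ** conj_transpose A) l \<longleftrightarrow> A *v (conj_transpose A *v x) = (l - 1) *\<^sub>R x"
    for A :: "'a^'k^'l" and l x
    by (auto simp: eigenspace_def matrix_vector_mult_add_rdistrib matrix_vector_mul_assoc algebra_simps)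
  have sub: "subspace (eigenspace (mat 1 + A ** conj_transpose A) l)" for A :: "'a^'k^'l" and l
    by (rule subspaceI; unfold mem)
      (simp_all add: linear_0[OF linear_matrix_mult] linear_add[OF linear_matrix_mult]
       linear_scale[OF linear_matrix_mult] scaleR_add_right scaleR_left_commute)
  have im: "conj_transpose A *v x \<in> eigenspace (mat 1 + conj_transpose A ** A) l"
    if "x \<in> eigenspace (mat 1 + A ** conj_transpose A) l" for A :: "'a^'k^'l" and x l
    using that mem[of x A l] mem[of "conj_transpose A *v x" "conj_transpose A" l]
    by (simp add: linear_scale[OF linear_matrix_mult])
  have inj: "inj_on ((*v) (conj_transpose A)) (eigenspace (mat 1 + A ** conj_transpose A) l)"
    if "l \<noteq> 1" for A :: "'a^'k^'l" and l
  proof (rule inj_onI)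
    fix x y assume "x \<in> eigenspace (mat 1 + A ** conj_transpose A) l"
      "y \<in> eigenspace (mat 1 + A ** conj_transpose A) l" "conj_transpose A *v x = conj_transpose A *v y"
    then have "(l - 1) *\<^sub>R x = (l - 1) *\<^sub>R y" unfolding mem by metis
    then show "x = y" using that by simp
  qed
  have le: "dim (eigenspace (mat 1 + A ** conj_transpose A) l) \<le> dim (eigenspace (mat 1 + conj_transpose A ** A) l)"
    if "l \<noteq> 1" for A :: "'a^'k^'l" and l
  proof -
    have "dim (eigenspace (mat 1 + A ** conj_transpose A) l)
      = dim ((*v) (conj_transpose A) ` eigenspace (mat 1 + A ** conj_transpose A) l)"
      using inj[OF that, of A] sub[of A l]
      by (intro dim_image_eq[OF linear_matrix_mult, symmetric]) (simp add: span_eq_iff[THEN iffD2])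
    also have "\<dots> \<le> dim (eigenspace (mat 1 + conj_transpose A ** A) l)"
      using im by (intro dim_subset) auto
    finally show ?thesis .
  qed
  have deq: "dim (eigenspace (mat 1 + T ** conj_transpose T) l) = dim (eigenspace (mat 1 + conj_transpose T ** T) l)"
    if "l \<noteq> 1" for l
    using le[OF that, of T] le[OF that, of "conj_transpose T"] by simp
  have nz: "(\<exists>x\<in>eigenspace A l. x \<noteq> 0) \<longleftrightarrow> dim (eigenspace A l) > 0" for A :: "'a^'k^'k" and l
    unfolding neq0_conv[symmetric] dim_eq_0 by blast
  let ?L = "\<lambda>A. {l. 0 < dim (eigenspace A l)}"
  have h1: "conj_transpose (mat 1 + A ** conj_transpose A) = mat 1 + A ** conj_transpose A" for A :: "'a^'k^'l"
    by (simp add: conj_transpose_add conj_transpose_mult)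
  \<comment> \<open>The eigenvalue 1 may have different multiplicities on the two sides, whose sizes
    differ, but its powers contribute only factors 1.\<close>
  have split: "herm_det A = (\<Prod>l\<in>?L A - {1}. l ^ (dim (eigenspace A l) div DIM('a)))"
    if "conj_transpose A = A" for A :: "'a^'k^'k"
    using finite_eigenvalues[OF that] unfolding herm_det_def nz
    by (intro prod.mono_neutral_right) auto
  show ?thesis
    using split[OF h1[of T]] split[OF h1[of "conj_transpose T"]] deq by (auto intro!: prod.cong)
qed

section \<open>Positive definite matrices\<close>

text \<open>For Hermitian \<open>A\<close> the value \<open>cinner x (A *v x)\<close> is its own
  conjugate, hence real and equal to its real part.\<close>

lemma pos_def_cone_iff:
  "A \<in> pos_def_cone \<longleftrightarrow> conj_transpose A = A \<and> (\<forall>x. x \<noteq> 0 \<longrightarrow> x \<bullet> (A *v x) > 0)"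
proof -
  have "(\<exists>r>0. cinner x (A *v x) = of_real r) \<longleftrightarrow> x \<bullet> (A *v x) > 0" if A: "conj_transpose A = A" for x
  proof -
    have "conjugate (cinner x (A *v x)) = cinner x (A *v x)"
      using cinner_matrix_mult[of A x x] A by (simp add: conjugate_cinner)
    then obtain r where r: "cinner x (A *v x) = of_real r" using self_conjugate_real by blast
    then show ?thesis by (auto simp: inner_eq_cinner[of x])
  qed
  then show ?thesis by (auto simp: pos_def_cone_def cinner_def)
qed

lemma pos_def_coneD:
  assumes "A \<in> pos_def_cone" shows "conj_transpose A = A" "\<And>x. x \<noteq> 0 \<Longrightarrow> x \<bullet> (A *v x) > 0"
  using assms by (auto simp: pos_def_cone_iff)

lemma eigenvalue_pos:
  assumes A: "A \<in> pos_def_cone" and "\<exists>x\<in>eigenspace A l. x \<noteq> 0" shows "l > 0"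
proof -
  obtain x where x: "A *v x = l *\<^sub>R x" "x \<noteq> 0" using assms by (auto simp: eigenspace_def)
  have "l * (x \<bullet> x) > 0" using pos_def_coneD(2)[OF A x(2)] x(1) by simp
  moreover have "x \<bullet> x > 0" using x(2) by simp
  ultimately show ?thesis by (simp only: zero_less_mult_pos2)
qed

lemma herm_det_pos: "A \<in> pos_def_cone \<Longrightarrow> herm_det A > 0"
  unfolding herm_det_def by (intro prod_pos) (simp add: eigenvalue_pos)

lemma herm_det_eq_edet:
  fixes A :: "'a::conj_div_algebra^'n^'n"
  assumes "A \<in> pos_def_cone" shows "herm_det A = edet ((*v) A) powr (1 / DIM('a))" "edet ((*v) A) > 0"
proof -
  have e: "edet ((*v) A) = herm_det A powr DIM('a)"
    using herm_det_power[OF pos_def_coneD(1)[OF assms]] herm_det_pos[OF assms] by (simp add: powr_realpow)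
  then show "edet ((*v) A) > 0" using herm_det_pos[OF assms] by simp
  show "herm_det A = edet ((*v) A) powr (1 / DIM('a))"
    using herm_det_pos[OF assms] by (simp add: e powr_powr)
qed

lemma pos_def_cone_add_mat_1:
  assumes "conj_transpose A = A" "\<And>x. x \<bullet> (A *v x) \<ge> 0" shows "mat 1 + A \<in> pos_def_cone"
proof -
  have "x \<bullet> ((mat 1 + A) *v x) > 0" if "x \<noteq> 0" for x
    using assms(2)[of x] that by (simp add: matrix_vector_mult_add_rdistrib inner_add_right add_pos_nonneg)
  then show ?thesis using assms(1) by (simp add: pos_def_cone_iff conj_transpose_add)
qed

section \<open>Bordered matrices\<close>

text \<open>
  Matrices of size \<open>card S\<close> are encoded as matrices of full size that agree with the identity
  outside \<open>S \<times> S\<close>, so that an induction over \<open>S\<close> stays within one type.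
\<close>
definition id_outside :: "'n set \<Rightarrow> 'a::conj_div_algebra^'n^'n \<Rightarrow> bool" where
  "id_outside S A \<longleftrightarrow> (\<forall>i j. i \<notin> S \<or> j \<notin> S \<longrightarrow> A $ i $ j = (if i = j then 1 else 0))"

definition border :: "'a::conj_div_algebra^'n^'n \<Rightarrow> 'n \<Rightarrow> 'a^'n \<Rightarrow> real \<Rightarrow> 'a^'n^'n" where
  "border P k b s = (\<chi> i j. if i = k then (if j = k then of_real s else conjugate (b $ j))
     else if j = k then b $ i else P $ i $ j)"

lemma sum_UNIV_remove:
  fixes k :: "'n::finite" shows "(\<Sum>j\<in>UNIV. F j) = F k + (\<Sum>j\<in>UNIV - {k}. F j :: 'a::comm_monoid_add)"
  by (rule sum.remove) auto

lemma axis_nth_if: "axis k c $ i = (if i = k then c else 0)"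
  by (simp add: axis_def)

text \<open>
  Scaling the coordinate \<open>k\<close> by \<open>2\<close> conjugates this map to its square, so its determinant is idempotent.
\<close>
lemma edet_add_rank_one:
  fixes c :: "'a::conj_div_algebra^'n"
  assumes "c $ k = 0" shows "edet (\<lambda>x. x + rscale c (x $ k)) = 1"
proof -
  define L where "L t x = x + rscale (t *\<^sub>R c) (x $ k)" for t x
  have lin: "linear (L t)" for t
    by (rule linearI) (simp_all add: L_def rscale_def vec_eq_iff algebra_simps)
  have LL: "L t (L u x) = L (t + u) x" for t u x
    using assms by (simp add: L_def rscale_def vec_eq_iff algebra_simps)
  have L_edet: "edet (L (t + u)) = edet (L t) * edet (L u)" for t u
    using edet_compose[OF lin lin, of t u] by (simp add: LL[abs_def])
  define D where "D t x = (\<chi> i. if i = k then t *\<^sub>R x $ i else (x $ i :: 'a))" for t :: real and x :: "'a^'n"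
  have linD: "linear (D t)" for t
    by (rule linearI) (simp_all add: D_def vec_eq_iff algebra_simps)
  have "D (1/2) (D 2 x) = x" for x by (simp add: D_def vec_eq_iff)
  then have "edet (D (1/2)) * edet (D 2) = 1"
    using edet_compose[OF linD linD, of "1/2" 2] by (simp add: edet_ident)
  moreover have "D (1/2) (L 1 (D 2 x)) = L 2 x" for x
    using assms by (simp add: D_def L_def rscale_def vec_eq_iff)
  then have "edet (D (1/2)) * (edet (L 1) * edet (D 2)) = edet (L 2)"
    using edet_compose[OF linD linear_compose[OF linD lin, unfolded o_def], of "1/2" 1 2]
      edet_compose[OF lin linD, of 1 2] by simp
  ultimately have "edet (L 1) = edet (L 2)" by (simp add: algebra_simps)
  also have "\<dots> = edet (L 1) * edet (L 1)" using L_edet[of 1 1] by simp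
  finally have "edet (L 1) = 0 \<or> edet (L 1) = 1" by simp
  moreover have "L 0 = (\<lambda>x. x)" by (auto simp: L_def rscale_def vec_eq_iff)
  then have "edet (L 1) * edet (L (-1)) = 1" using L_edet[of 1 "-1"] by (simp add: edet_ident)
  ultimately show ?thesis by (auto simp: L_def[abs_def])
qed

text \<open>Exactly \<open>DIM('a)\<close> vectors of the real basis sit on the coordinate
  \<open>k\<close>; each is multiplied by \<open>r\<close>, all others are fixed.\<close>

lemma edet_scale_coordinate:
  "edet (\<lambda>x. x + axis k (((r - 1) *\<^sub>R (x $ k :: 'a::conj_div_algebra)))) = r ^ DIM('a)"
  for k :: "'n::finite"
proof -
  have "edet (\<lambda>x :: 'a^'n. x + axis k (((r - 1) *\<^sub>R (x $ k)))) = (\<Prod>b\<in>(Basis :: ('a^'n) set). if b $ k = 0 then 1 else r)"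
  proof (rule edet_diagonal[where c = "\<lambda>b :: 'a^'n. if b $ k = 0 then 1 else r"])
    fix b :: "'a^'n" assume "b \<in> Basis"
    then obtain i u where b: "b = axis i u" "u \<in> Basis" by (auto simp: Basis_vec_def)
    then show "b + axis k ((r - 1) *\<^sub>R (b $ k)) = (if b $ k = 0 then 1 else r) *\<^sub>R b"
      using nonzero_Basis[OF b(2)] by (auto simp: vec_eq_iff axis_nth_if algebra_simps)
  qed
  also have "\<dots> = (\<Prod>i\<in>UNIV. \<Prod>u\<in>Basis. if axis i u $ k = (0::'a) then 1 else r)"
    unfolding Basis_vec_def
    by (subst prod.UNION_disjoint)
      (auto simp: axis_eq_axis UNION_singleton_eq_range prod.reindex inj_on_def)
  also have "\<dots> = (\<Prod>i\<in>UNIV. if i = k then r ^ DIM('a) else 1)"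
  proof (rule prod.cong[OF refl])
    fix i
    have "(\<Prod>u\<in>Basis. if axis i u $ k = (0::'a) then 1 else r) = (\<Prod>u\<in>(Basis::'a set). if i = k then r else 1)"
      by (rule prod.cong) (auto simp: axis_nth_if)
    then show "(\<Prod>u\<in>Basis. if axis i u $ k = (0::'a) then 1 else r) = (if i = k then r ^ DIM('a) else 1)"
      by auto
  qed
  also have "\<dots> = r ^ DIM('a)" by simp
  finally show ?thesis .
qed

text \<open>The hypothesis makes \<open>G ** conj_transpose G\<close> the inverse of
  \<open>P\<close>. On one side this follows because the injective map \<open>G\<close> is
  surjective; the other side is the adjoint of the first.\<close>

lemma inverse_of_factor:
  fixes P G :: "'a::conj_div_algebra^'n^'n"
  assumes "conj_transpose G ** P ** G = mat 1" and P: "conj_transpose P = P"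
  shows "P *v (G *v (conj_transpose G *v x)) = x" "G *v (conj_transpose G *v (P *v x)) = x"
    "edet ((*v) P) * (edet ((*v) (conj_transpose G)))\<^sup>2 = 1"
proof -
  have e: "conj_transpose G *v (P *v (G *v x)) = x" for x
    using arg_cong[OF assms(1), of "\<lambda>A. A *v x"] by (simp add: matrix_vector_mul_assoc[symmetric])
  have "inj ((*v) G)" by (rule injI) (metis e)
  then have "surj ((*v) G)" using linear_injective_imp_surjective[OF linear_matrix_mult] by blast
  then show 2: "G *v (conj_transpose G *v (P *v x)) = x" for x by (metis e surjD)
  show "P *v (G *v (conj_transpose G *v x)) = x"
  proof (rule vector_eq_ldot[THEN iffD1], rule allI)
    fix z
    have "z \<bullet> (P *v (G *v (conj_transpose G *v x))) = (G *v (conj_transpose G *v (P *v z))) \<bullet> x"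
      by (simp add: inner_matrix_mult P)
    then show "z \<bullet> (P *v (G *v (conj_transpose G *v x))) = z \<bullet> x" by (simp add: 2)
  qed
  have "edet (\<lambda>x. conj_transpose G *v (P *v (G *v x)))
      = edet ((*v) (conj_transpose G)) * (edet ((*v) P) * edet ((*v) G))"
    using edet_compose[OF linear_matrix_mult[of P] linear_matrix_mult[of G]]
      edet_compose[OF linear_matrix_mult[of "conj_transpose G"]
        linear_compose[OF linear_matrix_mult[of G] linear_matrix_mult[of P], unfolded o_def]] by simp
  moreover have "edet ((*v) (conj_transpose G)) = edet ((*v) G)"
    by (rule edet_adjoint) (rule inner_matrix_mult)
  ultimately show "edet ((*v) P) * (edet ((*v) (conj_transpose G)))\<^sup>2 = 1"
    by (simp add: e edet_ident power2_eq_square algebra_simps)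
qed

text \<open>Write \<open>x = G *v y\<close> with \<open>y = conj_transpose G *v (P *v x)\<close>;
  the form at \<open>x\<close> is then \<open>y \<bullet> y\<close>.\<close>

lemma pos_def_coneI_factor:
  fixes P G :: "'a::conj_div_algebra^'n^'n"
  assumes "conj_transpose G ** P ** G = mat 1" and P: "conj_transpose P = P"
  shows "P \<in> pos_def_cone"
proof -
  have "x \<bullet> (P *v x) > 0" if "x \<noteq> 0" for x
  proof -
    let ?y = "conj_transpose G *v (P *v x)"
    have x: "G *v ?y = x" by (rule inverse_of_factor(2)[OF assms])
    have "x \<bullet> (P *v x) = (G *v ?y) \<bullet> (P *v x)" by (simp add: x)
    also have "\<dots> = ?y \<bullet> ?y" by (simp only: inner_matrix_mult[of G])
    moreover have "?y \<noteq> 0" using x that linear_0[OF linear_matrix_mult] by force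
    ultimately show ?thesis by simp
  qed
  then show ?thesis using P by (simp add: pos_def_cone_iff)
qed

lemma conj_transpose_border:
  "conj_transpose P = P \<Longrightarrow> conj_transpose (border P k b s) = border P k b s"
  by (auto simp: border_def conj_transpose_def vec_eq_iff conjugate_conjugate)

text \<open>\<open>P\<close> has a 1 at position (k, k) and already contributes \<open>x $ k\<close>
  there, hence \<open>s - 1\<close> in place of \<open>s\<close>.\<close>

lemma border_mult:
  assumes "id_outside S P" "k \<notin> S" "b $ k = 0"
  shows "border P k b s *v x = P *v x + rscale b (x $ k) + axis k (cinner b x + (s - 1) *\<^sub>R (x $ k))"
proof (unfold vec_eq_iff, rule allI)
  fix i
  have P: "P $ i $ k = (if i = k then 1 else 0)" "P $ k $ i = (if i = k then 1 else 0)" for i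
    using assms by (auto simp: id_outside_def)
  show "(border P k b s *v x) $ i = (P *v x + rscale b (x $ k) + axis k (cinner b x + (s - 1) *\<^sub>R (x $ k))) $ i"
  proof (cases "i = k")
    case True
    have "(border P k b s *v x) $ k = of_real s * x $ k + (\<Sum>j\<in>UNIV - {k}. conjugate (b $ j) * x $ j)"
      unfolding matrix_vector_mult_def vec_lambda_beta
      by (subst sum_UNIV_remove[of _ k]) (simp add: border_def)
    moreover have "cinner b x = (\<Sum>j\<in>UNIV - {k}. conjugate (b $ j) * x $ j)"
      unfolding cinner_def by (subst sum_UNIV_remove[of _ k]) (simp add: assms(3))
    moreover have "(P *v x) $ k = x $ k"
      unfolding matrix_vector_mult_def vec_lambda_beta
      by (subst sum_UNIV_remove[of _ k]) (simp add: P)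
    ultimately show ?thesis using True assms(3) by (simp add: rscale_def axis_nth_if scaleR_left_diff_distrib of_real_def)
  next
    case False
    have "(border P k b s *v x) $ i = b $ i * x $ k + (\<Sum>j\<in>UNIV - {k}. P $ i $ j * x $ j)"
      unfolding matrix_vector_mult_def vec_lambda_beta
      by (subst sum_UNIV_remove[of _ k]) (simp add: border_def False)
    moreover have "(P *v x) $ i = (\<Sum>j\<in>UNIV - {k}. P $ i $ j * x $ j)"
      unfolding matrix_vector_mult_def vec_lambda_beta
      by (subst sum_UNIV_remove[of _ k]) (simp add: P False)
    ultimately show ?thesis using False by (simp add: rscale_def axis_nth_if)
  qed
qed

lemma id_outside_mult_nth:
  assumes "id_outside S P" "k \<notin> S" shows "(P *v x) $ k = x $ k"
proof -
  have "P $ k $ i = (if i = k then 1 else 0)" for i using assms by (auto simp: id_outside_def)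
  then show ?thesis unfolding matrix_vector_mult_def vec_lambda_beta
    by (subst sum_UNIV_remove[of _ k]) simp
qed

lemma id_outside_conj_transpose: "id_outside S P \<Longrightarrow> id_outside S (conj_transpose P)"
  by (auto simp: id_outside_def conj_transpose_def)

text \<open>On vectors \<open>y\<close> with \<open>y $ k = 0\<close> both matrices have the same
  quadratic form; the coordinate \<open>k\<close> adds only the square of its norm, since
  \<open>P\<close> acts on it as the identity.\<close>

lemma pos_def_cone_of_border:
  assumes P: "id_outside S P" "k \<notin> S" "b $ k = 0" "conj_transpose P = P"
    and pd: "border P k b s \<in> pos_def_cone"
  shows "P \<in> pos_def_cone"
proof -
  have "x \<bullet> (P *v x) > 0" if "x \<noteq> 0" for x
  proof -
    define y where "y = x - axis k (x $ k)"
    have yk: "y $ k = 0" by (simp add: y_def)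
    have b: "border P k b s *v y = P *v y + axis k (cinner b y)"
      using border_mult[OF P(1,2,3), of s y] yk by (simp add: rscale_def vec_eq_iff)
    have y: "y \<bullet> (border P k b s *v y) = y \<bullet> (P *v y)"
      unfolding b by (simp add: inner_add_right inner_commute[of y "axis _ _"] inner_axis' yk)
    have x: "x = y + axis k (x $ k)" by (simp add: y_def)
    have Pk: "P *v axis k c = axis k c" for c
    proof -
      have "P $ i $ k = (if i = k then 1 else 0)" for i using P by (auto simp: id_outside_def)
      then show ?thesis by (simp add: matrix_vector_mult_def vec_eq_iff axis_nth_if if_distrib[of "(*) _"] cong: if_cong)
    qed
    have "x \<bullet> (P *v x) = (y + axis k (x $ k)) \<bullet> (P *v (y + axis k (x $ k)))" using x by simp
    also have "\<dots> = y \<bullet> (P *v y) + (norm (x $ k))\<^sup>2"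
      using yk id_outside_mult_nth[OF P(1,2), of y]
      by (simp add: matrix_vector_right_distrib Pk inner_add_left inner_add_right inner_axis inner_axis'
          power2_norm_eq_inner)
    finally have e: "x \<bullet> (P *v x) = y \<bullet> (P *v y) + (norm (x $ k))\<^sup>2" .
    show ?thesis
    proof (cases "y = 0")
      case True
      then have "x $ k \<noteq> 0" using x that by (metis add.left_neutral axis_eq_0_iff)
      then show ?thesis using e True by simp
    next
      case False
      then show ?thesis using pos_def_coneD(2)[OF pd False] y e by (simp add: add_pos_nonneg)
    qed
  qed
  then show ?thesis using P(4) by (simp add: pos_def_cone_iff)
qed

text \<open>
  Block elimination: with \<open>c = P\<inverse> b\<close> and \<open>L x = x + c x\<^sub>k\<close>, the bordered matrix is
  \<open>L\<^sup>* D P L\<close> where \<open>D\<close> multiplies the coordinate \<open>k\<close> by the Schur complement.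
\<close>
lemma
  fixes P G :: "'a::conj_div_algebra^'n^'n" and s :: real
  assumes P: "id_outside S P" "k \<notin> S" "b $ k = 0" "conj_transpose P = P"
    and b: "\<And>i. i \<notin> S \<Longrightarrow> b $ i = 0"
    and G: "id_outside S G" "conj_transpose G ** P ** G = mat 1"
  defines "r \<equiv> s - (norm (conj_transpose G *v b))\<^sup>2"
  shows edet_border: "edet ((*v) (border P k b s)) = r ^ DIM('a) * edet ((*v) P)"
    and border_pos_def_iff: "border P k b s \<in> pos_def_cone \<longleftrightarrow> r > 0"
    and border_factor: "r > 0 \<Longrightarrow>
      \<exists>H. id_outside (insert k S) H \<and> conj_transpose H ** border P k b s ** H = mat 1"
proof -
  define c where "c = G *v (conj_transpose G *v b)"
  define L where "L x = x + rscale c (x $ k)" for x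
  define L' where "L' y = y + axis k (cinner c y)" for y
  define D where "D t y = y + axis k ((t - 1) *\<^sub>R (y $ k))" for t :: real and y :: "'a^'n"
  have ck: "c $ k = 0"
    unfolding c_def using P G
    by (simp add: id_outside_mult_nth[OF G(1) P(2)] id_outside_mult_nth[OF id_outside_conj_transpose[OF G(1)] P(2)])
  have Pc: "P *v c = b" unfolding c_def by (rule inverse_of_factor(1)[OF G(2) P(4)])
  have cP: "cinner c (P *v x) = cinner b x" for x
    using cinner_matrix_mult[of P c x] P(4) Pc by simp
  \<comment> \<open>As \<open>G ** conj_transpose G\<close> inverts \<open>P\<close>, this is the
    inverse of \<open>P\<close> evaluated as a form at \<open>b\<close>, so that \<open>r\<close> is
    the Schur complement.\<close>
  have cb: "cinner c b = of_real ((norm (conj_transpose G *v b))\<^sup>2)"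
    unfolding c_def cinner_matrix_mult cinner_self ..
  have Pk: "(P *v x) $ k = x $ k" for x by (rule id_outside_mult_nth[OF P(1,2)])
  have c0: "cinner c (axis k u) = 0" for u
    unfolding cinner_def by (subst sum_UNIV_remove[of _ k]) (simp add: ck axis_nth_if)
  have Lk: "L x $ k = x $ k" for x by (simp add: L_def rscale_def ck)
  have PL: "P *v L x = P *v x + rscale b (x $ k)" for x
    by (simp add: L_def matrix_vector_right_distrib matrix_mult_rscale Pc)
  have bord: "border P k b s *v x = L' (D r (P *v L x))" for x
  proof -
    have bk: "(P *v x + rscale b (x $ k)) $ k = x $ k" by (simp add: Pk rscale_def P(3))
    have "L' (D r (P *v L x)) = P *v x + rscale b (x $ k) + axis k ((r - 1) *\<^sub>R (x $ k))
        + axis k (cinner b x + cinner c b * x $ k)"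
      unfolding L'_def D_def PL bk by (simp add: cinner_add_right c0 cP cinner_rscale_right)
    also have "\<dots> = P *v x + rscale b (x $ k) + axis k (cinner b x + (s - 1) *\<^sub>R (x $ k))"
      by (simp add: vec_eq_iff axis_nth_if cb r_def algebra_simps of_real_def)
    finally show ?thesis by (simp add: border_mult[OF P(1,2,3)])
  qed
  have linL: "linear L" unfolding L_def
    by (rule linearI) (simp_all add: rscale_def vec_eq_iff algebra_simps)
  have linL': "linear L'" unfolding L'_def
    by (rule linearI) (simp_all add: vec_eq_iff axis_nth_if cinner_def algebra_simps sum.distrib scaleR_sum_right)
  have linD: "linear (D t)" for t unfolding D_def
    by (rule linearI) (simp_all add: vec_eq_iff axis_nth_if algebra_simps)
  have adj: "L x \<bullet> y = x \<bullet> L' y" for x y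
  proof -
    have "rscale c (x $ k) \<bullet> y = (conjugate (x $ k) * cinner c y) \<bullet> 1"
      by (simp add: inner_eq_cinner cinner_rscale_left)
    also have "\<dots> = x \<bullet> axis k (cinner c y)"
      using inner_mult_left_adjoint[of "conjugate (x $ k)" "cinner c y" 1]
      by (simp add: inner_axis conjugate_conjugate inner_commute)
    finally show ?thesis by (simp add: L_def L'_def inner_add_left inner_add_right)
  qed
  have eL: "edet L = 1" unfolding L_def by (rule edet_add_rank_one[OF ck])
  have eL': "edet L' = 1" using edet_adjoint[of L L', OF adj] eL by simp
  have eD: "edet (D r) = r ^ DIM('a)" unfolding D_def by (rule edet_scale_coordinate)
  note lin = linear_matrix_mult[of P]
  have "edet (\<lambda>x. L' (D r (P *v L x))) = edet L' * (edet (D r) * (edet ((*v) P) * edet L))"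
    using edet_compose[OF linL' linear_compose[OF linear_compose[OF linL lin] linD, unfolded o_def]]
      edet_compose[OF linD linear_compose[OF linL lin, unfolded o_def]]
      edet_compose[OF lin linL] by simp
  then show "edet ((*v) (border P k b s)) = r ^ DIM('a) * edet ((*v) P)"
    by (simp add: bord[abs_def] eL eL' eD)
  have herm: "conj_transpose (border P k b s) = border P k b s"
    by (rule conj_transpose_border[OF P(4)])
  show fac: "\<exists>H. id_outside (insert k S) H \<and> conj_transpose H ** border P k b s ** H = mat 1" if "r > 0"
  proof -
    \<comment> \<open>The matrix of the inverse of \<open>L\<close> after \<open>G\<close> after
      \<open>D (1 / sqrt r)\<close>. The inverse of \<open>L\<close> undoes the outer factors,
      \<open>G\<close> turns \<open>P\<close> into the identity, and the scaling of the coordinate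
      \<open>k\<close> cancels \<open>D r\<close>.\<close>
    define N where "N = (\<chi> i j. if j = k \<and> i \<noteq> k then - c $ i /\<^sub>R sqrt r else 
      if j = k then of_real (1 / sqrt r) else G $ i $ j)"
    have Gk: "G $ i $ k = (if i = k then 1 else 0)" "G $ k $ i = (if i = k then 1 else 0)" for i
      using G(1) P(2) by (auto simp: id_outside_def)
    have Nx: "N *v x = G *v (D (1 / sqrt r) x) - rscale c (x $ k /\<^sub>R sqrt r)" for x
    proof (unfold vec_eq_iff, rule allI)
      fix i
      have "(N *v x) $ i = N $ i $ k * x $ k + (\<Sum>j\<in>UNIV - {k}. N $ i $ j * x $ j)"
        unfolding matrix_vector_mult_def vec_lambda_beta by (rule sum_UNIV_remove)
      also have "\<dots> = N $ i $ k * x $ k + (\<Sum>j\<in>UNIV - {k}. G $ i $ j * x $ j)"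
        by (simp add: N_def)
      finally have 1: "(N *v x) $ i = N $ i $ k * x $ k + (\<Sum>j\<in>UNIV - {k}. G $ i $ j * x $ j)" .
      have "(G *v (D (1 / sqrt r) x)) $ i = G $ i $ k * D (1 / sqrt r) x $ k 
          + (\<Sum>j\<in>UNIV - {k}. G $ i $ j * D (1 / sqrt r) x $ j)"
        unfolding matrix_vector_mult_def vec_lambda_beta by (rule sum_UNIV_remove)
      also have "\<dots> = G $ i $ k * (x $ k /\<^sub>R sqrt r) + (\<Sum>j\<in>UNIV - {k}. G $ i $ j * x $ j)"
        by (simp add: D_def axis_nth_if algebra_simps divide_inverse)
      finally show "(N *v x) $ i = (G *v (D (1 / sqrt r) x) - rscale c (x $ k /\<^sub>R sqrt r)) $ i"
        using 1 ck Gk(1)[of i] by (auto simp: N_def rscale_def of_real_def divide_inverse)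
    qed
    have c_out: "c $ i = 0" if "i \<notin> S" for i
      unfolding c_def using b[OF that]
      by (simp add: id_outside_mult_nth[OF G(1) that] id_outside_mult_nth[OF id_outside_conj_transpose[OF G(1)] that])
    have supp: "id_outside (insert k S) N"
      using G(1) P(2) c_out by (auto simp: id_outside_def N_def)
    let ?t = "1 / sqrt r"
    have Dk: "D t x $ k = t *\<^sub>R x $ k" for t x by (simp add: D_def axis_nth_if algebra_simps)
    have Gxk: "(G *v x) $ k = x $ k" for x by (rule id_outside_mult_nth[OF G(1) P(2)])
    have LN: "L (N *v x) = G *v D ?t x" for x
    proof -
      have "(N *v x) $ k = ?t *\<^sub>R x $ k" by (simp add: Nx Gxk Dk rscale_def ck)
      then show ?thesis by (simp add: L_def Nx rscale_def vec_eq_iff divide_inverse)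
    qed
    have e: "conj_transpose G *v (P *v (G *v x)) = x" for x
      using arg_cong[OF G(2), of "\<lambda>A. A *v x"] by (simp add: matrix_vector_mul_assoc[symmetric])
    have DD: "D ?t x \<bullet> D ?t y = x \<bullet> y + (1 / r - 1) * (x $ k \<bullet> y $ k)" for x y
    proof -
      have "D ?t x \<bullet> D ?t y = x \<bullet> y + (2 * (?t - 1) + (?t - 1) * (?t - 1)) * (x $ k \<bullet> y $ k)"
        unfolding D_def by (simp add: inner_add_left inner_add_right inner_axis inner_axis' axis_nth_if algebra_simps)
      also have "2 * (?t - 1) + (?t - 1) * (?t - 1) = 1 / r - 1"
        using that by (simp add: field_simps)
      finally show ?thesis .
    qed
    have "x \<bullet> (conj_transpose N *v (border P k b s *v (N *v y))) = x \<bullet> y" for x y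
    proof -
      have "x \<bullet> (conj_transpose N *v (border P k b s *v (N *v y))) = L (N *v x) \<bullet> D r (P *v L (N *v y))"
        by (simp add: inner_matrix_mult[symmetric] bord adj)
      also have "\<dots> = (G *v D ?t x) \<bullet> (P *v (G *v D ?t y)) + (r - 1) * ((?t *\<^sub>R x $ k) \<bullet> (?t *\<^sub>R y $ k))"
        unfolding LN D_def[of r] by (simp add: inner_add_right inner_axis Gxk Pk Dk)
      also have "(G *v D ?t x) \<bullet> (P *v (G *v D ?t y)) = D ?t x \<bullet> D ?t y"
        by (simp add: inner_matrix_mult[of G] e)
      also have "\<dots> + (r - 1) * ((?t *\<^sub>R x $ k) \<bullet> (?t *\<^sub>R y $ k)) = x \<bullet> y"
        unfolding DD using that by (simp add: field_simps)
      finally show ?thesis .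
    qed
    then have "conj_transpose N *v (border P k b s *v (N *v y)) = y" for y
      using vector_eq_ldot by blast
    then have "conj_transpose N ** border P k b s ** N = mat 1"
      by (simp add: matrix_eq matrix_vector_mul_assoc[symmetric])
    with supp show ?thesis by blast
  qed
  show "border P k b s \<in> pos_def_cone \<longleftrightarrow> r > 0"
  proof
    assume "r > 0" then show "border P k b s \<in> pos_def_cone"
      using fac pos_def_coneI_factor[OF _ herm] by blast
  next
    assume pd: "border P k b s \<in> pos_def_cone"
    \<comment> \<open>The preimage of the unit vector at \<open>k\<close> under \<open>L\<close>;
      the quadratic form takes the value \<open>r\<close> there.\<close>
    define x where "x = axis k 1 - c"
    have xk: "x $ k = 1" by (simp add: x_def ck)
    have Lx: "L x = axis k 1" using xk by (simp add: L_def x_def rscale_def vec_eq_iff)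
    have Px: "P *v axis k 1 = axis k 1"
      using P(1,2) by (auto simp: matrix_vector_mult_def vec_eq_iff axis_nth_if if_distrib[of "(*) _"] id_outside_def cong: if_cong)
    have "x \<bullet> (border P k b s *v x) = L x \<bullet> D r (P *v L x)" by (simp add: bord adj)
    also have "\<dots> = r" 
      by (simp add: Lx Px D_def inner_axis' axis_nth_if) (simp add: algebra_simps power2_norm_eq_inner[symmetric])
    finally show "r > 0" using pos_def_coneD(2)[OF pd, of x] xk by force
  qed
qed

text \<open>A Cholesky factorisation, one row and column at a time. The smaller block inherits
  positivity, and positivity of \<open>A\<close> makes the Schur complement positive, so that the
  factor extends to the new index.\<close>

lemma pos_def_factor:
  fixes A :: "'a::conj_div_algebra^'n^'n"
  assumes "finite S" "id_outside S A" "A \<in> pos_def_cone"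
  shows "\<exists>G. id_outside S G \<and> conj_transpose G ** A ** G = mat 1"
  using assms
proof (induction S arbitrary: A rule: finite_induct)
  case empty
  then have "A = mat 1" by (auto simp: id_outside_def vec_eq_iff mat_def)
  then show ?case by (intro exI[of _ "mat 1"] conjI) (simp add: id_outside_def mat_def, simp)
next
  case (insert k S)
  note herm = pos_def_coneD(1)[OF insert.prems(2)]
  have Aij: "conjugate (A $ j $ i) = A $ i $ j" for i j
    using arg_cong[OF herm, of "\<lambda>M. M $ i $ j"] by (simp add: conj_transpose_def)
  define P where "P = (\<chi> i j. if i = k \<or> j = k then if i = j then 1 else 0 else A $ i $ j)"
  define b where "b = (\<chi> i. if i = k then 0 else A $ i $ k)"
  obtain s where s: "A $ k $ k = of_real s" using self_conjugate_real[OF Aij[of k k]] by blast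
  have A: "A = border P k b s"
    by (auto simp: border_def P_def b_def vec_eq_iff s Aij)
  have P: "id_outside S P" "conj_transpose P = P"
    using insert.prems(1) by (auto simp: id_outside_def P_def conj_transpose_def vec_eq_iff Aij)
  have b: "b $ i = 0" if "i \<notin> S" for i
    using insert.prems(1) that by (auto simp: id_outside_def b_def)
  note Pk = P(1) insert.hyps(2) b[OF insert.hyps(2)] P(2)
  have "P \<in> pos_def_cone" using insert.prems(2) by (intro pos_def_cone_of_border[OF Pk]) (simp add: A)
  then obtain G where G: "id_outside S G" "conj_transpose G ** P ** G = mat 1"
    using insert.IH[OF P(1)] by blast
  have "s - (norm (conj_transpose G *v b))\<^sup>2 > 0"
    using border_pos_def_iff[OF Pk b G] insert.prems(2) A by simp
  then show ?case using border_factor[OF Pk b G] A by simp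
qed

section \<open>Lebesgue measure in coordinates\<close>

interpretation lborel_prod: product_sigma_finite "\<lambda>_. lborel"
  by standard

lemma measurable_PiM_lborel_component:
  "i \<in> I \<Longrightarrow> (\<lambda>f. f i) \<in> borel_measurable (\<Pi>\<^sub>M i\<in>I. lborel :: 'b::euclidean_space measure)"
  using measurable_component_singleton[of i I "\<lambda>_. lborel :: 'b measure"]
  by (simp only: measurable_cong_sets[OF refl sets_lborel])

text \<open>Boxes are products of boxes of the factors, and boxes determine Lebesgue measure. The
  family \<open>e\<close> is general in order to cover both the entries of a vector and the columns
  of a matrix.\<close>

lemma lborel_eq_PiM_coordinates:
  fixes F :: "('i::finite \<Rightarrow> 'b::euclidean_space) \<Rightarrow> 'c::euclidean_space" and e :: "'i \<Rightarrow> 'b \<Rightarrow> 'c"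
  assumes e: "bij_betw (\<lambda>(i, b). e i b) (UNIV \<times> Basis) Basis"
    and F: "\<And>f i b. b \<in> Basis \<Longrightarrow> F f \<bullet> e i b = f i \<bullet> b"
  shows "F \<in> measurable (\<Pi>\<^sub>M i\<in>UNIV. lborel) borel"
    and "lborel = distr (\<Pi>\<^sub>M i\<in>UNIV. lborel) borel F"
proof -
  have eB: "Basis = (\<lambda>(i, b). e i b) ` (UNIV \<times> Basis)" using e by (auto simp: bij_betw_def)
  show meas: "F \<in> measurable (\<Pi>\<^sub>M i\<in>UNIV. lborel) borel"
    unfolding borel_measurable_euclidean_space[of F] eB
    by (auto simp: F intro!: borel_measurable_inner measurable_PiM_lborel_component)
  show "lborel = distr (\<Pi>\<^sub>M i\<in>UNIV. lborel) borel F"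
  proof (rule lborel_eqI)
    fix l u :: 'c assume le: "\<And>b. b \<in> Basis \<Longrightarrow> l \<bullet> b \<le> u \<bullet> b"
    define p where "p x i = (\<Sum>b\<in>Basis. (x \<bullet> e i b) *\<^sub>R b)" for x i
    have p: "p x i \<bullet> b = x \<bullet> e i b" if "b \<in> Basis" for x i b
      using that by (simp add: p_def inner_sum_left inner_Basis if_distrib[of "(*) _"] cong: if_cong)
    have "F -` box l u \<inter> space (\<Pi>\<^sub>M i\<in>UNIV. lborel) = (\<Pi>\<^sub>E i\<in>UNIV. box (p l i) (p u i))"
      by (auto simp: space_PiM mem_box PiE_iff eB F p)
    then have "emeasure (distr (\<Pi>\<^sub>M i\<in>UNIV. lborel) borel F) (box l u)
        = (\<Prod>i\<in>UNIV. emeasure lborel (box (p l i) (p u i)))"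
      by (simp add: emeasure_distr[OF meas] lborel_prod.emeasure_PiM)
    also have "\<dots> = (\<Prod>i\<in>UNIV. ennreal (\<Prod>b\<in>Basis. (u - l) \<bullet> e i b))"
    proof (rule prod.cong[OF refl])
      fix i
      have "e i b \<in> Basis" if "b \<in> Basis" for b using that eB by auto
      then have "\<forall>b\<in>Basis. p l i \<bullet> b \<le> p u i \<bullet> b" using le by (simp add: p)
      then show "emeasure lborel (box (p l i) (p u i)) = ennreal (\<Prod>b\<in>Basis. (u - l) \<bullet> e i b)"
        by (simp add: emeasure_lborel_box_eq inner_diff_left p)
    qed
    also have "\<dots> = ennreal (\<Prod>i\<in>UNIV. \<Prod>b\<in>Basis. (u - l) \<bullet> e i b)"
    proof (rule prod_ennreal)
      fix i
      have "e i b \<in> Basis" if "b \<in> Basis" for b using that eB by auto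
      then show "0 \<le> (\<Prod>b\<in>Basis. (u - l) \<bullet> e i b)" using le by (auto intro!: prod_nonneg simp: inner_diff_left)
    qed
    also have "(\<Prod>i\<in>UNIV. \<Prod>b\<in>Basis. (u - l) \<bullet> e i b) = (\<Prod>(i, b)\<in>UNIV \<times> Basis. (u - l) \<bullet> e i b)"
      by (simp add: prod.cartesian_product)
    also have "\<dots> = (\<Prod>c\<in>Basis. (u - l) \<bullet> c)"
      using prod.reindex_bij_betw[OF e, of "\<lambda>c. (u - l) \<bullet> c"] by (simp add: case_prod_beta)
    finally show "emeasure (distr (\<Pi>\<^sub>M i\<in>UNIV. lborel) borel F) (box l u) = (\<Prod>c\<in>Basis. (u - l) \<bullet> c)" .
  qed simp
qed

lemma bij_betw_axis_Basis:
  "bij_betw (\<lambda>(i, b). axis i b) (UNIV \<times> Basis) (Basis :: ('b::euclidean_space^'n) set)"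
  by (auto simp: bij_betw_def inj_on_def axis_eq_axis Basis_vec_def image_iff)

lemma nn_integral_lborel_vec:
  fixes h :: "'b::euclidean_space^'n \<Rightarrow> ennreal"
  assumes "h \<in> borel_measurable borel"
  shows "(\<integral>\<^sup>+x. h x \<partial>lborel) = (\<integral>\<^sup>+f. h (\<chi> i. f i) \<partial>(\<Pi>\<^sub>M i\<in>UNIV. lborel))"
proof -
  note 1 = lborel_eq_PiM_coordinates[OF bij_betw_axis_Basis, of "\<lambda>f. \<chi> i. f i"]
  show ?thesis
    by (subst 1(2)) (auto intro!: nn_integral_distr 1(1) assms simp: inner_axis)
qed

text \<open>A matrix is a vector of rows, whereas the induction needs independent columns; the
  standard basis is regrouped by column.\<close>

lemma nn_integral_lborel_columns:
  fixes h :: "'b::euclidean_space^'n^'m \<Rightarrow> ennreal"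
  assumes "h \<in> borel_measurable borel"
  shows "(\<integral>\<^sup>+x. h x \<partial>lborel) = (\<integral>\<^sup>+t. h (\<chi> l j. t j $ l) \<partial>(\<Pi>\<^sub>M j\<in>UNIV. lborel))"
proof -
  define e where "e j v = (\<chi> l. axis j (v $ l))" for j :: 'n and v :: "'b^'m"
  have e_axis: "e j (axis l b) = axis l (axis j b)" for j l b
    by (auto simp: e_def vec_eq_iff axis_def)
  have "bij_betw (\<lambda>(j, v). e j v) (UNIV \<times> Basis) Basis"
    by (auto simp: bij_betw_def inj_on_def Basis_vec_def image_iff e_axis axis_eq_axis nonzero_Basis)
  note 1 = lborel_eq_PiM_coordinates[OF this, of "\<lambda>t. \<chi> l j. t j $ l"]
  have "(\<chi> l j. t j $ l) \<bullet> e i b = t i \<bullet> b" for t :: "'n \<Rightarrow> 'b^'m" and i b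
    by (simp add: inner_vec_def[of "t i"] e_def inner_vec_def[of "\<chi> l j. t j $ l"] inner_axis)
  note 1 = 1[OF this]
  show ?thesis
    by (subst 1(2)) (auto intro!: nn_integral_distr 1(1) assms)
qed

lemma nn_integral_PiM_reindex:
  fixes g :: "('i \<Rightarrow> 'b::euclidean_space) \<Rightarrow> ennreal"
  assumes S: "finite S" "inj_on r S" and g: "g \<in> borel_measurable (\<Pi>\<^sub>M i\<in>S. lborel)"
  shows "(\<integral>\<^sup>+x. g (\<lambda>i\<in>S. x (r i)) \<partial>(\<Pi>\<^sub>M j\<in>r ` S. lborel)) = (\<integral>\<^sup>+y. g y \<partial>(\<Pi>\<^sub>M i\<in>S. lborel))"
proof -
  let ?R = "\<lambda>x. \<lambda>i\<in>S. x (r i)"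
  have m: "?R \<in> measurable (\<Pi>\<^sub>M j\<in>r ` S. lborel) (\<Pi>\<^sub>M i\<in>S. lborel :: 'b measure)"
    by (intro measurable_restrict measurable_component_singleton) auto
  have "distr (\<Pi>\<^sub>M j\<in>r ` S. lborel) (\<Pi>\<^sub>M i\<in>S. lborel) ?R = (\<Pi>\<^sub>M i\<in>S. lborel :: 'b measure)"
  proof (rule lborel_prod.PiM_eqI)
    fix A :: "'i \<Rightarrow> 'b set" assume A: "\<And>i. i \<in> S \<Longrightarrow> A i \<in> sets lborel"
    have "?R -` Pi\<^sub>E S A \<inter> space (\<Pi>\<^sub>M j\<in>r ` S. lborel) = (\<Pi>\<^sub>E j\<in>r ` S. A (the_inv_into S r j))"
      using S by (auto simp: space_PiM PiE_iff the_inv_into_f_f)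
    moreover have "A (the_inv_into S r j) \<in> sets lborel" if "j \<in> r ` S" for j
      using that A S by (auto simp: the_inv_into_f_f)
    ultimately have "emeasure (distr (\<Pi>\<^sub>M j\<in>r ` S. lborel) (\<Pi>\<^sub>M i\<in>S. lborel) ?R) (Pi\<^sub>E S A)
        = (\<Prod>j\<in>r ` S. emeasure lborel (A (the_inv_into S r j)))"
      using S A by (subst emeasure_distr[OF m]) (auto intro!: sets_PiM_I_finite lborel_prod.emeasure_PiM)
    also have "\<dots> = (\<Prod>i\<in>S. emeasure lborel (A i))"
      using S by (simp add: prod.reindex the_inv_into_f_f)
    finally show "emeasure (distr (\<Pi>\<^sub>M j\<in>r ` S. lborel) (\<Pi>\<^sub>M i\<in>S. lborel) ?R) (Pi\<^sub>E S A)
        = (\<Prod>i\<in>S. emeasure lborel (A i))" .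
  qed (use S in auto)
  then show ?thesis using nn_integral_distr[OF m, of g] g by simp
qed

section \<open>The squared norm under Lebesgue measure\<close>

text \<open>The density of the squared norm under Lebesgue measure in real dimension 2a.\<close>

definition radial_density :: "real \<Rightarrow> real \<Rightarrow> real" where
  "radial_density a q = (if q > 0 then pi powr a / Gamma a * q powr (a - 1) else 0)"

lemma radial_density_measurable [measurable]: "radial_density a \<in> borel_measurable borel"
  unfolding radial_density_def[abs_def] by measurable

lemma radial_density_nonneg [simp]: "a > 0 \<Longrightarrow> radial_density a q \<ge> 0"
  by (simp add: radial_density_def Gamma_real_pos less_imp_le)

lemma nn_integral_radial_density_atMost:
  assumes a: "a > 0"
  shows "(\<integral>\<^sup>+q. ennreal (radial_density a q) * indicator {..r} q \<partial>lborel)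
    = ennreal (if r > 0 then pi powr a / Gamma (a + 1) * r powr a else 0)"
proof (cases "r > 0")
  case True
  have "((\<lambda>x. x powr (a - 1)) has_integral (r powr (a - 1 + 1) / (a - 1 + 1))) {0..r}"
    using a True by (intro has_integral_powr_from_0) auto
  then have "((\<lambda>x. pi powr a / Gamma a * x powr (a - 1)) has_integral (pi powr a / Gamma a * (r powr a / a))) {0..r}"
    by (intro has_integral_mult_right) simp
  then have "(\<integral>\<^sup>+q. ennreal (pi powr a / Gamma a * q powr (a - 1)) * indicator {0..r} q \<partial>lborel)
      = ennreal (pi powr a / Gamma a * (r powr a / a))"
    using a by (intro nn_integral_has_integral_lebesgue') (auto simp: Gamma_real_pos less_imp_le)
  also have "pi powr a / Gamma a * (r powr a / a) = pi powr a / Gamma (a + 1) * r powr a"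
    using a Gamma_real_pos[OF a] by (subst Gamma_plus1) (auto simp: nonpos_Ints_def)
  also have "(\<integral>\<^sup>+q. ennreal (pi powr a / Gamma a * q powr (a - 1)) * indicator {0..r} q \<partial>lborel)
    = (\<integral>\<^sup>+q. ennreal (radial_density a q) * indicator {..r} q \<partial>lborel)"
    by (intro nn_integral_cong) (auto simp: radial_density_def indicator_def)
  finally show ?thesis using True by simp
next
  case False
  then have "(\<integral>\<^sup>+q. ennreal (radial_density a q) * indicator {..r} q \<partial>lborel) = (\<integral>\<^sup>+q. 0 \<partial>(lborel :: real measure))"
    by (intro nn_integral_cong) (auto simp: radial_density_def indicator_def)
  then show ?thesis using False by simp
qed

text \<open>The ball of radius \<open>sqrt r\<close> has volume
  \<open>pi powr a / Gamma (a + 1) * r powr a\<close> with \<open>a\<close> half the dimension,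
  which is also the integral of the radial density up to \<open>r\<close>. Half-lines are stable
  under intersection and generate the Borel sets.\<close>

lemma nn_integral_norm_square:
  fixes g :: "real \<Rightarrow> ennreal"
  assumes [measurable]: "g \<in> borel_measurable borel"
  shows "(\<integral>\<^sup>+x. g ((norm x)\<^sup>2) \<partial>(lborel :: 'a::euclidean_space measure))
    = (\<integral>\<^sup>+q. ennreal (radial_density (DIM('a) / 2) q) * g q \<partial>lborel)"
proof -
  let ?a = "DIM('a) / 2"
  let ?N = "distr (lborel :: 'a measure) borel (\<lambda>x. (norm x)\<^sup>2)"
  let ?D = "density lborel (\<lambda>q. ennreal (radial_density ?a q))"
  have em: "emeasure ?N {..r} = ennreal (if r > 0 then pi powr ?a / Gamma (?a + 1) * r powr ?a else 0)" for r
  proof -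
    have "emeasure ?N {..r} = emeasure lborel {x :: 'a. (norm x)\<^sup>2 \<le> r}"
      by (subst emeasure_distr) (auto simp: vimage_def)
    also have "\<dots> = ennreal (if r > 0 then pi powr ?a / Gamma (?a + 1) * r powr ?a else 0)"
    proof (cases "r > 0")
      case True
      then have "{x :: 'a. (norm x)\<^sup>2 \<le> r} = cball 0 (sqrt r)"
        by (auto simp: dist_norm real_le_rsqrt) (metis norm_ge_zero real_sqrt_le_iff real_sqrt_pow2 less_imp_le power_mono real_sqrt_ge_zero)
      moreover have "sqrt r ^ DIM('a) = r powr ?a"
        using True by (simp add: powr_half_sqrt[symmetric] powr_realpow[symmetric] powr_powr)
      ultimately show ?thesis using True by (simp add: emeasure_cball unit_ball_vol_def)
    next
      case False
      then have "{x :: 'a. (norm x)\<^sup>2 \<le> r} \<subseteq> {0}" 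
        by (auto simp: not_less) (meson norm_eq_zero order.antisym order.trans zero_le_power2 power_eq_0_iff)
      then have "emeasure lborel {x :: 'a. (norm x)\<^sup>2 \<le> r} \<le> emeasure lborel {0 :: 'a}"
        by (intro emeasure_mono) auto
      then show ?thesis using False by simp
    qed
    finally show ?thesis .
  qed
  have eq: "emeasure ?N {..r} = emeasure ?D {..r}" for r
    unfolding em by (simp add: emeasure_density nn_integral_radial_density_atMost)
  have "?N = ?D"
  proof (rule measure_eqI_generator_eq[where E="range atMost" and A="\<lambda>n. {..real n}" and \<Omega>=UNIV])
    show "Int_stable (range (atMost :: real \<Rightarrow> _))" by (auto simp: Int_stable_def)
    show "(\<Union>n. {..real n}) = UNIV" by (auto simp: real_arch_simple)
    show "emeasure ?N X = emeasure ?D X" if "X \<in> range atMost" for X using that eq by auto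
    show "emeasure ?N {..real n} \<noteq> \<infinity>" for n unfolding em by simp
  qed (auto simp: borel_eq_atMost)
  then have "(\<integral>\<^sup>+q. g q \<partial>?N) = (\<integral>\<^sup>+q. g q \<partial>?D)" by simp
  then show ?thesis by (simp add: nn_integral_distr nn_integral_density)
qed

lemma nn_integral_shift:
  fixes f :: "real \<Rightarrow> ennreal"
  assumes "f \<in> borel_measurable borel"
  shows "(\<integral>\<^sup>+q. f q \<partial>lborel) = (\<integral>\<^sup>+s. f (s - p) \<partial>lborel)"
  using nn_integral_real_affine[OF assms, of 1 "- p"] by simp

text \<open>The substitution \<open>p = s * t\<close> leaves a Beta integral, whose value replaces
  the two Gamma factors by \<open>Gamma (a + b)\<close>.\<close>

lemma radial_density_convolution:
  assumes a: "a > 0" and b: "b > 0" 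
  shows "(\<integral>\<^sup>+p. ennreal (radial_density a p) * ennreal (radial_density b (s - p)) \<partial>lborel)
    = ennreal (radial_density (a + b) s)"
proof (cases "s > 0")
  case True
  let ?c = "pi powr (a + b) / (Gamma a * Gamma b)"
  have G: "Gamma a > 0" "Gamma b > 0" "Gamma (a + b) > 0" using a b by (auto intro: Gamma_real_pos)
  have "(\<integral>\<^sup>+p. ennreal (radial_density a p) * ennreal (radial_density b (s - p)) \<partial>lborel)
    = ennreal s * (\<integral>\<^sup>+t. ennreal (radial_density a (s * t)) * ennreal (radial_density b (s - s * t)) \<partial>lborel)"
    using nn_integral_real_affine[of "\<lambda>p. ennreal (radial_density a p) * ennreal (radial_density b (s - p))" s 0] True
    by simp
  also have "(\<integral>\<^sup>+t. ennreal (radial_density a (s * t)) * ennreal (radial_density b (s - s * t)) \<partial>lborel)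
    = (\<integral>\<^sup>+t. ennreal (?c * s powr (a + b - 2)) * (ennreal (t powr (a - 1) * (1 - t) powr (b - 1)) * indicator {0..1} t) \<partial>lborel)"
  proof (rule nn_integral_cong_AE)
    \<comment> \<open>At the endpoints the closed indicator is 1, so they are set aside as a null
      set.\<close>
    have "AE t in lborel. t \<noteq> (0::real)" "AE t in lborel. t \<noteq> (1::real)" by (auto intro: AE_lborel_singleton)
    then show "AE t in lborel. ennreal (radial_density a (s * t)) * ennreal (radial_density b (s - s * t))
      = ennreal (?c * s powr (a + b - 2)) * (ennreal (t powr (a - 1) * (1 - t) powr (b - 1)) * indicator {0..1} t)"
    proof eventually_elim
      case (elim t)
      have e: "s - s * t = s * (1 - t)" by (simp add: algebra_simps)
      show ?case
      proof (cases "0 < t \<and> t < 1")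
        case t: True
        have "radial_density a (s * t) * radial_density b (s - s * t)
          = ?c * s powr (a + b - 2) * (t powr (a - 1) * (1 - t) powr (b - 1))"
        proof -
          have "s powr (a + b - 2) = s powr (a - 1) * s powr (b - 1)" by (simp flip: powr_add)
          then show ?thesis
            unfolding e using t True by (simp add: radial_density_def powr_mult powr_add)
        qed
        then show ?thesis
          using t G a b by (simp add: ennreal_mult'[symmetric] Gamma_real_pos less_imp_le)
      next
        case t: False
        then have "t < 0 \<or> t > 1" using elim by auto
        then have "radial_density a (s * t) = 0 \<or> radial_density b (s - s * t) = 0" "indicator {0..1} t = (0::ennreal)"
          unfolding e using True by (auto simp: radial_density_def zero_less_mult_iff)
        then show ?thesis by auto
      qed
    qed
  qed
  also have "\<dots> = ennreal (?c * s powr (a + b - 2)) * ennreal (Beta a b)"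
    using has_integral_Beta_real[OF a b] by (subst nn_integral_cmult) (auto intro!: arg_cong2[where f="(*)"] nn_integral_has_integral_lebesgue')
  also have "ennreal s * \<dots> = ennreal (s * (?c * s powr (a + b - 2) * Beta a b))"
    using G True by (simp add: ennreal_mult'[symmetric] Beta_def)
  also have "s * (?c * s powr (a + b - 2) * Beta a b) = radial_density (a + b) s"
    using True G by (simp add: radial_density_def Beta_def powr_diff power2_eq_square field_simps)
  finally show ?thesis .
next
  case False
  then have "radial_density a p = 0 \<or> radial_density b (s - p) = 0" for p
    by (auto simp: radial_density_def)
  then have "(\<integral>\<^sup>+p. ennreal (radial_density a p) * ennreal (radial_density b (s - p)) \<partial>lborel) = (\<integral>\<^sup>+p. 0 \<partial>(lborel :: real measure))"
    by (intro nn_integral_cong) (metis ennreal_0 mult_zero_left mult_zero_right)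
  then show ?thesis using False by (simp add: radial_density_def)
qed

text \<open>\<open>J\<close> is a set of indices and not an index type, so the formula for a
  Euclidean space does not apply at once; the squared norms are added one by one by convolution. An
  empty \<open>J\<close> would give a point mass instead of a density.\<close>

lemma nn_integral_sum_norm_square:
  fixes g :: "real \<Rightarrow> ennreal"
  assumes J: "finite J" "J \<noteq> {}" and g: "g \<in> borel_measurable borel"
  shows "(\<integral>\<^sup>+z. g (\<Sum>j\<in>J. (norm (z j :: 'a::euclidean_space))\<^sup>2) \<partial>(\<Pi>\<^sub>M j\<in>J. lborel))
    = (\<integral>\<^sup>+q. ennreal (radial_density (DIM('a) * card J / 2) q) * g q \<partial>lborel)"
  using J g
proof (induction J arbitrary: g rule: finite_ne_induct)
  case (singleton j)
  note [measurable] = singleton.prems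
  show ?case
    using lborel_prod.product_nn_integral_singleton[of "\<lambda>x :: 'a. g ((norm x)\<^sup>2)" j]
    by (simp add: nn_integral_norm_square)
next
  case (insert j J)
  note [measurable] = insert.prems
  let ?a = "DIM('a) * card J / 2" and ?b = "DIM('a) / 2"
  have a: "?a > 0" "?b > 0" using insert.hyps by (auto simp: card_gt_0_iff)
  have "(\<integral>\<^sup>+z. g (\<Sum>i\<in>insert j J. (norm (z i :: 'a))\<^sup>2) \<partial>(\<Pi>\<^sub>M i\<in>insert j J. lborel))
    = (\<integral>\<^sup>+x. (\<integral>\<^sup>+y. g (\<Sum>i\<in>insert j J. (norm ((x(j := y)) i :: 'a))\<^sup>2) \<partial>lborel) \<partial>(\<Pi>\<^sub>M i\<in>J. lborel))"
  proof (rule lborel_prod.product_nn_integral_insert[OF insert.hyps(1,3)])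
    show "(\<lambda>z. g (\<Sum>i\<in>insert j J. (norm (z i :: 'a))\<^sup>2)) \<in> borel_measurable (\<Pi>\<^sub>M i\<in>insert j J. lborel)"
      by (intro measurable_compose[OF _ insert.prems] borel_measurable_sum borel_measurable_power measurable_compose[OF measurable_PiM_lborel_component borel_measurable_norm])
  qed
  also have "\<dots> = (\<integral>\<^sup>+x. (\<integral>\<^sup>+y. g ((\<Sum>i\<in>J. (norm (x i))\<^sup>2) + (norm (y :: 'a))\<^sup>2) \<partial>lborel) \<partial>(\<Pi>\<^sub>M i\<in>J. lborel :: 'a measure))"
  proof (intro nn_integral_cong)
    fix x y
    have "(\<Sum>i\<in>J. (norm ((x(j := y)) i :: 'a))\<^sup>2) = (\<Sum>i\<in>J. (norm (x i))\<^sup>2)"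
      using insert.hyps by (intro sum.cong) auto
    then show "g (\<Sum>i\<in>insert j J. (norm ((x(j := y)) i :: 'a))\<^sup>2) = g ((\<Sum>i\<in>J. (norm (x i))\<^sup>2) + (norm y)\<^sup>2)"
      using insert.hyps by (simp add: add.commute)
  qed
  also have "\<dots> = (\<integral>\<^sup>+x. (\<integral>\<^sup>+q. ennreal (radial_density ?b q) * g ((\<Sum>i\<in>J. (norm (x i))\<^sup>2) + q) \<partial>lborel) \<partial>(\<Pi>\<^sub>M i\<in>J. lborel :: 'a measure))"
    by (intro nn_integral_cong nn_integral_norm_square) measurable
  also have "\<dots> = (\<integral>\<^sup>+p. ennreal (radial_density ?a p) * (\<integral>\<^sup>+q. ennreal (radial_density ?b q) * g (p + q) \<partial>lborel) \<partial>lborel)"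
    by (rule insert.IH) measurable
  also have "\<dots> = (\<integral>\<^sup>+p. ennreal (radial_density ?a p) * (\<integral>\<^sup>+s. ennreal (radial_density ?b (s - p)) * g s \<partial>lborel) \<partial>lborel)"
  proof (rule nn_integral_cong)
    fix p
    have "(\<integral>\<^sup>+q. ennreal (radial_density ?b q) * g (p + q) \<partial>lborel) = (\<integral>\<^sup>+s. ennreal (radial_density ?b (s - p)) * g s \<partial>lborel)"
      by (subst nn_integral_shift[of _ p]) simp_all
    then show "ennreal (radial_density ?a p) * (\<integral>\<^sup>+q. ennreal (radial_density ?b q) * g (p + q) \<partial>lborel)
      = ennreal (radial_density ?a p) * (\<integral>\<^sup>+s. ennreal (radial_density ?b (s - p)) * g s \<partial>lborel)"
      by simp
  qed
  also have "\<dots> = (\<integral>\<^sup>+p. (\<integral>\<^sup>+s. ennreal (radial_density ?a p) * ennreal (radial_density ?b (s - p)) * g s \<partial>lborel) \<partial>lborel)"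
    by (subst nn_integral_cmult[symmetric]) (simp_all add: mult.assoc)
  also have "\<dots> = (\<integral>\<^sup>+s. (\<integral>\<^sup>+p. ennreal (radial_density ?a p) * ennreal (radial_density ?b (s - p)) * g s \<partial>lborel) \<partial>lborel)"
    by (rule lborel_pair.Fubini') measurable
  also have "\<dots> = (\<integral>\<^sup>+s. ennreal (radial_density (?a + ?b) s) * g s \<partial>lborel)"
    using radial_density_convolution[OF a] by (simp add: nn_integral_multc)
  also have "?a + ?b = DIM('a) * card (insert j J) / 2"
    using insert.hyps by (simp add: field_simps)
  finally show ?case .
qed

section \<open>Measurability of matrix functions\<close>

lemma borel_measurable_vec_lambda [measurable (raw)]:
  fixes f :: "'i::finite \<Rightarrow> 'x \<Rightarrow> 'b::euclidean_space"
  assumes "\<And>i. f i \<in> borel_measurable M"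
  shows "(\<lambda>x. \<chi> i. f i x) \<in> borel_measurable M"
  unfolding borel_measurable_euclidean_space[of "\<lambda>x. \<chi> i. f i x"]
  using assms by (auto simp: Basis_vec_def inner_axis)

lemma borel_measurable_vec_component [measurable (raw)]:
  fixes f :: "'x \<Rightarrow> 'b::euclidean_space^'i"
  assumes "f \<in> borel_measurable M" shows "(\<lambda>x. f x $ i) \<in> borel_measurable M"
  by (rule measurable_compose[OF assms borel_measurable_linear]) (rule bounded_linear.linear[OF bounded_linear_vec_nth])

lemma borel_measurable_conjugate [measurable (raw)]:
  "f \<in> borel_measurable M \<Longrightarrow> (\<lambda>x. conjugate (f x :: 'a::conj_div_algebra)) \<in> borel_measurable M"
  by (rule measurable_compose[OF _ measurable_conjugate])

lemma borel_measurable_matrix_mult [measurable (raw)]: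
  fixes A :: "'a::conj_div_algebra^'n^'m"
  assumes "f \<in> borel_measurable M" shows "(\<lambda>x. A *v f x) \<in> borel_measurable M"
  by (rule measurable_compose[OF assms borel_measurable_linear[OF linear_matrix_mult]])

lemma borel_measurable_cinner [measurable (raw)]:
  fixes f g :: "'x \<Rightarrow> 'a::conj_div_algebra^'n"
  assumes [measurable]: "f \<in> borel_measurable M" "g \<in> borel_measurable M"
  shows "(\<lambda>x. cinner (f x) (g x)) \<in> borel_measurable M"
  unfolding cinner_def by measurable

text \<open>Points of a product space over \<open>S\<close> are \<open>undefined\<close> outside
  \<open>S\<close>; zeros there turn them into vectors on which matrices can act.\<close>

definition vec_on :: "'n set \<Rightarrow> ('n \<Rightarrow> 'a::zero) \<Rightarrow> 'a^'n" where
  "vec_on S y = (\<chi> i. if i \<in> S then y i else 0)"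

lemma borel_measurable_vec_on [measurable]:
  "vec_on S \<in> borel_measurable (\<Pi>\<^sub>M i\<in>S. lborel :: 'b::euclidean_space measure)"
proof -
  have "(\<lambda>y. if i \<in> S then y i else 0) \<in> borel_measurable (\<Pi>\<^sub>M i\<in>S. lborel :: 'b measure)" for i
    by (cases "i \<in> S") (simp_all add: measurable_PiM_lborel_component)
  then show ?thesis unfolding vec_on_def[abs_def] by measurable
qed

section \<open>Coordinates with respect to an orthonormal system\<close>

text \<open>Choose distinct coordinates \<open>r i\<close> and rotate so that the axis
  \<open>r i\<close> goes to the direction \<open>u i\<close>. Products with \<open>u i\<close>
  become coordinates, and the other coordinates enter through their squared norm only. The rotation
  is completed merely as a real isometry, which suffices since only its effect on these directions,
  on norms and on volume matters.\<close>

lemma nn_integral_unitary_coordinates: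
  fixes u :: "'n::finite \<Rightarrow> 'a::conj_div_algebra^'m" and h :: "('a^'n) \<times> real \<Rightarrow> ennreal"
  assumes u: "\<And>i j. i \<in> S \<Longrightarrow> j \<in> S \<Longrightarrow> cinner (u i) (u j) = (if i = j then 1 else 0)"
    and S: "card S < CARD('m)" and h [measurable]: "h \<in> borel_measurable (borel \<Otimes>\<^sub>M borel)"
  shows "(\<integral>\<^sup>+x. h (vec_on S (\<lambda>i. cinner (u i) x), (norm x)\<^sup>2) \<partial>lborel) =
    (\<integral>\<^sup>+y. (\<integral>\<^sup>+q. ennreal (radial_density (DIM('a) * (CARD('m) - card S) / 2) q)
        * h (vec_on S y, (norm (vec_on S y))\<^sup>2 + q) \<partial>lborel) \<partial>(\<Pi>\<^sub>M i\<in>S. lborel))"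
proof -
  obtain r :: "'n \<Rightarrow> 'm" where r: "inj_on r S"
    using card_le_inj[of S "UNIV :: 'm set"] S by auto
  let ?A = "(\<lambda>(i, c). axis (r i) c) ` (S \<times> Basis) :: ('a^'m) set"
  define s where "s b = (\<Sum>i\<in>S. rscale (u i) (b $ r i))" for b
  have s_axis: "s (axis (r i) c) = rscale (u i) c" if "i \<in> S" for i c
  proof -
    have "s (axis (r i) c) = (\<Sum>j\<in>S. if j = i then rscale (u i) c else 0)"
      unfolding s_def
    proof (rule sum.cong[OF refl])
      fix j assume "j \<in> S"
      then show "rscale (u j) (axis (r i) c $ r j) = (if j = i then rscale (u i) c else 0)"
        using r that by (auto simp: axis_nth_if inj_on_def rscale_def vec_eq_iff)
    qed
    then show ?thesis using that by simp
  qed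
  have AB: "?A \<subseteq> Basis" by (auto simp: Basis_vec_def)
  have orth: "s b \<bullet> s c = (if b = c then 1 else 0)" if "b \<in> ?A" "c \<in> ?A" for b c
  proof -
    from that obtain i j v w where bc: "b = axis (r i) v" "c = axis (r j) w" "i \<in> S" "j \<in> S" "v \<in> Basis" "w \<in> Basis"
      by auto
    have "s b \<bullet> s c = (conjugate v * (cinner (u i) (u j) * w)) \<bullet> 1"
      by (simp add: bc s_axis inner_eq_cinner cinner_rscale_left cinner_rscale_right mult.assoc)
    also have "\<dots> = (if i = j then v \<bullet> w else 0)"
      using inner_mult_left_adjoint[of "conjugate v" w 1] bc u by (simp add: conjugate_conjugate inner_commute)
    also have "\<dots> = (if b = c then 1 else 0)"
      using bc r by (auto simp: inner_Basis axis_eq_axis inj_on_def nonzero_Basis)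
    finally show ?thesis .
  qed
  obtain s' where s': "\<And>b. b \<in> ?A \<Longrightarrow> s' b = s b"
    "\<And>b c. b \<in> Basis \<Longrightarrow> c \<in> Basis \<Longrightarrow> s' b \<bullet> s' c = (if b = c then 1 else 0)"
    using extend_orthonormal[OF AB orth] by metis
  define U where "U x = (\<Sum>b\<in>Basis. (x \<bullet> b) *\<^sub>R s' b)" for x
  note fr = orthonormal_frame[of s', OF s'(2), folded U_def]
  have U: "linear U" "\<bar>edet U\<bar> = 1" "\<And>x y. U x \<bullet> U y = x \<bullet> y" "\<And>b. b \<in> Basis \<Longrightarrow> U b = s' b"
    using fr(1,3,7,8) by (auto simp: U_def[abs_def])
  have Un: "norm (U x) = norm x" for x by (simp add: norm_eq_sqrt_inner U(3))
  have Uc: "cinner (u i) (U x) = x $ r i" if i: "i \<in> S" for i x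
  proof (rule euclidean_eqI)
    fix c :: 'a assume c: "c \<in> Basis"
    have "axis (r i) c \<in> ?A" using i c by (intro image_eqI[of _ _ "(i, c)"]) auto
    then have "U (axis (r i) c) = s' (axis (r i) c)" "s' (axis (r i) c) = s (axis (r i) c)"
      using AB by (blast intro: U(4) s'(1))+
    then have "U (axis (r i) c) = rscale (u i) c" by (simp only: s_axis[OF i])
    then have "x $ r i \<bullet> c = U x \<bullet> rscale (u i) c"
      using U(3)[of x "axis (r i) c"] by (simp add: inner_axis)
    also have "\<dots> = (conjugate c * cinner (u i) (U x)) \<bullet> 1"
      by (subst inner_commute) (simp add: inner_eq_cinner cinner_rscale_left)
    also have "\<dots> = cinner (u i) (U x) \<bullet> c"
      using inner_mult_left_adjoint[of "conjugate c" "cinner (u i) (U x)" 1] by (simp add: conjugate_conjugate)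
    finally show "cinner (u i) (U x) \<bullet> c = x $ r i \<bullet> c" by simp
  qed
  \<comment> \<open>The coordinates orthogonal to the system; they have total real dimension
    \<open>DIM('a) * (CARD('m) - card S)\<close>, which is positive.\<close>
  define J where "J = UNIV - r ` S"
  have J: "finite J" "J \<noteq> {}" "card J = CARD('m) - card S" "r ` S \<inter> J = {}" "r ` S \<union> J = UNIV"
  proof -
    show c: "card J = CARD('m) - card S" using r by (simp add: J_def card_Diff_subset card_image)
    then show "J \<noteq> {}" using S by auto
  qed (auto simp: J_def)
  let ?a = "DIM('a) * (CARD('m) - card S) / 2"
  have m1: "(\<lambda>x. vec_on S (\<lambda>i. cinner (u i) x)) \<in> borel_measurable borel"
    and m2: "(\<lambda>x :: 'a^'m. vec_on S (\<lambda>i. x $ r i)) \<in> borel_measurable borel"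
    unfolding vec_on_def by measurable
  note [measurable] = m1 m2
  have "(\<integral>\<^sup>+x. h (vec_on S (\<lambda>i. cinner (u i) x), (norm x)\<^sup>2) \<partial>lborel)
    = (\<integral>\<^sup>+x. h (vec_on S (\<lambda>i. cinner (u i) (U x)), (norm (U x))\<^sup>2) \<partial>lborel)"
    using U(2) by (subst nn_integral_lborel_linear[OF U(1)]) (auto, measurable)
  also have "\<dots> = (\<integral>\<^sup>+x. h (vec_on S (\<lambda>i. x $ r i), (norm x)\<^sup>2) \<partial>lborel)"
    by (simp add: Un Uc vec_on_def cong: if_cong)
  also have "\<dots> = (\<integral>\<^sup>+f. h (vec_on S (\<lambda>i. f (r i)), \<Sum>j\<in>UNIV. (norm (f j))\<^sup>2) \<partial>(\<Pi>\<^sub>M j\<in>UNIV. lborel))"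
    by (subst nn_integral_lborel_vec) (measurable, simp add: norm_vec_def L2_set_def sum_nonneg)
  also have "\<dots> = (\<integral>\<^sup>+f. h (vec_on S (\<lambda>i. f (r i)), \<Sum>j\<in>UNIV. (norm (f j))\<^sup>2) \<partial>(\<Pi>\<^sub>M j\<in>r ` S \<union> J. lborel))"
    by (simp add: J)
  also have "\<dots> = (\<integral>\<^sup>+x. (\<integral>\<^sup>+z. h (vec_on S (\<lambda>i. merge (r ` S) J (x, z) (r i)),
      \<Sum>j\<in>UNIV. (norm (merge (r ` S) J (x, z) j))\<^sup>2) \<partial>(\<Pi>\<^sub>M j\<in>J. lborel)) \<partial>(\<Pi>\<^sub>M j\<in>r ` S. lborel))"
  proof (rule lborel_prod.product_nn_integral_fold[OF J(4)])
    have [measurable]: "(\<lambda>f. f j) \<in> borel_measurable (\<Pi>\<^sub>M j\<in>r ` S \<union> J. lborel :: 'a measure)" for j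
      by (rule measurable_PiM_lborel_component) (simp add: J)
    show "(\<lambda>f. h (vec_on S (\<lambda>i. f (r i)), \<Sum>j\<in>UNIV. (norm (f j))\<^sup>2)) \<in> borel_measurable (\<Pi>\<^sub>M j\<in>r ` S \<union> J. lborel)"
      unfolding vec_on_def by measurable
  qed (use J in auto)
  also have "\<dots> = (\<integral>\<^sup>+x. (\<integral>\<^sup>+z. h (vec_on S (\<lambda>i\<in>S. x (r i)),
      (norm (vec_on S (\<lambda>i\<in>S. x (r i))))\<^sup>2 + (\<Sum>j\<in>J. (norm (z j :: 'a))\<^sup>2)) \<partial>(\<Pi>\<^sub>M j\<in>J. lborel)) \<partial>(\<Pi>\<^sub>M j\<in>r ` S. lborel))"
  proof (intro nn_integral_cong)
    fix x z :: "'m \<Rightarrow> 'a"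
    have v: "vec_on S (\<lambda>i. merge (r ` S) J (x, z) (r i)) = vec_on S (\<lambda>i\<in>S. x (r i))"
      using J(4) by (auto simp: vec_on_def vec_eq_iff merge_def)
    have n: "(norm (vec_on S (\<lambda>i\<in>S. x (r i))))\<^sup>2 = (\<Sum>j\<in>r ` S. (norm (x j))\<^sup>2)"
    proof -
      have "(norm (vec_on S (\<lambda>i\<in>S. x (r i))))\<^sup>2 = (\<Sum>i\<in>UNIV. if i \<in> S then (norm (x (r i)))\<^sup>2 else 0)"
        by (auto simp: norm_vec_def L2_set_def sum_nonneg vec_on_def intro!: sum.cong)
      also have "\<dots> = (\<Sum>i\<in>S. (norm (x (r i)))\<^sup>2)" by (simp add: sum.If_cases)
      finally show ?thesis using r by (simp add: sum.reindex)
    qed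
    have "(\<Sum>j\<in>UNIV. (norm (merge (r ` S) J (x, z) j))\<^sup>2)
      = (\<Sum>j\<in>r ` S. (norm (merge (r ` S) J (x, z) j))\<^sup>2) + (\<Sum>j\<in>J. (norm (merge (r ` S) J (x, z) j))\<^sup>2)"
      unfolding J(5)[symmetric] using J by (intro sum.union_disjoint) auto
    also have "\<dots> = (\<Sum>j\<in>r ` S. (norm (x j))\<^sup>2) + (\<Sum>j\<in>J. (norm (z j))\<^sup>2)"
      using J(4) by (intro arg_cong2[where f="(+)"] sum.cong) (auto simp: merge_def)
    finally show "h (vec_on S (\<lambda>i. merge (r ` S) J (x, z) (r i)), \<Sum>j\<in>UNIV. (norm (merge (r ` S) J (x, z) j))\<^sup>2)
      = h (vec_on S (\<lambda>i\<in>S. x (r i)), (norm (vec_on S (\<lambda>i\<in>S. x (r i))))\<^sup>2 + (\<Sum>j\<in>J. (norm (z j))\<^sup>2))"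
      unfolding v n by simp
  qed
  also have "\<dots> = (\<integral>\<^sup>+x. (\<integral>\<^sup>+q. ennreal (radial_density ?a q) * h (vec_on S (\<lambda>i\<in>S. x (r i)),
      (norm (vec_on S (\<lambda>i\<in>S. x (r i))))\<^sup>2 + q) \<partial>lborel) \<partial>(\<Pi>\<^sub>M j\<in>r ` S. lborel))"
    unfolding J(3)[symmetric]
    by (intro nn_integral_cong nn_integral_sum_norm_square J) measurable
  also have "\<dots> = (\<integral>\<^sup>+y. (\<integral>\<^sup>+q. ennreal (radial_density ?a q)
        * h (vec_on S y, (norm (vec_on S y))\<^sup>2 + q) \<partial>lborel) \<partial>(\<Pi>\<^sub>M i\<in>S. lborel))"
    by (rule nn_integral_PiM_reindex[OF _ r]) (simp, measurable)
  finally show ?thesis .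
qed

section \<open>Linear substitutions in some of the coordinates\<close>

lemma vec_nth_vec_lambda: "($) (vec_lambda f) = f"
  by (simp add: fun_eq_iff)

text \<open>The change of variables is available for full vectors only. The coordinates outside
  \<open>S\<close> are therefore restored and confined to boxes of volume 1.\<close>

lemma nn_integral_PiM_cut:
  fixes F :: "'a::conj_div_algebra^'n \<Rightarrow> ennreal"
  assumes [measurable]: "F \<in> borel_measurable borel"
  shows "(\<integral>\<^sup>+y. F (vec_on S y) \<partial>(\<Pi>\<^sub>M i\<in>S. lborel)) =
    (\<integral>\<^sup>+v. F (vec_on S (\<lambda>i. v $ i)) * (\<Prod>i\<in>-S. indicator (box 0 One) (v $ i)) \<partial>lborel)"
proof -
  have [measurable]: "(\<lambda>v :: 'a^'n. vec_on S (\<lambda>i. v $ i)) \<in> borel_measurable borel"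
    unfolding vec_on_def by measurable
  have [measurable]: "(\<lambda>f. f i) \<in> borel_measurable (\<Pi>\<^sub>M i\<in>S \<union> -S. lborel :: 'a measure)" for i
    by (rule measurable_PiM_lborel_component) auto
  have [measurable]: "(\<lambda>f. vec_on S f) \<in> borel_measurable (\<Pi>\<^sub>M i\<in>S \<union> -S. lborel :: 'a measure)"
    unfolding vec_on_def by measurable
  have "(\<integral>\<^sup>+v. F (vec_on S (\<lambda>i. v $ i)) * (\<Prod>i\<in>-S. indicator (box 0 One) (v $ i)) \<partial>lborel)
    = (\<integral>\<^sup>+f. F (vec_on S f) * (\<Prod>i\<in>-S. indicator (box 0 One) (f i)) \<partial>(\<Pi>\<^sub>M i\<in>UNIV. lborel))"
    by (subst nn_integral_lborel_vec) (measurable, simp add: vec_nth_vec_lambda)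
  also have "\<dots> = (\<integral>\<^sup>+f. F (vec_on S f) * (\<Prod>i\<in>-S. indicator (box 0 One) (f i)) \<partial>(\<Pi>\<^sub>M i\<in>S \<union> -S. lborel))"
    by (simp add: Compl_partition)
  also have "\<dots> = (\<integral>\<^sup>+y. (\<integral>\<^sup>+z. F (vec_on S (merge S (-S) (y, z)))
      * (\<Prod>i\<in>-S. indicator (box 0 One) (merge S (-S) (y, z) i)) \<partial>(\<Pi>\<^sub>M i\<in>-S. lborel)) \<partial>(\<Pi>\<^sub>M i\<in>S. lborel))"
  proof (rule lborel_prod.product_nn_integral_fold)
    show "(\<lambda>f. F (vec_on S f) * (\<Prod>i\<in>-S. indicator (box 0 One) (f i)))
      \<in> borel_measurable (\<Pi>\<^sub>M i\<in>S \<union> -S. lborel)" by measurable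
  qed auto
  also have "\<dots> = (\<integral>\<^sup>+y. (\<integral>\<^sup>+z. F (vec_on S y)
      * (\<Prod>i\<in>-S. indicator (box 0 One) (z i :: 'a)) \<partial>(\<Pi>\<^sub>M i\<in>-S. lborel)) \<partial>(\<Pi>\<^sub>M i\<in>S. lborel))"
  proof -
    have v: "vec_on S (merge S (-S) (y, z)) = vec_on S y" for y z :: "'n \<Rightarrow> 'a"
      by (auto simp: vec_on_def vec_eq_iff merge_def)
    have p: "(\<Prod>i\<in>-S. indicator (box 0 One) (merge S (-S) (y, z) i)) = (\<Prod>i\<in>-S. indicator (box 0 One) (z i) :: ennreal)" for y z :: "'n \<Rightarrow> 'a"
      by (intro prod.cong) (auto simp: merge_def)
    show ?thesis unfolding v p ..
  qed
  also have "\<dots> = (\<integral>\<^sup>+y. F (vec_on S y) \<partial>(\<Pi>\<^sub>M i\<in>S. lborel))"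
  proof -
    have "(\<integral>\<^sup>+z. (\<Prod>i\<in>-S. indicator (box 0 One) (z i :: 'a)) \<partial>(\<Pi>\<^sub>M i\<in>-S. lborel)) = (1 :: ennreal)"
      by (subst lborel_prod.product_nn_integral_prod) (simp_all add: emeasure_lborel_box_eq)
    moreover have "(\<lambda>z. \<Prod>i\<in>-S. indicator (box 0 One) (z i :: 'a) :: ennreal) \<in> borel_measurable (\<Pi>\<^sub>M i\<in>-S. lborel)"
      by (intro borel_measurable_prod_ennreal measurable_compose[OF measurable_PiM_lborel_component borel_measurable_indicator]) auto
    ultimately show ?thesis by (simp add: nn_integral_cmult)
  qed
  finally show ?thesis ..
qed

text \<open>A matrix that is the identity outside \<open>S\<close> keeps the remaining coordinates,
  hence also the boxes to which they are confined.\<close>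

lemma nn_integral_PiM_linear:
  fixes F :: "'a::conj_div_algebra^'n \<Rightarrow> ennreal"
  assumes [measurable]: "F \<in> borel_measurable borel" and A: "id_outside S A" and nz: "edet ((*v) A) \<noteq> 0"
  shows "(\<integral>\<^sup>+y. F (vec_on S y) \<partial>(\<Pi>\<^sub>M i\<in>S. lborel)) =
    ennreal \<bar>edet ((*v) A)\<bar> * (\<integral>\<^sup>+y. F (A *v vec_on S y) \<partial>(\<Pi>\<^sub>M i\<in>S. lborel))"
proof -
  have [measurable]: "(\<lambda>v :: 'a^'n. vec_on S (\<lambda>i. v $ i)) \<in> borel_measurable borel"
    unfolding vec_on_def by measurable
  have Aij: "A $ i $ j = (if i = j then 1 else 0)" if "i \<notin> S \<or> j \<notin> S" for i j
    using A that by (auto simp: id_outside_def)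
  have cut: "vec_on S (\<lambda>i. (A *v v) $ i) = A *v vec_on S (\<lambda>i. v $ i)" for v
  proof (unfold vec_eq_iff, rule allI)
    fix i
    show "vec_on S (\<lambda>i. (A *v v) $ i) $ i = (A *v vec_on S (\<lambda>i. v $ i)) $ i"
    proof (cases "i \<in> S")
      case True
      then show ?thesis
        by (auto simp: vec_on_def matrix_vector_mult_def Aij intro!: sum.cong)
    next
      case False
      then show ?thesis using id_outside_mult_nth[OF A False] by (simp add: vec_on_def)
    qed
  qed
  have ind: "(\<Prod>i\<in>-S. indicator (box 0 One) ((A *v v) $ i)) = (\<Prod>i\<in>-S. indicator (box 0 One) (v $ i) :: ennreal)" for v
    by (intro prod.cong refl) (simp add: id_outside_mult_nth[OF A])
  have "(\<integral>\<^sup>+v. F (vec_on S (\<lambda>i. v $ i)) * (\<Prod>i\<in>-S. indicator (box 0 One) (v $ i)) \<partial>lborel)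
    = ennreal \<bar>edet ((*v) A)\<bar> * (\<integral>\<^sup>+v. F (A *v vec_on S (\<lambda>i. v $ i)) * (\<Prod>i\<in>-S. indicator (box 0 One) (v $ i)) \<partial>lborel)"
    by (subst nn_integral_lborel_linear[OF linear_matrix_mult nz])
      (measurable, simp add: cut ind)
  then show ?thesis
    using nn_integral_PiM_cut[of F S] nn_integral_PiM_cut[of "\<lambda>v. F (A *v v)" S] by simp
qed

section \<open>Measurability of the determinant and of the cone\<close>

lemma borel_measurable_matrix_apply [measurable (raw)]:
  fixes f :: "'x \<Rightarrow> 'a::conj_div_algebra^'n^'m"
  assumes "f \<in> borel_measurable M" shows "(\<lambda>x. f x *v c) \<in> borel_measurable M"
proof -
  have "linear (\<lambda>A :: 'a^'n^'m. A *v c)"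
    by (rule linearI) (simp_all add: matrix_vector_mult_def vec_eq_iff algebra_simps sum.distrib scaleR_sum_right)
  then show ?thesis by (rule measurable_compose[OF assms borel_measurable_linear])
qed

text \<open>As a determinant this is a polynomial in real components of the matrix, whereas
  measurability is not evident from a product of eigenvalues.\<close>

lemma borel_measurable_edet [measurable (raw)]:
  fixes f :: "'x \<Rightarrow> 'a::conj_div_algebra^'n^'n"
  assumes [measurable]: "f \<in> borel_measurable M" shows "(\<lambda>x. edet ((*v) (f x))) \<in> borel_measurable M"
  unfolding edet_def det_def by measurable

lemma continuous_on_matrix_apply: "continuous_on S (\<lambda>A :: 'a::conj_div_algebra^'n^'m. A *v c)"
proof -
  have "linear (\<lambda>A :: 'a^'n^'m. A *v c)"
    by (rule linearI) (simp_all add: matrix_vector_mult_def vec_eq_iff algebra_simps sum.distrib scaleR_sum_right)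
  then show ?thesis by (simp add: linear_continuous_on linear_conv_bounded_linear)
qed

text \<open>On the compact unit sphere a positive form is bounded below by some 1/(n+1). The cone is
  thus a countable union of closed conditions within the closed set of Hermitian matrices.\<close>

lemma pos_def_cone_borel [measurable]: "(pos_def_cone :: ('a::conj_div_algebra^'n^'n) set) \<in> sets borel"
proof -
  let ?H = "{A :: 'a^'n^'n. conj_transpose A = A}"
  let ?C = "\<lambda>n::nat. \<Inter>x. {A :: 'a^'n^'n. x \<bullet> x / Suc n \<le> x \<bullet> (A *v x)}"
  have "linear (conj_transpose :: 'a^'n^'n \<Rightarrow> _)"
    by (rule linearI) (simp_all add: conj_transpose_def vec_eq_iff conjugate_add conjugate_scaleR)
  then have "continuous_on UNIV (conj_transpose :: 'a^'n^'n \<Rightarrow> _)"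
    by (simp add: linear_continuous_on linear_conv_bounded_linear)
  then have H: "closed ?H" by (intro closed_Collect_eq continuous_on_id)
  have C: "closed (?C n)" for n
    by (intro closed_INT ballI closed_Collect_le continuous_intros continuous_on_matrix_apply)
  have "pos_def_cone = ?H \<inter> (\<Union>n. ?C n)"
  proof (intro set_eqI iffI)
    fix A :: "'a^'n^'n" assume A: "A \<in> pos_def_cone"
    have "continuous_on (sphere 0 1) (\<lambda>x. x \<bullet> (A *v x))"
      using linear_matrix_mult[of A]
      by (intro continuous_intros linear_continuous_on) (simp add: linear_conv_bounded_linear)
    moreover obtain b :: "'a^'n" where "b \<in> Basis" using nonempty_Basis by blast
    then have "b \<in> sphere 0 1" by simp
    then have "sphere 0 1 \<noteq> ({} :: ('a^'n) set)" by blast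
    ultimately obtain y :: "'a^'n" where y: "norm y = 1" "\<And>x. norm x = 1 \<Longrightarrow> y \<bullet> (A *v y) \<le> x \<bullet> (A *v x)"
      using continuous_attains_inf[OF compact_sphere[of "0 :: 'a^'n" 1], of "\<lambda>x. x \<bullet> (A *v x)"] by auto
    have "y \<noteq> 0" using y(1) by auto
    then have "y \<bullet> (A *v y) > 0" by (rule pos_def_coneD(2)[OF A])
    then obtain n where n: "inverse (real (Suc n)) < y \<bullet> (A *v y)" using reals_Archimedean by blast
    have "x \<bullet> x / Suc n \<le> x \<bullet> (A *v x)" for x
    proof (cases "x = 0")
      case False
      have "y \<bullet> (A *v y) \<le> ((1 / norm x) *\<^sub>R x) \<bullet> (A *v ((1 / norm x) *\<^sub>R x))"
        using False by (intro y(2)) simp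
      then have "inverse (real (Suc n)) \<le> (x \<bullet> (A *v x)) / (x \<bullet> x)"
        using n by (simp add: linear_scale[OF linear_matrix_mult] power2_norm_eq_inner[symmetric] power2_eq_square)
      moreover have "x \<bullet> x > 0" using False by simp
      ultimately have "inverse (real (Suc n)) * (x \<bullet> x) \<le> x \<bullet> (A *v x)" by (simp only: pos_le_divide_eq)
      then show ?thesis by (simp only: divide_inverse mult.commute)
    qed simp
    then show "A \<in> ?H \<inter> (\<Union>n. ?C n)" using pos_def_coneD(1)[OF A] by blast
  next
    fix A :: "'a^'n^'n" assume A: "A \<in> ?H \<inter> (\<Union>n. ?C n)"
    then obtain n where n: "\<And>x. x \<bullet> x / real (Suc n) \<le> x \<bullet> (A *v x)" by blast
    have "x \<bullet> (A *v x) > 0" if "x \<noteq> 0" for x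
      by (rule less_le_trans[OF _ n]) (use that in simp)
    then show "A \<in> pos_def_cone" using A by (simp add: pos_def_cone_iff)
  qed
  moreover have "?H \<inter> (\<Union>n. ?C n) \<in> sets borel"
    using H C by (intro sets.Int sets.countable_UN') (auto intro: borel_closed)
  ultimately show ?thesis by simp
qed

lemma borel_measurable_border [measurable (raw)]:
  fixes P :: "'x \<Rightarrow> 'a::conj_div_algebra^'n^'n"
  assumes [measurable]: "P \<in> borel_measurable M" "b \<in> borel_measurable M" "s \<in> borel_measurable M"
  shows "(\<lambda>x. border (P x) k (b x) (s x)) \<in> borel_measurable M"
proof -
  have [measurable]: "(of_real :: real \<Rightarrow> 'a) \<in> borel_measurable borel"
    by (rule borel_measurable_continuous_onI) (rule continuous_on_of_real_id)
  show ?thesis unfolding border_def by measurable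
qed

section \<open>Gram matrices\<close>

definition gram_on :: "'n set \<Rightarrow> ('n \<Rightarrow> 'a::conj_div_algebra^'m) \<Rightarrow> 'a^'n^'n" where
  "gram_on S t = (\<chi> i j. if i \<in> S \<and> j \<in> S then cinner (t i) (t j) else if i = j then 1 else 0)"

lemma id_outside_gram_on: "id_outside S (gram_on S t)"
  by (auto simp: id_outside_def gram_on_def)

lemma conj_transpose_gram_on: "conj_transpose (gram_on S t) = gram_on S t"
  by (auto simp: conj_transpose_def gram_on_def vec_eq_iff conjugate_cinner)

lemma borel_measurable_gram_on [measurable]:
  "gram_on S \<in> borel_measurable (\<Pi>\<^sub>M i\<in>S. lborel :: ('a::conj_div_algebra^'m) measure)"
proof -
  have "(\<lambda>t. if i \<in> S \<and> j \<in> S then cinner (t i) (t j) else if i = j then 1 else 0)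
    \<in> borel_measurable (\<Pi>\<^sub>M i\<in>S. lborel :: ('a^'m) measure)" for i j
    by (cases "i \<in> S"; cases "j \<in> S"; cases "i = j")
      (simp_all add: borel_measurable_cinner measurable_PiM_lborel_component)
  then show ?thesis unfolding gram_on_def[abs_def] by measurable
qed

lemma gram_on_insert:
  assumes "k \<notin> S"
  shows "gram_on (insert k S) (t(k := x)) = border (gram_on S t) k (vec_on S (\<lambda>i. cinner (t i) x)) ((norm x)\<^sup>2)"
  using assms by (auto simp: gram_on_def border_def vec_on_def vec_eq_iff cinner_self conjugate_cinner)

text \<open>
  Density of the new entries when a column is appended to a matrix with Gram matrix \<open>P\<close>, as a
  function of the enlarged Gram matrix \<open>F\<close>; \<open>edet F / edet P\<close> is a power of the squared distance of
  the new column from the span of the old ones.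
\<close>
definition gram_step_density :: "real \<Rightarrow> 'a::conj_div_algebra^'n^'n \<Rightarrow> 'a^'n^'n \<Rightarrow> real" where
  "gram_step_density a P F = (if F \<in> pos_def_cone then pi powr a / Gamma a *
    (edet ((*v) F) / edet ((*v) P)) powr ((a - 1) / DIM('a)) * edet ((*v) P) powr (- 1 / 2) else 0)"

lemma borel_measurable_gram_step_density [measurable (raw)]:
  fixes P F :: "'x \<Rightarrow> 'a::conj_div_algebra^'n^'n"
  assumes [measurable]: "P \<in> borel_measurable M" "F \<in> borel_measurable M"
  shows "(\<lambda>x. gram_step_density a (P x) (F x)) \<in> borel_measurable M"
  unfolding gram_step_density_def by measurable

lemma nn_integral_gram_step:
  fixes t :: "'n::finite \<Rightarrow> 'a::conj_div_algebra^'m" and h :: "('a^'n) \<times> real \<Rightarrow> ennreal"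
  assumes pd: "gram_on S t \<in> pos_def_cone" and k: "k \<notin> S" and S: "card S < CARD('m)"
    and h [measurable]: "h \<in> borel_measurable (borel \<Otimes>\<^sub>M borel)"
  shows "(\<integral>\<^sup>+x. h (vec_on S (\<lambda>i. cinner (t i) x), (norm x)\<^sup>2) \<partial>lborel) =
    (\<integral>\<^sup>+b. (\<integral>\<^sup>+s. ennreal (gram_step_density (DIM('a) * (CARD('m) - card S) / 2) (gram_on S t)
        (border (gram_on S t) k (vec_on S b) s)) * h (vec_on S b, s) \<partial>lborel) \<partial>(\<Pi>\<^sub>M i\<in>S. lborel))"
proof -
  define P where "P = gram_on S t"
  define a where "a = DIM('a) * (CARD('m) - card S) / 2"
  have P: "id_outside S P" "conj_transpose P = P" "P \<in> pos_def_cone"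
    using pd by (simp_all add: P_def id_outside_gram_on conj_transpose_gram_on)
  obtain G where G: "id_outside S G" "conj_transpose G ** P ** G = mat 1"
    using pos_def_factor[OF _ P(1,3)] by auto
  define R where "R = conj_transpose G"
  note inv = inverse_of_factor[OF G(2) P(2), folded R_def]
  have R: "id_outside S R" unfolding R_def by (rule id_outside_conj_transpose[OF G(1)])
  have eP: "edet ((*v) P) > 0" by (rule herm_det_eq_edet(2)[OF P(3)])
  have eR: "edet ((*v) R) \<noteq> 0" using inv(3) by auto
  have eR': "\<bar>edet ((*v) R)\<bar> = edet ((*v) P) powr (- 1 / 2)"
  proof -
    have "(edet ((*v) R))\<^sup>2 = 1 / edet ((*v) P)" using inv(3) eP by (simp add: field_simps)
    then have "\<bar>edet ((*v) R)\<bar> = sqrt (1 / edet ((*v) P))" by (metis real_sqrt_abs)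
    also have "\<dots> = edet ((*v) P) powr (- 1 / 2)"
      using eP by (simp add: powr_half_sqrt powr_minus_divide real_sqrt_divide)
    finally show ?thesis .
  qed
  \<comment> \<open>The columns multiplied on the right by \<open>G\<close>; their Gram matrix is
    \<open>conj_transpose G ** P ** G\<close>, the identity.\<close>
  define u where "u i = (\<Sum>j\<in>S. rscale (t j) (G $ j $ i))" for i
  have G0: "G $ j $ i = 0" if "i \<in> S" "j \<notin> S" for i j using G(1) that by (auto simp: id_outside_def)
  have cu: "cinner (u i) x = (\<Sum>j\<in>S. conjugate (G $ j $ i) * cinner (t j) x)" for i x
    by (simp add: u_def cinner_sum_left cinner_rscale_left)
  have Rb: "vec_on S (\<lambda>i. cinner (u i) x) = R *v vec_on S (\<lambda>i. cinner (t i) x)" for x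
  proof (unfold vec_eq_iff, rule allI)
    fix i
    show "vec_on S (\<lambda>i. cinner (u i) x) $ i = (R *v vec_on S (\<lambda>i. cinner (t i) x)) $ i"
    proof (cases "i \<in> S")
      case True
      have "(R *v vec_on S (\<lambda>i. cinner (t i) x)) $ i = (\<Sum>j\<in>UNIV. if j \<in> S then conjugate (G $ j $ i) * cinner (t j) x else 0)"
        by (auto simp: R_def conj_transpose_def matrix_vector_mult_def vec_on_def intro!: sum.cong)
      then show ?thesis using True by (simp add: cu vec_on_def sum.If_cases)
    next
      case False
      then show ?thesis by (simp add: id_outside_mult_nth[OF R] vec_on_def)
    qed
  qed
  have orth: "cinner (u i) (u l) = (if i = l then 1 else 0)" if "i \<in> S" "l \<in> S" for i l
  proof -
    have "cinner (u i) (u l) = (\<Sum>j\<in>S. conjugate (G $ j $ i) * (\<Sum>p\<in>S. cinner (t j) (t p) * G $ p $ l))"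
      by (simp add: cu) (simp add: u_def cinner_sum_right cinner_rscale_right)
    also have "\<dots> = (\<Sum>j\<in>S. conjugate (G $ j $ i) * (\<Sum>p\<in>UNIV. P $ j $ p * G $ p $ l))"
    proof (rule sum.cong[OF refl])
      fix j assume j: "j \<in> S"
      have "(\<Sum>p\<in>UNIV. P $ j $ p * G $ p $ l) = (\<Sum>p\<in>S. P $ j $ p * G $ p $ l)"
        using G0[OF that(2)] by (intro sum.mono_neutral_right) auto
      also have "\<dots> = (\<Sum>p\<in>S. cinner (t j) (t p) * G $ p $ l)"
        using j by (intro sum.cong) (auto simp: P_def gram_on_def)
      finally show "conjugate (G $ j $ i) * (\<Sum>p\<in>S. cinner (t j) (t p) * G $ p $ l)
        = conjugate (G $ j $ i) * (\<Sum>p\<in>UNIV. P $ j $ p * G $ p $ l)" by simp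
    qed
    also have "\<dots> = (\<Sum>j\<in>UNIV. conjugate (G $ j $ i) * (\<Sum>p\<in>UNIV. P $ j $ p * G $ p $ l))"
      using G0[OF that(1)] by (intro sum.mono_neutral_left) auto
    also have "\<dots> = (conj_transpose G ** (P ** G)) $ i $ l"
      by (simp add: matrix_matrix_mult_def conj_transpose_def)
    also have "\<dots> = (if i = l then 1 else 0)"
      using G(2) by (simp add: matrix_mul_assoc mat_def)
    finally show ?thesis .
  qed
  have Rh [measurable]: "(\<lambda>(v, q). h (P *v (G *v v), q)) \<in> borel_measurable (borel \<Otimes>\<^sub>M borel)"
    by measurable
  have "(\<integral>\<^sup>+x. h (vec_on S (\<lambda>i. cinner (t i) x), (norm x)\<^sup>2) \<partial>lborel)
    = (\<integral>\<^sup>+x. h (P *v (G *v vec_on S (\<lambda>i. cinner (u i) x)), (norm x)\<^sup>2) \<partial>lborel)"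
    by (simp add: Rb inv(1))
  also have "\<dots> = (\<integral>\<^sup>+y. (\<integral>\<^sup>+q. ennreal (radial_density a q)
        * h (P *v (G *v vec_on S y), (norm (vec_on S y))\<^sup>2 + q) \<partial>lborel) \<partial>(\<Pi>\<^sub>M i\<in>S. lborel))"
    using nn_integral_unitary_coordinates[OF orth S Rh] by (simp add: a_def)
  \<comment> \<open>Substituting \<open>R *v vec_on S b\<close> for the orthonormal coordinates
    turns \<open>P *v (G *v _)\<close> back into \<open>vec_on S b\<close>.\<close>
  also have "\<dots> = ennreal \<bar>edet ((*v) R)\<bar> * (\<integral>\<^sup>+b. (\<integral>\<^sup>+q. ennreal (radial_density a q)
        * h (P *v (G *v (R *v vec_on S b)), (norm (R *v vec_on S b))\<^sup>2 + q) \<partial>lborel) \<partial>(\<Pi>\<^sub>M i\<in>S. lborel))"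
    by (rule nn_integral_PiM_linear[OF _ R eR]) measurable
  also have "\<dots> = ennreal \<bar>edet ((*v) R)\<bar> * (\<integral>\<^sup>+b. (\<integral>\<^sup>+s. ennreal (radial_density a (s - (norm (R *v vec_on S b))\<^sup>2))
        * h (vec_on S b, s) \<partial>lborel) \<partial>(\<Pi>\<^sub>M i\<in>S. lborel))"
  proof -
    have "(\<integral>\<^sup>+q. ennreal (radial_density a q) * h (v, p + q) \<partial>lborel)
      = (\<integral>\<^sup>+s. ennreal (radial_density a (s - p)) * h (v, s) \<partial>lborel)" for v p
      by (subst nn_integral_shift[of _ p]) simp_all
    then show ?thesis by (simp add: inv(1))
  qed
  also have "\<dots> = (\<integral>\<^sup>+b. (\<integral>\<^sup>+s. ennreal \<bar>edet ((*v) R)\<bar> * (ennreal (radial_density a (s - (norm (R *v vec_on S b))\<^sup>2))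
        * h (vec_on S b, s)) \<partial>lborel) \<partial>(\<Pi>\<^sub>M i\<in>S. lborel))"
    by (subst nn_integral_cmult[symmetric], measurable, subst nn_integral_cmult[symmetric], measurable)
  also have "\<dots> = (\<integral>\<^sup>+b. (\<integral>\<^sup>+s. ennreal (gram_step_density a P (border P k (vec_on S b) s))
      * h (vec_on S b, s) \<partial>lborel) \<partial>(\<Pi>\<^sub>M i\<in>S. lborel))"
  proof -
    have "\<bar>edet ((*v) R)\<bar> * radial_density a (s - (norm (R *v vec_on S b))\<^sup>2) = gram_step_density a P (border P k (vec_on S b) s)"
      for b s
    proof -
      let ?v = "vec_on S b" and ?r = "s - (norm (R *v vec_on S b))\<^sup>2"
      have v: "?v $ i = 0" if "i \<notin> S" for i using that by (simp add: vec_on_def)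
      note hyps = P(1) k v[OF k] P(2) v G
      show ?thesis
      proof (cases "?r > 0")
        case True
        then have "border P k ?v s \<in> pos_def_cone" using border_pos_def_iff[OF hyps] by (simp add: R_def)
        moreover have "edet ((*v) (border P k ?v s)) / edet ((*v) P) = ?r powr DIM('a)"
          using edet_border[OF hyps, of s] eP True by (simp add: R_def powr_realpow)
        ultimately show ?thesis
          using True by (simp add: gram_step_density_def radial_density_def eR' powr_powr)
      next
        case False
        then have "border P k ?v s \<notin> pos_def_cone" using border_pos_def_iff[OF hyps, of s] by (simp add: R_def)
        then show ?thesis using False by (simp add: gram_step_density_def radial_density_def)
      qed
    qed
    moreover have "a > 0" using S by (simp add: a_def)
    ultimately show ?thesis by (simp add: mult.assoc[symmetric] ennreal_mult'[symmetric])
  qed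
  finally show ?thesis unfolding P_def a_def .
qed

section \<open>The density of the Gram matrix\<close>

definition pairs_on :: "'n::linorder set \<Rightarrow> ('n \<times> 'n) set" where
  "pairs_on S = {(i, j). i \<in> S \<and> j \<in> S \<and> i < j}"

definition hermitian_on ::
    "'n set \<Rightarrow> ('n \<Rightarrow> real) \<Rightarrow> ('n \<times> 'n \<Rightarrow> 'a) \<Rightarrow> 'a::conj_div_algebra^'n::{finite,linorder}^'n::{finite,linorder}" where
  "hermitian_on S d u = (\<chi> i j. if i \<in> S \<and> j \<in> S then hermitian_of (d, u) $ i $ j else if i = j then 1 else 0)"

lemma id_outside_hermitian_on: "id_outside S (hermitian_on S d u)"
  by (auto simp: id_outside_def hermitian_on_def)

lemma conj_transpose_hermitian_on: "conj_transpose (hermitian_on S d u) = hermitian_on S d u"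
  by (auto simp: conj_transpose_def hermitian_on_def hermitian_of_def vec_eq_iff conjugate_conjugate)

lemma borel_measurable_hermitian_on [measurable (raw)]:
  fixes u :: "'x \<Rightarrow> 'n::{finite,linorder} \<times> 'n \<Rightarrow> 'a::conj_div_algebra"
  assumes d: "d \<in> measurable M (\<Pi>\<^sub>M i\<in>S. lborel)" and u: "u \<in> measurable M (\<Pi>\<^sub>M p\<in>pairs_on S. lborel)"
  shows "(\<lambda>x. hermitian_on S (d x) (u x) :: 'a^'n::_^'n::_) \<in> borel_measurable M"
proof -
  have [measurable]: "(of_real :: real \<Rightarrow> 'a) \<in> borel_measurable borel"
    by (rule borel_measurable_continuous_onI) (rule continuous_on_of_real_id)
  have dm: "(\<lambda>x. d x i) \<in> borel_measurable M" if "i \<in> S" for i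
    by (rule measurable_compose[OF d measurable_PiM_lborel_component[OF that]])
  have um: "(\<lambda>x. u x (i, j)) \<in> borel_measurable M" if "i \<in> S" "j \<in> S" "i < j" for i j
    by (rule measurable_compose[OF u measurable_PiM_lborel_component]) (use that in \<open>simp add: pairs_on_def\<close>)
  have "(\<lambda>x. if i \<in> S \<and> j \<in> S then hermitian_of (d x, u x) $ i $ j else if i = j then 1 else (0::'a)) \<in> borel_measurable M"
    for i j
  proof (cases "i \<in> S \<and> j \<in> S")
    case True
    consider "i = j" | "i < j" | "j < i" by force
    then show ?thesis
    proof cases
      case 1
      have [measurable]: "(\<lambda>x. d x j) \<in> borel_measurable M" using dm True by blast
      show ?thesis using True 1 by (simp add: hermitian_of_def)
    next
      case 2
      then have "i \<noteq> j" by simp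
      then show ?thesis using True um 2 by (simp add: hermitian_of_def)
    next
      case 3
      then have "\<not> i < j" "i \<noteq> j" by auto
      then show ?thesis using True um 3 by (simp add: hermitian_of_def borel_measurable_conjugate)
    qed
  next
    case False
    then show ?thesis by (cases "i \<in> S"; cases "j \<in> S") simp_all
  qed
  then show ?thesis unfolding hermitian_on_def by measurable
qed

text \<open>As \<open>k\<close> exceeds all of \<open>S\<close>, the new entries (i, k) lie above
  the diagonal, so \<open>b\<close> enters without conjugation.\<close>

lemma hermitian_on_insert:
  assumes k: "\<And>i. i \<in> S \<Longrightarrow> i < k"
    and u': "\<And>i j. i \<in> S \<Longrightarrow> j \<in> S \<Longrightarrow> i < j \<Longrightarrow> u' (i, j) = u (i, j)" "\<And>i. i \<in> S \<Longrightarrow> u' (i, k) = b i"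
  shows "hermitian_on (insert k S) (d(k := s)) u' = border (hermitian_on S d u) k (vec_on S b) s"
proof -
  have "k \<notin> S" using k by blast
  then show ?thesis
    unfolding hermitian_on_def hermitian_of_def border_def vec_on_def vec_eq_iff
    by (auto simp: u' dest: k less_asym)
qed

definition det_power_density :: "real \<Rightarrow> 'a::conj_div_algebra^'n^'n \<Rightarrow> real" where
  "det_power_density e F = (if F \<in> pos_def_cone then edet ((*v) F) powr e else 0)"

lemma borel_measurable_det_power_density [measurable (raw)]:
  fixes F :: "'x \<Rightarrow> 'a::conj_div_algebra^'n^'n"
  assumes [measurable]: "F \<in> borel_measurable M"
  shows "(\<lambda>x. det_power_density e (F x)) \<in> borel_measurable M"
  unfolding det_power_density_def by measurable

lemma det_power_density_nonneg [simp]: "det_power_density e F \<ge> 0"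
  by (simp add: det_power_density_def)

text \<open>Factor \<open>i\<close> is the constant of the radial density for the squared distance
  of a column from the span of \<open>i\<close> previous ones, in real dimension
  \<open>\<beta> * real (m - i)\<close>.\<close>

definition gram_const :: "real \<Rightarrow> nat \<Rightarrow> nat \<Rightarrow> real" where
  "gram_const \<beta> m c = (\<Prod>i<c. pi powr (\<beta> * real (m - i) / 2) / Gamma (\<beta> * real (m - i) / 2))"

lemma gram_const_nonneg: "c \<le> m \<Longrightarrow> \<beta> > 0 \<Longrightarrow> gram_const \<beta> m c \<ge> 0"
  unfolding gram_const_def
  by (intro prod_nonneg) (auto intro!: divide_nonneg_nonneg less_imp_le[OF Gamma_real_pos])

text \<open>The exponents of \<open>edet\<close> at \<open>P\<close> from the old density, the
  radial density and the Jacobian add up to 0, leaving only a power at the bordered matrix.\<close>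

lemma det_power_density_step:
  fixes P :: "'a::conj_div_algebra^'n^'n"
  assumes P: "id_outside S P" "k \<notin> S" "b $ k = 0" "conj_transpose P = P" and c: "c < m"
  defines "a \<equiv> DIM('a) * real (m - c) / 2"
  shows "det_power_density ((real m - real c + 1) / 2 - 1 / DIM('a)) P * gram_step_density a P (border P k b s)
    = pi powr a / Gamma a * det_power_density ((real m - real (Suc c) + 1) / 2 - 1 / DIM('a)) (border P k b s)"
proof (cases "border P k b s \<in> pos_def_cone")
  case True
  let ?F = "border P k b s" and ?D = "real DIM('a)"
  have Ppd: "P \<in> pos_def_cone" by (rule pos_def_cone_of_border[OF P True])
  have pos: "edet ((*v) P) > 0" "edet ((*v) ?F) > 0"
    using herm_det_eq_edet(2)[OF Ppd] herm_det_eq_edet(2)[OF True] by auto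
  have D: "?D > 0" by simp
  \<comment> \<open>The right-hand side is already the exponent of the density for
    \<open>Suc c\<close> columns.\<close>
  have e1: "(a - 1) / ?D = (real m - real c) / 2 - 1 / ?D"
    using c D unfolding a_def by (simp add: of_nat_diff field_simps)
  have e2: "(real m - real c + 1) / 2 - 1 / ?D + - ((a - 1) / ?D) + - 1 / 2 = 0"
    unfolding e1 by (simp add: diff_divide_distrib add_divide_distrib)
  have "edet ((*v) P) powr ((real m - real c + 1) / 2 - 1 / ?D)
      * ((edet ((*v) ?F) / edet ((*v) P)) powr ((a - 1) / ?D) * edet ((*v) P) powr (- 1 / 2))
    = edet ((*v) P) powr ((real m - real c + 1) / 2 - 1 / ?D + - ((a - 1) / ?D) + - 1 / 2) * edet ((*v) ?F) powr ((a - 1) / ?D)"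
    using pos unfolding powr_add by (simp add: powr_divide powr_minus field_simps)
  also have "\<dots> = edet ((*v) ?F) powr ((real m - real (Suc c) + 1) / 2 - 1 / ?D)"
  proof -
    have z: "edet ((*v) P) powr ((real m - real c + 1) / 2 - 1 / ?D + - ((a - 1) / ?D) + - 1 / 2) = 1"
      unfolding e2 using pos by simp
    show ?thesis unfolding z by (simp add: e1)
  qed
  finally show ?thesis using True Ppd
    by (simp add: det_power_density_def gram_step_density_def algebra_simps)
next
  case False
  then show ?thesis by (simp add: det_power_density_def gram_step_density_def)
qed

text \<open>Induction that adds the largest index. The function \<open>h\<close> must stay
  arbitrary: the hypothesis is applied both to the integral over the new column and to an
  indicator.\<close>

lemma nn_integral_gram_on:
  fixes h :: "'a::conj_div_algebra^'n::{finite,linorder}^'n::{finite,linorder} \<Rightarrow> ennreal"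
  assumes mn: "CARD('n) \<le> CARD('m::finite)" and h: "h \<in> borel_measurable borel"
  shows "(\<integral>\<^sup>+t. h (gram_on S t) \<partial>(\<Pi>\<^sub>M j\<in>S. (lborel :: ('a^'m) measure))) =
    ennreal (gram_const DIM('a) CARD('m) (card S)) *
    (\<integral>\<^sup>+u. (\<integral>\<^sup>+d. ennreal (det_power_density ((real CARD('m) - real (card S) + 1) / 2 - 1 / DIM('a)) (hermitian_on S d u))
      * h (hermitian_on S d u) \<partial>(\<Pi>\<^sub>M i\<in>S. lborel)) \<partial>(\<Pi>\<^sub>M p\<in>pairs_on S. lborel))"
  using finite[of S] h
proof (induction S arbitrary: h rule: finite_linorder_max_induct)
  case empty
  have "gram_on {} t = mat 1" for t :: "'n \<Rightarrow> 'a^'m"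
    by (simp add: gram_on_def mat_def vec_eq_iff)
  moreover have "hermitian_on {} d u = (mat 1 :: 'a^'n::_^'n::_)" for d u
    by (simp add: hermitian_on_def mat_def vec_eq_iff)
  moreover have "det_power_density e (mat 1 :: 'a^'n::_^'n::_) = 1" for e
  proof -
    have "(mat 1 :: 'a^'n::_^'n::_) \<in> pos_def_cone" by (simp add: pos_def_cone_iff)
    moreover have "(*v) (mat 1 :: 'a^'n::_^'n::_) = (\<lambda>x. x)" by (simp add: fun_eq_iff)
    ultimately show ?thesis by (simp add: det_power_density_def edet_ident)
  qed
  moreover have "pairs_on ({} :: 'n set) = {}" by (simp add: pairs_on_def)
  ultimately show ?case by (simp add: gram_const_def PiM_empty nn_integral_count_space_finite)
next
  case (insert k S)
  note [measurable] = insert.prems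
  have k: "k \<notin> S" using insert.hyps(2) by blast
  let ?m = "CARD('m)" and ?c = "card S" and ?D = "real DIM('a)"
  let ?PS = "\<Pi>\<^sub>M i\<in>S. lborel :: (real measure)" and ?PU = "\<Pi>\<^sub>M p\<in>pairs_on S. lborel :: ('a measure)"
    and ?PB = "\<Pi>\<^sub>M i\<in>S. lborel :: ('a measure)" and ?PT = "\<Pi>\<^sub>M i\<in>S. lborel :: (('a^'m) measure)"
  interpret PB: sigma_finite_measure ?PB by (intro lborel_prod.sigma_finite insert.hyps(1))
  interpret PS: sigma_finite_measure ?PS by (intro lborel_prod.sigma_finite insert.hyps(1))
  have "card (insert k S) \<le> CARD('n)" by (rule card_mono) auto
  then have c: "?c < ?m" using mn k by simp
  define a where "a = DIM('a) * real (?m - ?c) / 2"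
  have a: "a > 0" using c by (simp add: a_def)
  define K where "K = gram_const DIM('a) ?m"
  have Kpos: "K n \<ge> 0" if "n \<le> ?m" for n
    unfolding K_def using that by (simp add: gram_const_nonneg)
  define e e' where "e = (real ?m - real ?c + 1) / 2 - 1 / ?D" and "e' = (real ?m - real (Suc ?c) + 1) / 2 - 1 / ?D"
  note IH = insert.IH[folded K_def e_def]
  define \<Psi> where "\<Psi> F = ennreal (det_power_density e' F) * h F" for F
  have [measurable]: "\<Psi> \<in> borel_measurable borel" unfolding \<Psi>_def[abs_def] by measurable
  \<comment> \<open>The integral over the new column as a function of the old Gram matrix
    \<open>P\<close>, with the value given by \<open>nn_integral_gram_step\<close>.\<close>
  define \<Phi> where "\<Phi> P = (\<integral>\<^sup>+b. (\<integral>\<^sup>+s. ennreal (gram_step_density a P (border P k (vec_on S b) s))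
      * h (border P k (vec_on S b) s) \<partial>lborel) \<partial>?PB)" for P :: "'a^'n::_^'n::_"
  have [measurable]: "\<Phi> \<in> borel_measurable borel" unfolding \<Phi>_def[abs_def] by measurable
  \<comment> \<open>The induction hypothesis for this indicator has integrand zero, so almost all
    systems of old columns are linearly independent and the step applies to them.\<close>
  have "(\<integral>\<^sup>+t. indicator (- pos_def_cone) (gram_on S t) \<partial>?PT) = 0"
  proof -
    have z: "ennreal (det_power_density e F) * indicator (- pos_def_cone) F = 0" for F :: "'a^'n::_^'n::_"
      by (simp add: det_power_density_def)
    show ?thesis by (subst IH) (measurable, simp only: z nn_integral_const mult_zero_left mult_zero_right)
  qed
  then have pd: "AE t in ?PT. gram_on S t \<in> pos_def_cone"
    by (subst (asm) nn_integral_0_iff_AE) (auto simp: indicator_def split: if_splits)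
  have "(\<integral>\<^sup>+t. h (gram_on (insert k S) t) \<partial>(\<Pi>\<^sub>M i\<in>insert k S. (lborel :: ('a^'m) measure)))
    = (\<integral>\<^sup>+t. (\<integral>\<^sup>+x. h (gram_on (insert k S) (t(k := x))) \<partial>lborel) \<partial>?PT)"
    by (rule lborel_prod.product_nn_integral_insert[OF insert.hyps(1) k]) measurable
  also have "\<dots> = (\<integral>\<^sup>+t. \<Phi> (gram_on S t) \<partial>?PT)"
  proof (rule nn_integral_cong_AE, use pd in eventually_elim)
    fix t :: "'n \<Rightarrow> 'a^'m" assume t: "gram_on S t \<in> pos_def_cone"
    have "(\<lambda>(v, q). h (border (gram_on S t) k v q)) \<in> borel_measurable (borel \<Otimes>\<^sub>M borel)" by measurable
    from nn_integral_gram_step[OF t k c this]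
    show "(\<integral>\<^sup>+x. h (gram_on (insert k S) (t(k := x))) \<partial>lborel) = \<Phi> (gram_on S t)"
      by (simp add: gram_on_insert[OF k] \<Phi>_def a_def)
  qed
  also have "\<dots> = ennreal (K ?c) * (\<integral>\<^sup>+u. (\<integral>\<^sup>+d. ennreal (det_power_density e (hermitian_on S d u))
      * \<Phi> (hermitian_on S d u) \<partial>?PS) \<partial>?PU)"
    by (rule IH) measurable
  also have "\<dots> = ennreal (K ?c) * (\<integral>\<^sup>+u. (\<integral>\<^sup>+d. ennreal (pi powr a / Gamma a) *
      (\<integral>\<^sup>+b. (\<integral>\<^sup>+s. \<Psi> (border (hermitian_on S d u) k (vec_on S b) s) \<partial>lborel) \<partial>?PB) \<partial>?PS) \<partial>?PU)"
  proof -
    have "ennreal (det_power_density e P) * \<Phi> P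
      = ennreal (pi powr a / Gamma a) * (\<integral>\<^sup>+b. (\<integral>\<^sup>+s. \<Psi> (border P k (vec_on S b) s) \<partial>lborel) \<partial>?PB)"
      if P: "id_outside S P" "conj_transpose P = P" for P
    proof -
      have pw: "ennreal (det_power_density e P) * (ennreal (gram_step_density a P (border P k (vec_on S b) s))
        * h (border P k (vec_on S b) s)) = ennreal (pi powr a / Gamma a) * \<Psi> (border P k (vec_on S b) s)" for b s
      proof -
        have "vec_on S b $ k = 0" using k by (simp add: vec_on_def)
        from det_power_density_step[OF P(1) k this P(2) c, of s, folded e_def e'_def a_def]
        have "ennreal (det_power_density e P) * ennreal (gram_step_density a P (border P k (vec_on S b) s))
          = ennreal (pi powr a / Gamma a) * ennreal (det_power_density e' (border P k (vec_on S b) s))"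
          using a by (simp add: ennreal_mult'[symmetric] Gamma_real_pos less_imp_le)
        then show ?thesis by (simp add: \<Psi>_def mult.assoc[symmetric])
      qed
      have "ennreal (det_power_density e P) * \<Phi> P = (\<integral>\<^sup>+b. (\<integral>\<^sup>+s. ennreal (det_power_density e P) *
         (ennreal (gram_step_density a P (border P k (vec_on S b) s)) * h (border P k (vec_on S b) s)) \<partial>lborel) \<partial>?PB)"
        unfolding \<Phi>_def by (subst nn_integral_cmult[symmetric], measurable, subst nn_integral_cmult[symmetric], measurable)
      also have "\<dots> = (\<integral>\<^sup>+b. (\<integral>\<^sup>+s. ennreal (pi powr a / Gamma a) * \<Psi> (border P k (vec_on S b) s) \<partial>lborel) \<partial>?PB)"
        unfolding pw ..
      also have "\<dots> = ennreal (pi powr a / Gamma a) * (\<integral>\<^sup>+b. (\<integral>\<^sup>+s. \<Psi> (border P k (vec_on S b) s) \<partial>lborel) \<partial>?PB)"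
        by (subst nn_integral_cmult, measurable, subst nn_integral_cmult, measurable)
      finally show ?thesis .
    qed
    then show ?thesis by (simp add: id_outside_hermitian_on conj_transpose_hermitian_on)
  qed
  also have "\<dots> = ennreal (K ?c) * (ennreal (pi powr a / Gamma a) * (\<integral>\<^sup>+u. (\<integral>\<^sup>+d. 
      (\<integral>\<^sup>+b. (\<integral>\<^sup>+s. \<Psi> (border (hermitian_on S d u) k (vec_on S b) s) \<partial>lborel) \<partial>?PB) \<partial>?PS) \<partial>?PU))"
  proof -
    let ?X = "\<lambda>u d. \<integral>\<^sup>+b. (\<integral>\<^sup>+s. \<Psi> (border (hermitian_on S d u) k (vec_on S b) s) \<partial>lborel) \<partial>?PB"
    have "(\<integral>\<^sup>+u. (\<integral>\<^sup>+d. ennreal (pi powr a / Gamma a) * ?X u d \<partial>?PS) \<partial>?PU)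
      = (\<integral>\<^sup>+u. ennreal (pi powr a / Gamma a) * (\<integral>\<^sup>+d. ?X u d \<partial>?PS) \<partial>?PU)"
    proof (rule nn_integral_cong)
      fix u assume u: "u \<in> space ?PU"
      \<comment> \<open>As a constant map into the product space, the fixed \<open>u\<close> fits
        the measurability rule for \<open>hermitian_on\<close>.\<close>
      note [measurable] = measurable_const[OF u]
      show "(\<integral>\<^sup>+d. ennreal (pi powr a / Gamma a) * ?X u d \<partial>?PS)
        = ennreal (pi powr a / Gamma a) * (\<integral>\<^sup>+d. ?X u d \<partial>?PS)"
        by (rule nn_integral_cmult) measurable
    qed
    also have "\<dots> = ennreal (pi powr a / Gamma a) * (\<integral>\<^sup>+u. (\<integral>\<^sup>+d. ?X u d \<partial>?PS) \<partial>?PU)"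
      by (rule nn_integral_cmult) measurable
    finally show ?thesis by simp
  qed
  also have "\<dots> = ennreal (K (Suc ?c)) * (\<integral>\<^sup>+u. (\<integral>\<^sup>+d. 
      (\<integral>\<^sup>+b. (\<integral>\<^sup>+s. \<Psi> (border (hermitian_on S d u) k (vec_on S b) s) \<partial>lborel) \<partial>?PB) \<partial>?PS) \<partial>?PU)"
  proof -
    have "K (Suc ?c) = K ?c * (pi powr a / Gamma a)" by (simp add: K_def gram_const_def a_def)
    moreover have "pi powr a / Gamma a \<ge> 0" using a by (simp add: Gamma_real_pos less_imp_le)
    ultimately have "ennreal (K (Suc ?c)) = ennreal (K ?c) * ennreal (pi powr a / Gamma a)"
      using Kpos[of ?c] c by (simp only: ennreal_mult less_imp_le)
    then show ?thesis by (simp only: mult.assoc)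
  qed
  \<comment> \<open>The entries \<open>b\<close> belong to the outer integral over positions above
    the diagonal and \<open>s\<close> to the inner one over the diagonal, so \<open>b\<close> has to
    move past \<open>d\<close>.\<close>
  also have "(\<integral>\<^sup>+u. (\<integral>\<^sup>+d. 
      (\<integral>\<^sup>+b. (\<integral>\<^sup>+s. \<Psi> (border (hermitian_on S d u) k (vec_on S b) s) \<partial>lborel) \<partial>?PB) \<partial>?PS) \<partial>?PU)
    = (\<integral>\<^sup>+u. (\<integral>\<^sup>+b. 
      (\<integral>\<^sup>+d. (\<integral>\<^sup>+s. \<Psi> (border (hermitian_on S d u) k (vec_on S b) s) \<partial>lborel) \<partial>?PS) \<partial>?PB) \<partial>?PU)"
  proof (rule nn_integral_cong)
    fix u assume u: "u \<in> space ?PU"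
    note [measurable] = measurable_const[OF u]
    interpret pair_sigma_finite ?PB ?PS
      by (intro pair_sigma_finite.intro lborel_prod.sigma_finite insert.hyps(1))
    show "(\<integral>\<^sup>+d. (\<integral>\<^sup>+b. (\<integral>\<^sup>+s. \<Psi> (border (hermitian_on S d u) k (vec_on S b) s) \<partial>lborel) \<partial>?PB) \<partial>?PS)
      = (\<integral>\<^sup>+b. (\<integral>\<^sup>+d. (\<integral>\<^sup>+s. \<Psi> (border (hermitian_on S d u) k (vec_on S b) s) \<partial>lborel) \<partial>?PS) \<partial>?PB)"
      by (rule Fubini') measurable
  qed
  also have "\<dots> = (\<integral>\<^sup>+u. (\<integral>\<^sup>+d. \<Psi> (hermitian_on (insert k S) d u) \<partial>(\<Pi>\<^sub>M i\<in>insert k S. lborel)) \<partial>(\<Pi>\<^sub>M p\<in>pairs_on (insert k S). lborel))"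
  proof -
    let ?r = "\<lambda>i. (i, k)"
    have pairs: "pairs_on (insert k S) = pairs_on S \<union> ?r ` S" "pairs_on S \<inter> ?r ` S = {}"
      using insert.hyps(2) k by (auto simp: pairs_on_def)
    have fin: "finite (pairs_on S)" "finite (?r ` S)" by auto
    have "(\<integral>\<^sup>+u. (\<integral>\<^sup>+d. \<Psi> (hermitian_on (insert k S) d u) \<partial>(\<Pi>\<^sub>M i\<in>insert k S. lborel)) \<partial>(\<Pi>\<^sub>M p\<in>pairs_on (insert k S). lborel))
      = (\<integral>\<^sup>+u. (\<integral>\<^sup>+w. (\<integral>\<^sup>+d. \<Psi> (hermitian_on (insert k S) d (merge (pairs_on S) (?r ` S) (u, w)))
        \<partial>(\<Pi>\<^sub>M i\<in>insert k S. lborel)) \<partial>(\<Pi>\<^sub>M p\<in>?r ` S. lborel)) \<partial>?PU)"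
      unfolding pairs(1)
    proof (rule lborel_prod.product_nn_integral_fold[OF pairs(2) fin])
      interpret sigma_finite_measure "\<Pi>\<^sub>M i\<in>insert k S. lborel :: (real measure)"
        by (intro lborel_prod.sigma_finite) simp
      show "(\<lambda>u. \<integral>\<^sup>+d. \<Psi> (hermitian_on (insert k S) d u) \<partial>(\<Pi>\<^sub>M i\<in>insert k S. lborel))
        \<in> borel_measurable (\<Pi>\<^sub>M p\<in>pairs_on S \<union> ?r ` S. lborel)"
        unfolding pairs(1)[symmetric] by measurable
    qed
    also have "\<dots> = (\<integral>\<^sup>+u. (\<integral>\<^sup>+w. (\<integral>\<^sup>+d. (\<integral>\<^sup>+s. \<Psi> (border (hermitian_on S d u) k (vec_on S (\<lambda>i\<in>S. w (?r i))) s)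
        \<partial>lborel) \<partial>?PS) \<partial>(\<Pi>\<^sub>M p\<in>?r ` S. lborel)) \<partial>?PU)"
    proof (rule nn_integral_cong, rule nn_integral_cong)
      fix u w assume u: "u \<in> space ?PU" and w: "w \<in> space (\<Pi>\<^sub>M p\<in>?r ` S. lborel :: ('a measure))"
      let ?u = "merge (pairs_on S) (?r ` S) (u, w)"
      have "?u \<in> space (\<Pi>\<^sub>M p\<in>pairs_on (insert k S). lborel)"
        using u w by (auto simp: space_PiM pairs(1) PiE_iff)
      note [measurable] = measurable_const[OF this]
      have ins: "(\<integral>\<^sup>+d. \<Psi> (hermitian_on (insert k S) d ?u) \<partial>(\<Pi>\<^sub>M i\<in>insert k S. lborel))
        = (\<integral>\<^sup>+d. (\<integral>\<^sup>+s. \<Psi> (hermitian_on (insert k S) (d(k := s)) ?u) \<partial>lborel) \<partial>?PS)"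
        by (rule lborel_prod.product_nn_integral_insert[OF insert.hyps(1) k]) measurable
      have bord: "hermitian_on (insert k S) (d(k := s)) ?u = border (hermitian_on S d u) k (vec_on S (\<lambda>i\<in>S. w (?r i))) s" for d s
        using insert.hyps(2) k by (intro hermitian_on_insert) (auto simp: merge_def pairs_on_def)
      show "(\<integral>\<^sup>+d. \<Psi> (hermitian_on (insert k S) d ?u) \<partial>(\<Pi>\<^sub>M i\<in>insert k S. lborel))
        = (\<integral>\<^sup>+d. (\<integral>\<^sup>+s. \<Psi> (border (hermitian_on S d u) k (vec_on S (\<lambda>i\<in>S. w (?r i))) s) \<partial>lborel) \<partial>?PS)"
        unfolding ins bord ..
    qed
    also have "\<dots> = (\<integral>\<^sup>+u. (\<integral>\<^sup>+b. 
      (\<integral>\<^sup>+d. (\<integral>\<^sup>+s. \<Psi> (border (hermitian_on S d u) k (vec_on S b) s) \<partial>lborel) \<partial>?PS) \<partial>?PB) \<partial>?PU)"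
    proof (rule nn_integral_cong)
      fix u assume u: "u \<in> space ?PU"
      note [measurable] = measurable_const[OF u]
      show "(\<integral>\<^sup>+w. (\<integral>\<^sup>+d. (\<integral>\<^sup>+s. \<Psi> (border (hermitian_on S d u) k (vec_on S (\<lambda>i\<in>S. w (?r i))) s)
        \<partial>lborel) \<partial>?PS) \<partial>(\<Pi>\<^sub>M p\<in>?r ` S. lborel)) = (\<integral>\<^sup>+b. 
        (\<integral>\<^sup>+d. (\<integral>\<^sup>+s. \<Psi> (border (hermitian_on S d u) k (vec_on S b) s) \<partial>lborel) \<partial>?PS) \<partial>?PB)"
        by (rule nn_integral_PiM_reindex[where g = "\<lambda>b. \<integral>\<^sup>+d. (\<integral>\<^sup>+s. \<Psi> (border (hermitian_on S d u) k (vec_on S b) s) \<partial>lborel) \<partial>?PS"])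
          (use insert.hyps in \<open>auto simp: inj_on_def\<close>, measurable)
    qed
    finally show ?thesis ..
  qed
  finally show ?case using k by (simp add: K_def \<Psi>_def e'_def)
qed

text \<open>With \<open>S = UNIV\<close> the padding by the identity disappears, and Fubini merges
  the iterated integral into the measure on Hermitian matrices.\<close>

theorem nn_integral_gram:
  fixes h :: "'a::conj_div_algebra^'n::{finite,linorder}^'n::{finite,linorder} \<Rightarrow> ennreal"
  assumes mn: "CARD('n) \<le> CARD('m::finite)" and h [measurable]: "h \<in> borel_measurable borel"
  shows "(\<integral>\<^sup>+T. h (conj_transpose T ** T) \<partial>(lborel :: ('a^'n::_^'m) measure)) =
    (\<integral>\<^sup>+F. ennreal (gram_const DIM('a) CARD('m) CARD('n) *
      det_power_density ((real CARD('m) - real CARD('n) + 1) / 2 - 1 / DIM('a)) F) * h F \<partial>hermitian_lborel)"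
proof -
  let ?K = "gram_const DIM('a) CARD('m) CARD('n)"
  define e where "e = (real CARD('m) - real CARD('n) + 1) / 2 - 1 / real DIM('a)"
  have K: "?K \<ge> 0"
    using mn by (simp add: gram_const_nonneg)
  let ?D = "\<Pi>\<^sub>M i\<in>(UNIV :: 'n set). lborel :: real measure"
    and ?U = "\<Pi>\<^sub>M p\<in>{(i :: 'n, j). i < j}. lborel :: 'a measure"
  have pairs: "pairs_on UNIV = {(i :: 'n, j). i < j}" by (simp add: pairs_on_def)
  have herm: "hermitian_on UNIV d u = (hermitian_of (d, u) :: 'a^'n::_^'n::_)" for d u
    by (simp add: hermitian_on_def vec_eq_iff)
  have gram: "conj_transpose (\<chi> l j. t j $ l) ** (\<chi> l j. t j $ l) = gram_on UNIV t" for t :: "'n \<Rightarrow> 'a^'m"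
    by (simp add: gram_on_def conj_transpose_def matrix_matrix_mult_def cinner_def vec_eq_iff)
  have [measurable]: "(\<lambda>T :: 'a^'n::_^'m. conj_transpose T ** T) \<in> borel_measurable borel"
    unfolding conj_transpose_def matrix_matrix_mult_def by measurable
  interpret pair_sigma_finite ?D ?U
    by (intro pair_sigma_finite.intro lborel_prod.sigma_finite) auto
  have "(\<integral>\<^sup>+T. h (conj_transpose T ** T) \<partial>(lborel :: ('a^'n::_^'m) measure))
    = (\<integral>\<^sup>+t. h (gram_on UNIV t) \<partial>(\<Pi>\<^sub>M j\<in>UNIV. (lborel :: ('a^'m) measure)))"
    by (subst nn_integral_lborel_columns) (measurable, simp add: gram)
  also have "\<dots> = ennreal ?K * (\<integral>\<^sup>+u. (\<integral>\<^sup>+d. ennreal (det_power_density e (hermitian_of (d, u))) * h (hermitian_of (d, u)) \<partial>?D) \<partial>?U)"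
    using nn_integral_gram_on[OF mn h, of UNIV] by (simp only: herm pairs e_def)
  also have "(\<integral>\<^sup>+u. (\<integral>\<^sup>+d. ennreal (det_power_density e (hermitian_of (d, u))) * h (hermitian_of (d, u)) \<partial>?D) \<partial>?U)
    = (\<integral>\<^sup>+x. ennreal (det_power_density e (hermitian_of x)) * h (hermitian_of x) \<partial>(?D \<Otimes>\<^sub>M ?U))"
    using measurable_hermitian_of[measurable] by (intro nn_integral_snd) measurable
  also have "\<dots> = (\<integral>\<^sup>+F. ennreal (det_power_density e F) * h F \<partial>hermitian_lborel)"
    unfolding hermitian_lborel_def
    by (rule nn_integral_distr[symmetric, OF measurable_hermitian_of]) measurable
  also have "ennreal ?K * \<dots> = (\<integral>\<^sup>+F. ennreal (?K * det_power_density e F) * h F \<partial>hermitian_lborel)"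
  proof -
    have "(\<lambda>F. ennreal (det_power_density e F) * h F) \<in> borel_measurable hermitian_lborel"
      unfolding hermitian_lborel_def by measurable
    then show ?thesis by (subst nn_integral_cmult[symmetric]) (simp_all add: ennreal_mult'[OF K] mult.assoc)
  qed
  finally show ?thesis by (simp only: e_def)
qed

section \<open>The constants\<close>

text \<open>The exponents \<open>\<beta> * real (m - i) / 2\<close> of pi sum to
  \<open>m * n * \<beta> / 2 - n * (n - 1) * \<beta> / 4\<close>; the second part is the power of pi
  in \<open>multi_Gamma\<close>.\<close>

lemma gram_const_eq:
  assumes "n \<le> m" "\<beta> > 0"
  shows "gram_const \<beta> m n = pi powr (real m * real n * \<beta> / 2) / multi_Gamma \<beta> n (\<beta> * real m / 2)"
proof -
  have p: "(\<Prod>i<n. pi powr (\<beta> * real (m - i) / 2)) = pi powr (real m * real n * \<beta> / 2) / pi powr (real n * (real n - 1) * \<beta> / 4)"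
    using assms(1)
  proof (induction n)
    case (Suc n)
    then have "(\<Prod>i<Suc n. pi powr (\<beta> * real (m - i) / 2))
      = pi powr (real m * real n * \<beta> / 2) / pi powr (real n * (real n - 1) * \<beta> / 4) * pi powr (\<beta> * real (m - n) / 2)"
      by simp
    also have "\<dots> = pi powr (real m * real n * \<beta> / 2 - real n * (real n - 1) * \<beta> / 4 + \<beta> * real (m - n) / 2)"
      by (simp add: powr_diff powr_add)
    also have "real m * real n * \<beta> / 2 - real n * (real n - 1) * \<beta> / 4 + \<beta> * real (m - n) / 2
      = real m * real (Suc n) * \<beta> / 2 - real (Suc n) * (real (Suc n) - 1) * \<beta> / 4"
      using Suc.prems by (simp add: of_nat_diff field_simps)
    finally show ?case by (simp only: powr_diff)
  qed simp
  have "(\<Prod>i=1..n. Gamma (\<beta> * real m / 2 - (real i - 1) * \<beta> / 2)) = (\<Prod>i<n. Gamma (\<beta> * real m / 2 - real i * \<beta> / 2))"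
    by (rule prod.reindex_bij_witness[of _ Suc "\<lambda>i. i - 1"]) (auto simp: of_nat_diff)
  also have "\<dots> = (\<Prod>i<n. Gamma (\<beta> * real (m - i) / 2))"
    using assms(1) by (intro prod.cong) (auto simp: of_nat_diff algebra_simps diff_divide_distrib)
  finally show ?thesis
    by (simp add: gram_const_def multi_Gamma_def prod_dividef p)
qed

lemma multi_Gamma_pos:
  assumes "a > (real p - 1) * \<beta> / 2" "\<beta> > 0" shows "multi_Gamma \<beta> p a > 0"
proof -
  have "a - (real i - 1) * \<beta> / 2 > 0" if "i \<in> {1..p}" for i
  proof -
    have "(real i - 1) * \<beta> / 2 \<le> (real p - 1) * \<beta> / 2"
      using that assms(2) by (intro divide_right_mono mult_right_mono) auto
    then show ?thesis using assms(1) by simp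
  qed
  then show ?thesis unfolding multi_Gamma_def by (intro mult_pos_pos prod_pos Gamma_real_pos) auto
qed

text \<open>Up to equal powers of pi, both sides are the product of \<open>G j\<close> over
  \<open>j < m + n\<close>, cut after the first \<open>m\<close> factors on the left and after the
  first \<open>n\<close> on the right.\<close>

lemma multi_Gamma_ratio:
  "multi_Gamma \<beta> m (\<beta> * (real n + \<nu>) / 2) * multi_Gamma \<beta> n (\<beta> * (\<nu> + real n - real m) / 2) =
   multi_Gamma \<beta> n (\<beta> * (real n + \<nu>) / 2) * multi_Gamma \<beta> m (\<beta> * \<nu> / 2)"
proof -
  define G where "G j = Gamma (\<beta> * (real n + \<nu> - real j) / 2)" for j :: nat
  have split: "(\<Prod>j<p + q. G j) = (\<Prod>j<p. G j) * (\<Prod>j<q. G (p + j))" for p q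
    by (induction q) (simp_all add: mult.assoc)
  have shift: "(\<Prod>i=1..p. Gamma (a - (real i - 1) * \<beta> / 2)) = (\<Prod>j<p. G (q + j))"
    if "a = \<beta> * (real n + \<nu> - real q) / 2" for p q a
    by (rule prod.reindex_bij_witness[of _ Suc "\<lambda>i. i - 1"])
      (auto simp: of_nat_diff G_def that algebra_simps diff_divide_distrib add_divide_distrib)
  have pr: "(\<Prod>j<m. G (0 + j)) * (\<Prod>j<n. G (m + j)) = (\<Prod>j<n. G (0 + j)) * (\<Prod>j<m. G (n + j))"
    using split[of m n] split[of n m] by (simp add: add.commute)
  have s1: "(\<Prod>i=1..p. Gamma (\<beta> * (real n + \<nu>) / 2 - (real i - 1) * \<beta> / 2)) = (\<Prod>j<p. G (0 + j))" for p
    by (rule shift) simp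
  have s2: "(\<Prod>i=1..n. Gamma (\<beta> * (\<nu> + real n - real m) / 2 - (real i - 1) * \<beta> / 2)) = (\<Prod>j<n. G (m + j))"
    by (rule shift) (simp add: algebra_simps)
  have s3: "(\<Prod>i=1..m. Gamma (\<beta> * \<nu> / 2 - (real i - 1) * \<beta> / 2)) = (\<Prod>j<m. G (n + j))"
    by (rule shift) simp
  have "a * A * (b * B) = b * C * (a * D)" if "A * B = C * D" for a b A B C D :: real
    using arg_cong[OF that, of "\<lambda>z. a * b * z"] by (simp only: mult.assoc mult.left_commute mult.commute)
  from this[OF pr] show ?thesis unfolding multi_Gamma_def s1 s2 s3 .
qed

text \<open>The power of pi in \<open>gram_const\<close> cancels the one in the density of
  \<open>T\<close>, and \<open>multi_Gamma_ratio\<close> trades the functions of order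
  \<open>m\<close> for those of order \<open>n\<close>.\<close>

lemma beta_II_const:
  assumes n: "n \<le> m" and \<beta>: "\<beta> \<ge> 1" and \<nu>: "\<nu> > \<beta> * (real m - 1)"
    and m: "m > 0"
  shows "gram_const \<beta> m n * (multi_Gamma \<beta> m (\<beta> * (real n + \<nu>) / 2) /
      (pi powr (real m * real n * \<beta> / 2) * multi_Gamma \<beta> m (\<beta> * \<nu> / 2)))
    = 1 / multi_Beta \<beta> n (\<beta> * (\<nu> + real n - real m) / 2) (\<beta> * real m / 2)"
proof -
  have "\<beta> * (real m - 1) \<ge> 1 * (real m - 1)" using \<beta> m by (intro mult_right_mono) auto
  then have \<nu>': "\<nu> > real m - 1" using \<nu> by simp
  have pos: "multi_Gamma \<beta> n (\<beta> * real m / 2) > 0" "multi_Gamma \<beta> m (\<beta> * \<nu> / 2) > 0"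
    "multi_Gamma \<beta> n (\<beta> * (\<nu> + real n - real m) / 2) > 0" "multi_Gamma \<beta> n (\<beta> * (real n + \<nu>) / 2) > 0"
  proof -
    \<comment> \<open>All four arguments have the form \<open>\<beta> * x / 2\<close>; the bounds on
      \<open>x\<close> follow from \<open>n \<le> m\<close> and
      \<open>\<nu> > real m - 1\<close>.\<close>
    have "multi_Gamma \<beta> p (\<beta> * x / 2) > 0" if "x > real p - 1" for p x
      using that \<beta> by (intro multi_Gamma_pos) (auto simp: mult.commute)
    from this[of n "real m"] this[of m \<nu>] this[of n "\<nu> + real n - real m"] this[of n "real n + \<nu>"]
    show "multi_Gamma \<beta> n (\<beta> * real m / 2) > 0" "multi_Gamma \<beta> m (\<beta> * \<nu> / 2) > 0"
      "multi_Gamma \<beta> n (\<beta> * (\<nu> + real n - real m) / 2) > 0" "multi_Gamma \<beta> n (\<beta> * (real n + \<nu>) / 2) > 0"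
      using n m \<nu>' by auto
  qed
  have e: "\<beta> * real m / 2 + \<beta> * (\<nu> + real n - real m) / 2 = \<beta> * (real n + \<nu>) / 2" by (simp add: field_simps)
  show ?thesis
    unfolding multi_Beta_def e gram_const_eq[OF n less_le_trans[OF zero_less_one \<beta>]]
    using multi_Gamma_ratio[of \<beta> m n \<nu>] pos by (simp add: field_simps)
qed

section \<open>The density of the matricvariate beta distribution\<close>

text \<open>The density of \<open>T\<close> is a function \<open>g\<close> of the Gram matrix by
  Sylvester's identity, and Lebesgue measure has image density \<open>k\<close>; hence the Gram
  matrix has density \<open>k F * g F\<close>, and the rest is a comparison of exponents and
  constants.\<close>

theorem distributed_matricvariate_beta_II:
  fixes T :: "'w \<Rightarrow> 'a::conj_div_algebra^'n::{finite,linorder}^'m"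
  assumes mn: "CARD('n) \<le> CARD('m)" and \<nu>: "\<nu> > real DIM('a) * (real CARD('m) - 1)"
    and T: "distributed M lborel T (\<lambda>X. ennreal (matricvariate_T_density DIM('a) \<nu> X))"
  shows "distributed M hermitian_lborel (\<lambda>\<omega>. conj_transpose (T \<omega>) ** T \<omega>)
    (\<lambda>F. ennreal (matricvariate_beta_II_density DIM('a) CARD('m) \<nu> F))"
proof -
  let ?D = "real DIM('a)" and ?m = "CARD('m)" and ?n = "CARD('n)"
  let ?H = "hermitian_lborel :: ('a^'n::_^'n::_) measure"
  define C where "C = multi_Gamma ?D ?m (?D * (real ?n + \<nu>) / 2) /
        (pi powr (real ?m * real ?n * ?D / 2) * multi_Gamma ?D ?m (?D * \<nu> / 2))"
  define x where "x = - (?D * (real ?n + \<nu>) / 2)"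
  define e where "e = (real ?m - real ?n + 1) / 2 - 1 / ?D"
  define K where "K = gram_const ?D ?m ?n"
  \<comment> \<open>Written with \<open>edet\<close> so that it is Borel on all matrices; it agrees
    with the power of \<open>herm_det\<close> wherever \<open>mat 1 + F\<close> is positive
    definite.\<close>
  define g where "g F = ennreal (C * (edet ((*v) (mat 1 + F)) powr (1 / ?D)) powr x)" for F :: "'a^'n::_^'n::_"
  define k where "k F = ennreal (K * det_power_density e F)" for F :: "'a^'n::_^'n::_"
  have [measurable]: "g \<in> borel_measurable borel" "k \<in> borel_measurable borel"
    unfolding g_def[abs_def] k_def[abs_def] by measurable
  have Gm [measurable]: "(\<lambda>X :: 'a^'n::_^'m. conj_transpose X ** X) \<in> borel_measurable borel"
    unfolding conj_transpose_def matrix_matrix_mult_def by measurable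
  have sH: "sets ?H = sets borel" by (simp add: hermitian_lborel_def)
  have K: "K \<ge> 0"
    unfolding K_def using mn by (simp add: gram_const_nonneg)
  have T_dens: "ennreal (matricvariate_T_density ?D \<nu> X) = g (conj_transpose X ** X)" for X :: "'a^'n::_^'m"
  proof -
    have "mat 1 + conj_transpose X ** X \<in> pos_def_cone"
    proof (rule pos_def_cone_add_mat_1)
      show "conj_transpose (conj_transpose X ** X) = conj_transpose X ** X" by (simp add: conj_transpose_mult)
      show "x \<bullet> ((conj_transpose X ** X) *v x) \<ge> 0" for x
        by (simp add: matrix_vector_mul_assoc[symmetric] inner_matrix_mult[symmetric])
    qed
    then show ?thesis
      by (simp add: matricvariate_T_density_def Let_def herm_det_sylvester herm_det_eq_edet(1) g_def C_def x_def)
  qed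
  have B_dens: "ennreal (matricvariate_beta_II_density ?D ?m \<nu> F) = k F * g F" for F
  proof (cases "F \<in> pos_def_cone")
    case True
    then have F1: "mat 1 + F \<in> pos_def_cone"
    proof (intro pos_def_cone_add_mat_1)
      show "x \<bullet> (F *v x) \<ge> 0" for x
        using pos_def_coneD(2)[OF True, of x] by (cases "x = 0") auto
    qed (rule pos_def_coneD(1)[OF True])
    \<comment> \<open>\<open>DIM('a)\<close> times \<open>e\<close> is the exponent in the
      theorem.\<close>
    have p: "herm_det F powr (?D * (real ?m - real ?n + 1) / 2 - 1) = edet ((*v) F) powr e"
      by (simp add: herm_det_eq_edet(1)[OF True] powr_powr e_def diff_divide_distrib)
    have KC: "K * C = 1 / multi_Beta ?D ?n (?D * (\<nu> + real ?n - real ?m) / 2) (?D * real ?m / 2)"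
      unfolding K_def C_def using \<nu> mn by (intro beta_II_const) (auto simp: DIM_positive Suc_leI)
    have "matricvariate_beta_II_density ?D ?m \<nu> F = K * C * edet ((*v) F) powr e * (edet ((*v) (mat 1 + F)) powr (1 / ?D)) powr x"
      unfolding matricvariate_beta_II_density_def Let_def p herm_det_eq_edet(1)[OF F1] x_def[symmetric] KC
      using True by simp
    then have "matricvariate_beta_II_density ?D ?m \<nu> F = (K * det_power_density e F) * (C * (edet ((*v) (mat 1 + F)) powr (1 / ?D)) powr x)"
      using True by (simp add: det_power_density_def)
    then show ?thesis using K by (simp add: k_def g_def ennreal_mult')
  next
    case False
    then show ?thesis by (simp add: matricvariate_beta_II_density_def Let_def k_def det_power_density_def)
  qed
  have Tm: "T \<in> measurable M borel" and Td: "distr M lborel T = density lborel (\<lambda>X. g (conj_transpose X ** X))"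
    using T by (simp_all add: distributed_def T_dens)
  have Ym: "(\<lambda>\<omega>. conj_transpose (T \<omega>) ** T \<omega>) \<in> measurable M ?H"
    using measurable_compose[OF Tm Gm] by (simp add: measurable_cong_sets[OF refl sH])
  have "distr M ?H (\<lambda>\<omega>. conj_transpose (T \<omega>) ** T \<omega>) = density ?H (\<lambda>F. k F * g F)"
  proof (rule measure_eqI)
    fix A assume "A \<in> sets (distr M ?H (\<lambda>\<omega>. conj_transpose (T \<omega>) ** T \<omega>))"
    then have A [measurable]: "A \<in> sets borel" by (simp add: sH)
    have kg: "(\<lambda>F. k F * g F) \<in> borel_measurable ?H" by (simp add: measurable_cong_sets[OF sH refl])
    let ?V = "(\<lambda>X :: 'a^'n::_^'m. conj_transpose X ** X) -` A"
    have V: "?V \<in> sets borel" using measurable_sets[OF Gm A] by simp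
    have "emeasure (distr M ?H (\<lambda>\<omega>. conj_transpose (T \<omega>) ** T \<omega>)) A = emeasure (distr M lborel T) ?V"
      using A V Tm Ym by (simp add: emeasure_distr sH vimage_comp o_def vimage_def)
    also have "\<dots> = (\<integral>\<^sup>+X. g (conj_transpose X ** X) * indicator A (conj_transpose X ** X) \<partial>(lborel :: ('a^'n::_^'m) measure))"
      unfolding Td using V by (subst emeasure_density) (auto intro!: nn_integral_cong simp: indicator_def)
    \<comment> \<open>The factor \<open>k\<close> is the image density; all of
      \<open>g F * indicator A F\<close> is taken as the test function.\<close>
    also have "\<dots> = (\<integral>\<^sup>+F. k F * (g F * indicator A F) \<partial>?H)"
      unfolding k_def K_def e_def by (rule nn_integral_gram[OF mn, of "\<lambda>F. g F * indicator A F"]) measurable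
    also have "\<dots> = emeasure (density ?H (\<lambda>F. k F * g F)) A"
      using A kg by (subst emeasure_density) (simp_all add: sH mult.assoc)
    finally show "emeasure (distr M ?H (\<lambda>\<omega>. conj_transpose (T \<omega>) ** T \<omega>)) A = emeasure (density ?H (\<lambda>F. k F * g F)) A" .
  qed simp
  then show ?thesis using Ym by (simp add: distributed_def B_dens measurable_cong_sets[OF sH refl])
qed

text \<open>The value of \<beta> is the real dimension of the entry type, so each part is an
  instance of the preceding theorem.\<close>

theorem theorem2p3:
  fixes M :: "'w measure" and \<nu> :: real
    and T1 :: "'w \<Rightarrow> real^'n::{finite,linorder}^'m"
    and T2 :: "'w \<Rightarrow> complex^'n::{finite,linorder}^'m"
    and T4 :: "'w \<Rightarrow> quat^'n::{finite,linorder}^'m"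
  assumes "prob_space M"
    and "CARD('m) > CARD('n)"
  shows "(\<nu> > 1 * (real CARD('m) - 1) \<and>
        distributed M lborel T1 (\<lambda>X. ennreal (matricvariate_T_density 1 \<nu> X)) \<longrightarrow>
        distributed M hermitian_lborel (\<lambda>\<omega>. conj_transpose (T1 \<omega>) ** T1 \<omega>)
          (\<lambda>F. ennreal (matricvariate_beta_II_density 1 CARD('m) \<nu> F))) \<and>
      (\<nu> > 2 * (real CARD('m) - 1) \<and>
        distributed M lborel T2 (\<lambda>X. ennreal (matricvariate_T_density 2 \<nu> X)) \<longrightarrow>
        distributed M hermitian_lborel (\<lambda>\<omega>. conj_transpose (T2 \<omega>) ** T2 \<omega>)
          (\<lambda>F. ennreal (matricvariate_beta_II_density 2 CARD('m) \<nu> F))) \<and>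
      (\<nu> > 4 * (real CARD('m) - 1) \<and>
        distributed M lborel T4 (\<lambda>X. ennreal (matricvariate_T_density 4 \<nu> X)) \<longrightarrow>
        distributed M hermitian_lborel (\<lambda>\<omega>. conj_transpose (T4 \<omega>) ** T4 \<omega>)
          (\<lambda>F. ennreal (matricvariate_beta_II_density 4 CARD('m) \<nu> F)))"
proof (intro conjI impI; elim conjE)
  have mn: "CARD('n) \<le> CARD('m)" using assms(2) by simp
  show "distributed M hermitian_lborel (\<lambda>\<omega>. conj_transpose (T1 \<omega>) ** T1 \<omega>)
      (\<lambda>F. ennreal (matricvariate_beta_II_density 1 CARD('m) \<nu> F))"
    if "\<nu> > 1 * (real CARD('m) - 1)"
      "distributed M lborel T1 (\<lambda>X. ennreal (matricvariate_T_density 1 \<nu> X))"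
    using distributed_matricvariate_beta_II[of \<nu> M T1] mn that by simp
  show "distributed M hermitian_lborel (\<lambda>\<omega>. conj_transpose (T2 \<omega>) ** T2 \<omega>)
      (\<lambda>F. ennreal (matricvariate_beta_II_density 2 CARD('m) \<nu> F))"
    if "\<nu> > 2 * (real CARD('m) - 1)"
      "distributed M lborel T2 (\<lambda>X. ennreal (matricvariate_T_density 2 \<nu> X))"
    using distributed_matricvariate_beta_II[of \<nu> M T2] mn that by simp
  show "distributed M hermitian_lborel (\<lambda>\<omega>. conj_transpose (T4 \<omega>) ** T4 \<omega>)
      (\<lambda>F. ennreal (matricvariate_beta_II_density 4 CARD('m) \<nu> F))"
    if "\<nu> > 4 * (real CARD('m) - 1)"
      "distributed M lborel T4 (\<lambda>X. ennreal (matricvariate_T_density 4 \<nu> X))"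
    using distributed_matricvariate_beta_II[of \<nu> M T4] mn that by simp
qed

end
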